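(* Let $d\ge 1$, let $\Sigma=\mathbb{T}^d=(\mathbb{R}/\mathbb{Z})^d$, let $\mu$ be a Borel probability measure on $\Sigma$, and let $m$ be the Haar probability measure on $\mathbb{T}^d$. Let $S=\mathrm{supp}(\mu)\subset\mathbb{T}^d$ be the support of $\mu$. Consider the skew-product map $f(\{\beta_i\},\theta)=(\sigma\{\beta_i\},\theta+\beta_0)$, where $\sigma$ is the left shift $(\sigma\beta)_i=\beta_{i+1}$; the same expression defines $f$ both on $\Sigma^{\mathbb{Z}}\times\mathbb{T}^d$ and on $\Sigma^{\mathbb{N}}\times\mathbb{T}^d$. The following statements are equivalent: (1) $f$ (on $\Sigma^{\mathbb{Z}}\times\mathbb{T}^d$) is ergodic with respect to $\mu^{\mathbb{Z}}\times m$; (2) $f$ (on $\Sigma^{\mathbb{N}}\times\mathbb{T}^d$) is ergodic with respect to $\mu^{\mathbb{N}}\times m$; (3) every $m$-stationary observable $\varphi\in L^\infty(\mathbb{T}^d)$ is constant $m$-a.e.; (4) $\hat\mu(k)\neq 1$ for every $k\in\mathbb{Z}^d\setminus\{0\}$; (5) for every $k\in\mathbb{Z}^d\setminus\{0\}$ there exists $\alpha\in S$ such that $\langle k,\alpha\rangle\notin\mathbb{Z}$; (6) $\mathbb{T}^d=\overline{\bigcup_{n\ge1}S^n}$, where $S^1:=S$ and $S^n:=S+S^{n-1}$ for all $n\ge2$; (7) $m$ is the unique $\mu$-stationary measure in the set of Borel probability measures on $\mathbb{T}^d$; (8) $\displaystyle\lim_{n\to+\infty}\frac1n\sum_{j=0}^{n-1}(\mathcal{Q}_\mu^j\varphi)(\theta)=\int_{\mathbb{T}^d}\varphi\,dm$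 for all $\theta\in\mathbb{T}^d$ and all $\varphi\in C^0(\mathbb{T}^d)$.
   Context: Indexing: $\mathbb{N}=\{0,1,2,\dots\}$. The measures $\mu^{\mathbb{Z}}$ and $\mu^{\mathbb{N}}$ are the product measures; $f$ preserves $\mu^{\mathbb{Z}}\times m$ (respectively $\mu^{\mathbb{N}}\times m$). Markov operator: for $\varphi\in C^0(\mathbb{T}^d)$ or $\varphi\in L^\infty(\mathbb{T}^d)=L^\infty(\mathbb{T}^d,m)$, $(\mathcal{Q}_\mu\varphi)(\theta):=\int_{\mathbb{T}^d}\varphi(\theta+\alpha)\,d\mu(\alpha)$; $\mathcal{Q}_\mu^j$ is its $j$-th iterate ($\mathcal{Q}_\mu^0$ is the identity). Stationary measures: a Borel probability measure $\eta$ on $\mathbb{T}^d$ is $\mu$-stationary if $\mu*\eta=\eta$, where $(\mu*\eta)(E)=\int_{\mathbb{T}^d}\eta(E-\alpha)\,d\mu(\alpha)$ for Borel sets $E$. The Haar measure $m$ is always $\mu$-stationary. An observable $\varphi\colon\mathbb{T}^d\to\mathbb{R}$ is called $m$-stationary if $(\mathcal{Q}_\mu\varphi)(\theta)=\varphi(\theta)$ for $m$-a.e. $\theta\in\mathbb{T}^d$. Fourier coefficients: $\hat\mu(k):=\int_{\Sigma}e^{2\pi i\langle k,\alpha\rangle}\,d\mu(\alpha)$ for $k\in\mathbb{Z}^d$. The condition $\langle k,\alpha\rangle\in\mathbb{Z}$ for $\alpha\in\mathbb{T}^d$ is well defined since $\langle k,\alpha\rangle$ is well defined modulo $\mathbb{Z}$.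 *)

theory Defs
  imports "HOL-Probability.Probability"
begin

section \<open>The torus $(\mathbb{R}/\mathbb{Z})^d$\<close>

definition int_cong :: "real \<Rightarrow> real \<Rightarrow> bool"
  where "int_cong x y \<longleftrightarrow> x - y \<in> \<int>"

lemma equivp_int_cong: "equivp int_cong"
proof (rule equivpI)
  show "reflp int_cong"
    by (simp add: reflp_def int_cong_def)
  show "symp int_cong"
    unfolding symp_def int_cong_def using Ints_minus by fastforce
  show "transp int_cong"
    unfolding transp_def int_cong_def using Ints_add by fastforce
qed

quotient_type circle = real / int_cong
  morphisms rep_circle to_circle
  by (rule equivp_int_cong)

instantiation circle :: ab_group_add
begin

lift_definition zero_circle :: circle is 0 .

lift_definition plus_circle :: "circle \<Rightarrow> circle \<Rightarrow> circle" is "(+)"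
proof -
  fix x x' y y' :: real
  assume "int_cong x x'" "int_cong y y'"
  then have "(x - x') + (y - y') \<in> \<int>"
    unfolding int_cong_def by (rule Ints_add)
  then show "int_cong (x + y) (x' + y')"
    by (simp add: int_cong_def algebra_simps)
qed

lift_definition uminus_circle :: "circle \<Rightarrow> circle" is "uminus"
proof -
  fix x x' :: real
  assume "int_cong x x'"
  then have "- (x - x') \<in> \<int>"
    unfolding int_cong_def by (rule Ints_minus)
  then show "int_cong (- x) (- x')"
    by (simp add: int_cong_def algebra_simps)
qed

lift_definition minus_circle :: "circle \<Rightarrow> circle \<Rightarrow> circle" is "(-)"
proof -
  fix x x' y y' :: real
  assume "int_cong x x'" "int_cong y y'"
  then have "(x - x') - (y - y') \<in> \<int>"
    unfolding int_cong_def by (rule Ints_diff)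
  then show "int_cong (x - y) (x' - y')"
    by (simp add: int_cong_def algebra_simps)
qed

instance
  by standard (transfer; simp add: int_cong_def)+

end

text \<open>The quotient topology.\<close>

instantiation circle :: topological_space
begin

definition open_circle :: "circle set \<Rightarrow> bool"
  where "open_circle U \<longleftrightarrow> open (to_circle -` U)"

instance
proof
  show "open (UNIV :: circle set)"
    by (simp add: open_circle_def)
next
  fix S T :: "circle set"
  assume "open S" "open T"
  then show "open (S \<inter> T)"
    by (simp add: open_circle_def open_Int)
next
  fix K :: "circle set set"
  assume "\<forall>S\<in>K. open S"
  then show "open (\<Union>K)"
    by (auto simp: open_circle_def vimage_Union)
qed

end

type_synonym 'd torus = "circle ^ 'd"

lift_definition int_scale :: "int \<Rightarrow> circle \<Rightarrow> circle" is "\<lambda>n x. of_int n * x"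
  unfolding int_cong_def by (simp flip: right_diff_distrib)

text \<open>
  The pairing $\langle k,\alpha\rangle$ of $k\in\mathbb{Z}^d$ and $\alpha\in\mathbb{T}^d$ is only
  defined modulo $\mathbb{Z}$, so it takes values in the circle, and
  $\langle k,\alpha\rangle\in\mathbb{Z}$ reads \<open>int_pairing k \<alpha> = 0\<close>.
\<close>

definition int_pairing :: "int ^ 'd \<Rightarrow> 'd::finite torus \<Rightarrow> circle"
  where "int_pairing k \<alpha> = (\<Sum>i\<in>UNIV. int_scale (k $ i) (\<alpha> $ i))"

lift_definition exp_circle :: "circle \<Rightarrow> complex" is "\<lambda>x. exp (2 * of_real pi * \<i> * of_real x)"
proof -
  fix x y :: real
  assume "int_cong x y"
  then obtain n :: int where "x = y + of_int n"
    unfolding int_cong_def by (auto elim!: Ints_cases simp: algebra_simps)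
  then have "2 * of_real pi * \<i> * complex_of_real x =
      2 * of_real pi * \<i> * complex_of_real y + of_int (2 * n) * of_real pi * \<i>"
    by (simp add: algebra_simps)
  then show "exp (2 * of_real pi * \<i> * complex_of_real x) = exp (2 * of_real pi * \<i> * complex_of_real y)"
    by (auto simp: exp_eq)
qed

section \<open>Measures on the torus\<close>

definition borel_prob :: "'a::topological_space measure \<Rightarrow> bool"
  where "borel_prob \<mu> \<longleftrightarrow> prob_space \<mu> \<and> sets \<mu> = sets borel"

definition haar_prob :: "'a::{topological_space, ab_group_add} measure \<Rightarrow> bool"
  where "haar_prob m \<longleftrightarrow> borel_prob m \<and>
    (\<forall>\<alpha>. \<forall>E\<in>sets borel. emeasure m ((+) \<alpha> ` E) = emeasure m E)"

definition supp_measure :: "'a::topological_space measure \<Rightarrow> 'a set"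
  where "supp_measure \<mu> = {x. \<forall>U. open U \<longrightarrow> x \<in> U \<longrightarrow> emeasure \<mu> U > 0}"

definition fourier_coeff :: "'d::finite torus measure \<Rightarrow> int ^ 'd \<Rightarrow> complex"
  where "fourier_coeff \<mu> k = (\<integral>\<alpha>. exp_circle (int_pairing k \<alpha>) \<partial>\<mu>)"

definition stationary_measure ::
    "'a::{topological_space, ab_group_add} measure \<Rightarrow> 'a measure \<Rightarrow> bool"
  where "stationary_measure \<mu> \<eta> \<longleftrightarrow> borel_prob \<eta> \<and>
    (\<forall>E\<in>sets borel. (\<integral>\<^sup>+\<alpha>. emeasure \<eta> ((\<lambda>\<theta>. \<theta> - \<alpha>) ` E) \<partial>\<mu>) = emeasure \<eta> E)"

definition markov_op :: "'a::ab_group_add measure \<Rightarrow> ('a \<Rightarrow> real) \<Rightarrow> 'a \<Rightarrow> real"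
  where "markov_op \<mu> \<phi> \<theta> = (\<integral>\<alpha>. \<phi> (\<theta> + \<alpha>) \<partial>\<mu>)"

text \<open>Elements of $L^\infty$ are represented by functions, not by classes modulo null sets.\<close>

definition L_infty :: "'a measure \<Rightarrow> ('a \<Rightarrow> real) set"
  where "L_infty m = {\<phi> \<in> borel_measurable m. \<exists>C. AE \<theta> in m. \<bar>\<phi> \<theta>\<bar> \<le> C}"

definition stationary_observable ::
    "'a::ab_group_add measure \<Rightarrow> 'a measure \<Rightarrow> ('a \<Rightarrow> real) \<Rightarrow> bool"
  where "stationary_observable \<mu> m \<phi> \<longleftrightarrow> (AE \<theta> in m. markov_op \<mu> \<phi> \<theta> = \<phi> \<theta>)"

fun set_multiple :: "'a::ab_group_add set \<Rightarrow> nat \<Rightarrow> 'a set" where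
  "set_multiple S 0 = {0}"
| "set_multiple S (Suc 0) = S"
| "set_multiple S (Suc (Suc n)) = {a + b | a b. a \<in> S \<and> b \<in> set_multiple S (Suc n)}"

section \<open>Ergodicity and the skew product\<close>

definition ergodic :: "'a measure \<Rightarrow> ('a \<Rightarrow> 'a) \<Rightarrow> bool"
  where "ergodic M T \<longleftrightarrow>
    T \<in> measurable M M \<and> distr M M T = M \<and>
    (\<forall>A\<in>sets M. T -` A \<inter> space M = A \<longrightarrow> emeasure M A = 0 \<or> emeasure M (space M - A) = 0)"

text \<open>
  The index type \<open>'i\<close> is \<open>int\<close> for the two-sided and \<open>nat\<close> for the one-sided shift.  The torus is
  compact and metrizable, so the product \<open>\<sigma>\<close>-algebra is the Borel \<open>\<sigma>\<close>-algebra of the product space.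
\<close>

definition skew_product :: "('i::semiring_1 \<Rightarrow> 'a::ab_group_add) \<times> 'a \<Rightarrow> ('i \<Rightarrow> 'a) \<times> 'a"
  where "skew_product = (\<lambda>(\<beta>, \<theta>). (\<lambda>i. \<beta> (i + 1), \<theta> + \<beta> 0))"

definition skew_measure :: "'a measure \<Rightarrow> 'a measure \<Rightarrow> (('i \<Rightarrow> 'a) \<times> 'a) measure"
  where "skew_measure \<mu> m = PiM UNIV (\<lambda>_. \<mu>) \<Otimes>\<^sub>M m"

definition all_equivalent :: "bool list \<Rightarrow> bool"
  where "all_equivalent Ps \<longleftrightarrow> (\<forall>P\<in>set Ps. \<forall>Q\<in>set Ps. P \<longleftrightarrow> Q)"

section \<open>Existence of the Haar probability measure\<close>

definition to_torus :: "real ^ 'd \<Rightarrow> 'd::finite torus"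
  where "to_torus x = (\<chi> i. to_circle (x $ i))"

definition unit_cell :: "(real ^ 'd::finite) set"
  where "unit_cell = {x. \<forall>i. 0 \<le> x $ i \<and> x $ i < 1}"

definition torus_lebesgue :: "'d::finite torus measure"
  where "torus_lebesgue = distr (restrict_space lborel unit_cell) borel to_torus"

lemma to_circle_eq_iff: "to_circle x = to_circle y \<longleftrightarrow> x - y \<in> \<int>"
  using circle.abs_eq_iff int_cong_def by simp

lemma to_torus_add: "to_torus (x + y) = to_torus x + to_torus y"
  by (simp add: to_torus_def vec_eq_iff plus_circle.abs_eq)

lemma surj_to_torus: "\<exists>x. to_torus x = \<alpha>"
proof
  show "to_torus (\<chi> i. rep_circle (\<alpha> $ i)) = \<alpha>"
    by (simp add: to_torus_def vec_eq_iff Quotient3_abs_rep[OF Quotient3_circle])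
qed

lemma continuous_to_torus: "continuous_on UNIV (to_torus :: real ^ 'd \<Rightarrow> 'd::finite torus)"
proof -
  have "continuous_on UNIV to_circle"
    by (simp add: continuous_on_open_vimage open_circle_def)
  then have "continuous_on UNIV (\<lambda>x :: real ^ 'd. to_circle (x $ i))" for i
    by (rule continuous_on_compose2) (auto intro!: continuous_intros)
  then show ?thesis
    unfolding to_torus_def by (intro continuous_on_vec_lambda)
qed

lemma measurable_to_torus [measurable]: "to_torus \<in> borel_measurable borel"
  by (rule borel_measurable_continuous_onI[OF continuous_to_torus])

lemma unit_cell_borel [measurable]: "unit_cell \<in> sets borel"
  unfolding unit_cell_def by measurable

lemma emeasure_unit_cell: "emeasure lborel (unit_cell :: (real ^ 'd::finite) set) = 1"
proof (rule antisym)
  have "unit_cell \<subseteq> cbox (0 :: real ^ 'd) 1"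
    by (auto simp: unit_cell_def mem_box_cart less_imp_le)
  then have "emeasure lborel (unit_cell :: (real ^ 'd) set) \<le> emeasure lborel (cbox (0 :: real ^ 'd) 1)"
    by (rule emeasure_mono) simp
  also have "\<dots> = 1"
    by (subst emeasure_lborel_cbox) (auto simp: Basis_vec_def inner_axis intro!: prod.neutral)
  finally show "emeasure lborel (unit_cell :: (real ^ 'd) set) \<le> 1" .
  have "1 = emeasure lborel (box (0 :: real ^ 'd) 1)"
    by (subst emeasure_lborel_box) (auto simp: Basis_vec_def inner_axis intro!: prod.neutral)
  also have "\<dots> \<le> emeasure lborel (unit_cell :: (real ^ 'd) set)"
    by (rule emeasure_mono) (auto simp: unit_cell_def mem_box_cart less_imp_le)
  finally show "1 \<le> emeasure lborel (unit_cell :: (real ^ 'd) set)" .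
qed

lemma unit_cell_tiles: "\<exists>!k :: int ^ 'd. (x :: real ^ 'd::finite) + (\<chi> i. of_int (k $ i)) \<in> unit_cell"
proof (rule ex1I)
  show "x + (\<chi> i. of_int ((\<chi> i. - \<lfloor>x $ i\<rfloor>) $ i)) \<in> unit_cell"
  proof -
    have "0 \<le> x $ i - of_int \<lfloor>x $ i\<rfloor> \<and> x $ i - of_int \<lfloor>x $ i\<rfloor> < 1" for i
      by linarith
    then show ?thesis by (simp add: unit_cell_def)
  qed
next
  fix k :: "int ^ 'd"
  assume k: "x + (\<chi> i. of_int (k $ i)) \<in> unit_cell"
  have "k $ i = - \<lfloor>x $ i\<rfloor>" for i
  proof -
    have "0 \<le> x $ i + of_int (k $ i)" "x $ i + of_int (k $ i) < 1"
      using k by (auto simp: unit_cell_def)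
    then have "\<lfloor>x $ i\<rfloor> = - (k $ i)"
      by (intro floor_unique) auto
    then show ?thesis by simp
  qed
  then show "k = (\<chi> i. - \<lfloor>x $ i\<rfloor>)"
    by (simp add: vec_eq_iff)
qed

lemma to_torus_add_int: "to_torus (x + (\<chi> i. of_int (k $ i))) = to_torus x"
  by (simp add: to_torus_def vec_eq_iff to_circle_eq_iff)

lemma emeasure_lborel_shift:
  fixes c :: "'a::euclidean_space"
  assumes "A \<in> sets borel"
  shows "emeasure lborel ((+) c -` A) = emeasure lborel A"
proof -
  have "emeasure lborel A = emeasure (distr lborel borel ((+) c)) A"
    by (simp add: lborel_distr_plus)
  also have "\<dots> = emeasure lborel ((+) c -` A)"
    using assms by (subst emeasure_distr) auto
  finally show ?thesis by simp
qed

lemma emeasure_torus_lebesgue: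
  assumes "E \<in> sets borel"
  shows "emeasure torus_lebesgue E = emeasure lborel (to_torus -` E \<inter> unit_cell)"
proof -
  have "to_torus \<in> measurable (restrict_space lborel unit_cell) borel"
    by (intro measurable_restrict_space1) simp
  then show ?thesis
    unfolding torus_lebesgue_def using assms
    by (subst emeasure_distr) (auto simp: emeasure_restrict_space space_restrict_space)
qed

lemma haar_prob_torus_lebesgue: "haar_prob (torus_lebesgue :: 'd::finite torus measure)"
  unfolding haar_prob_def borel_prob_def
proof (intro conjI allI ballI)
  show sets: "sets (torus_lebesgue :: 'd torus measure) = sets borel"
    by (simp add: torus_lebesgue_def)
  show "prob_space (torus_lebesgue :: 'd torus measure)"
  proof
    have "space (torus_lebesgue :: 'd torus measure) = UNIV"
      by (simp add: torus_lebesgue_def)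
    then show "emeasure torus_lebesgue (space (torus_lebesgue :: 'd torus measure)) = 1"
      by (simp add: emeasure_torus_lebesgue emeasure_unit_cell)
  qed
  fix \<alpha> :: "'d torus" and E :: "'d torus set"
  assume E [measurable]: "E \<in> sets borel"
  obtain a where a: "to_torus a = \<alpha>"
    using surj_to_torus by blast
  define P where "P = to_torus -` E"
  define v :: "int ^ 'd \<Rightarrow> real ^ 'd" where "v k = (\<chi> i. of_int (k $ i))" for k
  have P [measurable]: "P \<in> sets borel"
    unfolding P_def using measurable_sets[OF measurable_to_torus E] by simp
  have P_int: "x + v k \<in> P \<longleftrightarrow> x \<in> P" for x k
    unfolding P_def v_def by (simp add: to_torus_add_int)
  have tile: "\<exists>!k. x + v k \<in> unit_cell" for x
    unfolding v_def by (rule unit_cell_tiles)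
  have shift [measurable]: "(\<lambda>x. x + c) -` A \<in> sets borel" if "A \<in> sets borel" for c :: "real ^ 'd" and A
    using measurable_sets[of "\<lambda>x. x + c" borel borel A] that by simp
  have image: "(+) \<alpha> ` E = (\<lambda>\<theta>. \<theta> - \<alpha>) -` E"
    by (auto simp: image_iff) (metis add.commute diff_add_cancel)
  have "continuous_on UNIV (\<lambda>\<theta>. \<theta> - \<alpha>)"
  proof -
    have circ: "continuous_on UNIV (\<lambda>x. x - c)" for c :: circle
      unfolding continuous_on_open_vimage[OF open_UNIV]
    proof (intro allI impI)
      fix B :: "circle set" assume B: "open B"
      have "to_circle -` ((\<lambda>x. x - c) -` B) = (\<lambda>x. x - rep_circle c) -` (to_circle -` B)"
        using minus_circle.abs_eq[of _ "rep_circle c"]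
        by (auto simp: Quotient3_abs_rep[OF Quotient3_circle])
      moreover have "open ((\<lambda>x. x - rep_circle c) -` (to_circle -` B))"
        by (rule open_vimage) (use B in \<open>auto simp: open_circle_def intro!: continuous_intros\<close>)
      ultimately show "open ((\<lambda>x. x - c) -` B \<inter> UNIV)"
        by (simp add: open_circle_def)
    qed
    have "continuous_on UNIV (\<lambda>\<theta>. \<theta> $ i - \<alpha> $ i)" for i
      by (rule continuous_on_compose2[OF circ]) (auto intro!: continuous_intros)
    then have "continuous_on UNIV (\<lambda>\<theta>. \<chi> i. \<theta> $ i - \<alpha> $ i)"
      by (intro continuous_on_vec_lambda)
    then show ?thesis
      by (simp add: minus_vec_def)
  qed
  then have "(\<lambda>\<theta>. \<theta> - \<alpha>) \<in> borel_measurable borel"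
    by (rule borel_measurable_continuous_onI)
  then have img: "(+) \<alpha> ` E \<in> sets borel"
    unfolding image using measurable_sets[of _ borel borel E] E by simp
  have "to_torus x - \<alpha> = to_torus (x - a)" for x
    using to_torus_add[of "x - a" a] a by simp
  then have pre: "to_torus -` ((+) \<alpha> ` E) = (\<lambda>x. x + - a) -` P"
    unfolding image P_def by auto
  define A where "A k = (\<lambda>x. x + - a) -` P \<inter> unit_cell \<inter> (\<lambda>x. x + (v k - a)) -` unit_cell" for k
  define B where "B k = P \<inter> unit_cell \<inter> (\<lambda>x. x + (a - v k)) -` unit_cell" for k
  have A [measurable]: "A k \<in> sets lborel" for k
    unfolding A_def by (auto intro!: sets.Int shift)
  have B [measurable]: "B k \<in> sets lborel" for k
    unfolding B_def by (auto intro!: sets.Int shift)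
  have cover_A: "(\<lambda>x. x + - a) -` P \<inter> unit_cell = (\<Union>k. A k)"
  proof -
    have "\<exists>k. x + (v k - a) \<in> unit_cell" for x
      using tile[of "x - a"] by (auto simp: algebra_simps)
    then show ?thesis unfolding A_def by auto
  qed
  have v_uminus: "v (- k) = - v k" for k
    by (simp add: v_def vec_eq_iff)
  have cover_B: "P \<inter> unit_cell = (\<Union>k. B k)"
  proof -
    have "\<exists>k. x + (a - v k) \<in> unit_cell" for x
    proof -
      obtain k where "x + a + v k \<in> unit_cell"
        using tile[of "x + a"] by blast
      then have "x + (a - v (- k)) \<in> unit_cell"
        by (simp add: v_uminus algebra_simps)
      then show ?thesis ..
    qed
    then show ?thesis unfolding B_def by auto
  qed
  have disj_A: "disjoint_family A"
    unfolding disjoint_family_on_def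
  proof (intro ballI impI)
    fix k l :: "int ^ 'd" assume "k \<noteq> l"
    show "A k \<inter> A l = {}"
    proof (rule ccontr)
      assume "A k \<inter> A l \<noteq> {}"
      then obtain x where "(x - a) + v k \<in> unit_cell" "(x - a) + v l \<in> unit_cell"
        unfolding A_def by (auto simp: algebra_simps)
      then show False using tile[of "x - a"] \<open>k \<noteq> l\<close> by blast
    qed
  qed
  have disj_B: "disjoint_family B"
    unfolding disjoint_family_on_def
  proof (intro ballI impI)
    fix k l :: "int ^ 'd" assume "k \<noteq> l"
    show "B k \<inter> B l = {}"
    proof (rule ccontr)
      assume "B k \<inter> B l \<noteq> {}"
      then obtain x where "(x + a) + v (- k) \<in> unit_cell" "(x + a) + v (- l) \<in> unit_cell"
        unfolding B_def by (auto simp: algebra_simps v_uminus)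
      then show False using tile[of "x + a"] \<open>k \<noteq> l\<close> by (metis neg_equal_iff_equal)
    qed
  qed
  have eq: "emeasure lborel (A k) = emeasure lborel (B k)" for k
  proof -
    have "(+) (a - v k) -` A k = B k"
    proof (rule set_eqI)
      fix x
      have "(a - v k) + x + - a = x + v (- k)" "(a - v k) + x + (v k - a) = x"
        by (simp_all add: v_uminus)
      then show "x \<in> (+) (a - v k) -` A k \<longleftrightarrow> x \<in> B k"
        unfolding A_def B_def vimage_eq Int_iff
        by (metis P_int add.commute)
    qed
    then show ?thesis
      using emeasure_lborel_shift[of "A k" "a - v k"] A by simp
  qed
  have "emeasure torus_lebesgue ((+) \<alpha> ` E) = emeasure lborel (\<Union>k. A k)"
    using img by (simp add: emeasure_torus_lebesgue pre cover_A[symmetric])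
  also have "\<dots> = (\<integral>\<^sup>+k. emeasure lborel (A k) \<partial>count_space UNIV)"
    by (rule emeasure_UN_countable) (use A disj_A in auto)
  also have "\<dots> = (\<integral>\<^sup>+k. emeasure lborel (B k) \<partial>count_space UNIV)"
    by (simp add: eq)
  also have "\<dots> = emeasure lborel (\<Union>k. B k)"
    by (rule emeasure_UN_countable[symmetric]) (use B disj_B in auto)
  also have "\<dots> = emeasure torus_lebesgue E"
    by (simp add: emeasure_torus_lebesgue cover_B[symmetric] P_def[symmetric])
  finally show "emeasure torus_lebesgue ((+) \<alpha> ` E) = emeasure torus_lebesgue E" .
qed

end

theory Submission
  imports Defs
begin

text \<open>
  Everything is decided by the characters \<open>e\<^sub>k = character k\<close>. The Markov operator \<open>Q\<close> multiplies
  \<open>e\<^sub>k\<close> by the number \<open>z\<^sub>k = fourier_coeff \<mu> k\<close>, which has modulus at most one. So if \<open>z\<^sub>k \<noteq> 1\<close> the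
  averages of \<open>Q\<^sup>j e\<^sub>k\<close> tend to zero, and if \<open>z\<^sub>k = 1\<close> then \<open>e\<^sub>k = 1\<close> almost everywhere for \<open>\<mu>\<close>,
  hence on the whole support \<open>S\<close> of \<open>\<mu>\<close>.

  Suppose first that \<open>z\<^sub>k \<noteq> 1\<close> for all \<open>k \<noteq> 0\<close>. Finite combinations of characters are uniformly
  dense among the continuous functions (\<open>trig_poly_dense\<close>), and \<open>Q\<close> is a contraction for the
  supremum norm; therefore the averages of \<open>Q\<^sup>j \<phi>\<close> converge to the Haar integral of \<open>\<phi>\<close>
  (\<open>averages_converge\<close>). Density also shows that a Borel probability measure is determined by its
  Fourier coefficients (\<open>fourier_coeff_unique\<close>). Stationarity of a measure, or of an observable,
  says that its \<open>k\<close>-th coefficient is fixed under multiplication by \<open>z\<^sub>k\<close>, or by its conjugate, and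
  so vanishes for \<open>k \<noteq> 0\<close>; thus the measure is Haar (\<open>stationary_measure_unique\<close>) and the observable
  is constant (\<open>stationary_observable_const\<close>). Conversely, if \<open>z\<^sub>k = 1\<close> for some \<open>k \<noteq> 0\<close>, then \<open>e\<^sub>k\<close>
  is invariant under the random walk: \<open>1 + Re e\<^sub>k\<close> is the density of a second stationary measure,
  the set where \<open>Re e\<^sub>k > 0\<close> lifts to a nontrivial almost invariant set of the skew product, and all
  sums of elements of \<open>S\<close> lie in the proper closed subgroup where \<open>e\<^sub>k = 1\<close>.

  The sums of elements of \<open>S\<close> are dense because of the averages, without any structure theory of
  closed subgroups: a walk started at \<open>0\<close> stays in the closure \<open>F\<close> of these sums after its first
  step, so for a continuous function that vanishes exactly on \<open>F\<close> the averages at \<open>0\<close> tend to zero;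
  its Haar integral is then zero, and \<open>F\<close> is everything because nonempty open sets have positive
  Haar measure.

  For the one-sided skew product let \<open>A\<close> be invariant. Integrating its indicator over the noise
  gives a stationary observable, hence a constant. Invariance under \<open>n\<close> steps replaces the noise by
  its tail after time \<open>n\<close>, so \<open>A\<close> is independent of every cylinder that depends on the first \<open>n\<close>
  coordinates, and therefore of itself (\<open>observables_const_imp_ergodic_one_sided\<close>). In the two-sided
  system \<open>A\<close> may depend on the past, and this argument breaks down. But condition the measure on \<open>A\<close>
  and forget the past: the result is invariant under the one-sided system and absolutely continuous,
  so by ergodicity it is the product measure (\<open>ergodic_unique_invariant_density\<close>). Every two-sided
  cylinder is moved into the future by finitely many steps; hence conditioning on \<open>A\<close> changes
  nothing, and \<open>A\<close> has full measure.
\<close>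

section \<open>Topology and Borel structure of the torus\<close>

lemma exp_circle_to_circle: "exp_circle (to_circle x) = exp (2 * of_real pi * \<i> * of_real x)"
  by (rule exp_circle.abs_eq)

lemma exp_circle_0 [simp]: "exp_circle 0 = 1"
  by transfer simp

lemma exp_circle_add: "exp_circle (a + b) = exp_circle a * exp_circle b"
  by transfer (simp add: exp_add[symmetric] algebra_simps)

lemma exp_circle_uminus: "exp_circle (- a) = cnj (exp_circle a)"
  by transfer (simp add: exp_cnj)

lemma norm_exp_circle [simp]: "norm (exp_circle a) = 1"
  by transfer simp

lemma exp_circle_nonzero [simp]: "exp_circle a \<noteq> 0"
  using norm_exp_circle[of a] by force

lemma exp_circle_eq_iff: "exp_circle a = exp_circle b \<longleftrightarrow> a = b"
proof (transfer, unfold int_cong_def)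
  fix x y :: real
  have "exp (2 * complex_of_real pi * \<i> * x) = exp (2 * complex_of_real pi * \<i> * y) \<longleftrightarrow>
      (\<exists>n::int. 2 * pi * x = 2 * pi * y + 2 * of_int n * pi)"
    unfolding exp_eq by (simp add: complex_eq_iff mult_ac)
  also have "\<dots> \<longleftrightarrow> (\<exists>n::int. x - y = of_int n)"
  proof (intro ex_cong1)
    fix n :: int
    have "2 * pi * x = 2 * pi * y + 2 * of_int n * pi \<longleftrightarrow> 2 * pi * x = 2 * pi * (y + of_int n)"
      by (simp add: algebra_simps)
    also have "\<dots> \<longleftrightarrow> x = y + of_int n"
      by simp
    finally show "2 * pi * x = 2 * pi * y + 2 * of_int n * pi \<longleftrightarrow> x - y = of_int n"
      by linarith
  qed
  also have "\<dots> \<longleftrightarrow> x - y \<in> \<int>"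
    by (auto elim!: Ints_cases)
  finally show "exp (2 * complex_of_real pi * \<i> * x) = exp (2 * complex_of_real pi * \<i> * y) \<longleftrightarrow> x - y \<in> \<int>" .
qed

lemma exp_circle_int_scale: "exp_circle (int_scale n a) = exp_circle a powi n"
proof (transfer)
  fix n :: int and x :: real
  show "exp (2 * complex_of_real pi * \<i> * complex_of_real (real_of_int n * x)) =
        exp (2 * complex_of_real pi * \<i> * complex_of_real x) powi n"
    by (subst exp_power_int) (simp add: mult_ac)
qed

lemma continuous_exp_circle: "continuous_on UNIV exp_circle"
proof -
  have "open (to_circle -` (exp_circle -` U))" if "open U" for U
  proof -
    have "continuous_on UNIV (\<lambda>x::real. exp_circle (to_circle x))"
      unfolding exp_circle_to_circle by (intro continuous_intros)
    then have "open ((\<lambda>x. exp_circle (to_circle x)) -` U)"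
      using that by (simp add: continuous_on_open_vimage)
    then show ?thesis by (simp add: vimage_def)
  qed
  then show ?thesis
    by (simp add: continuous_on_open_vimage open_circle_def)
qed

text \<open>
  The torus is the continuous image of the closed unit cube, since every point has a representative
  in the unit cell.
\<close>

lemma compact_torus: "compact (UNIV :: 'd::finite torus set)"
proof -
  have "\<exists>x\<in>cbox 0 1. to_torus x = \<theta>" for \<theta> :: "'d torus"
  proof -
    obtain y where y: "to_torus y = \<theta>"
      using surj_to_torus by blast
    obtain k where "y + (\<chi> i. of_int (k $ i)) \<in> unit_cell"
      using unit_cell_tiles by blast
    moreover have "unit_cell \<subseteq> cbox (0 :: real ^ 'd) 1"
      by (auto simp: unit_cell_def mem_box_cart less_imp_le)
    ultimately show ?thesis
      using y to_torus_add_int by blast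
  qed
  then have "(UNIV :: 'd torus set) = to_torus ` cbox 0 1"
    by (auto simp: image_iff) metis
  moreover have "compact (to_torus ` cbox (0 :: real ^ 'd) 1)"
    by (intro compact_continuous_image continuous_on_subset[OF continuous_to_torus] compact_cbox) simp
  ultimately show ?thesis by simp
qed

text \<open>
  The quotient topology comes without a metric. By compactness this map into a Euclidean space is a
  closed embedding, and it is used to import metric and Borel facts.
\<close>

definition torus_emb :: "'d::finite torus \<Rightarrow> complex ^ 'd"
  where "torus_emb \<theta> = (\<chi> i. exp_circle (\<theta> $ i))"

lemma inj_torus_emb: "inj torus_emb"
  by (auto simp: inj_def torus_emb_def vec_eq_iff exp_circle_eq_iff)

lemma continuous_exp_component: "continuous_on UNIV (\<lambda>\<theta> :: 'd::finite torus. exp_circle (\<theta> $ i))"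
  by (rule continuous_on_compose2[OF continuous_exp_circle]) (auto intro!: continuous_intros)

lemma continuous_torus_emb: "continuous_on UNIV (torus_emb :: 'd::finite torus \<Rightarrow> _)"
  unfolding torus_emb_def by (intro continuous_on_vec_lambda continuous_exp_component)

lemma closed_torus_emb:
  assumes "closed F"
  shows "closed (torus_emb ` F)"
proof -
  have "compact F"
    using compact_Int_closed[OF compact_torus assms] by simp
  then show ?thesis
    by (intro compact_imp_closed compact_continuous_image continuous_on_subset[OF continuous_torus_emb]) auto
qed

lemma open_torusE:
  assumes "open (U :: 'd::finite torus set)"
  obtains V where "open V" "U = torus_emb -` V"
proof
  show "open (- torus_emb ` (- U))"
    using closed_torus_emb[of "- U"] assms by (simp add: open_Compl closed_Compl)
  show "U = torus_emb -` (- torus_emb ` (- U))"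
    using inj_torus_emb by (auto simp: inj_def)
qed

text \<open>
  All open sets are preimages under \<open>torus_emb\<close>, so measurability may be tested on its components.
  In particular addition is measurable on the product \<open>\<sigma>\<close>-algebra, thanks to the second countability
  of the Euclidean space.
\<close>

lemma borel_measurable_torusI:
  fixes f :: "'a \<Rightarrow> 'd::finite torus"
  assumes "\<And>i. (\<lambda>x. exp_circle (f x $ i)) \<in> borel_measurable M"
  shows "f \<in> borel_measurable M"
proof (rule borel_measurableI)
  fix U :: "'d torus set" assume "open U"
  then obtain V where V: "open V" "U = torus_emb -` V"
    by (rule open_torusE)
  have "(\<lambda>x. torus_emb (f x)) \<in> borel_measurable M"
  proof (rule borel_measurable_euclidean_space[THEN iffD2], rule ballI)
    fix b :: "complex ^ 'd" assume "b \<in> Basis"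
    then obtain i u where b: "b = axis i u" "u \<in> Basis"
      by (auto simp: Basis_vec_def)
    have "(\<lambda>x. torus_emb (f x) \<bullet> b) = (\<lambda>x. exp_circle (f x $ i) \<bullet> u)"
      unfolding b torus_emb_def inner_axis by simp
    then show "(\<lambda>x. torus_emb (f x) \<bullet> b) \<in> borel_measurable M"
      using assms[of i] by (simp add: borel_measurable_inner)
  qed
  then have "(\<lambda>x. torus_emb (f x)) -` V \<inter> space M \<in> sets M"
    using V by measurable
  then show "f -` U \<inter> space M \<in> sets M"
    unfolding V by (simp add: vimage_def)
qed

lemma borel_measurable_exp_component [measurable (raw)]:
  fixes f :: "'a \<Rightarrow> 'd::finite torus"
  assumes "f \<in> borel_measurable M"
  shows "(\<lambda>x. exp_circle (f x $ i)) \<in> borel_measurable M"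
  using measurable_compose[OF assms borel_measurable_continuous_onI[OF continuous_exp_component[of i]]] .

lemma borel_measurable_torus_add [measurable (raw)]:
  fixes f g :: "'a \<Rightarrow> 'd::finite torus"
  assumes [measurable]: "f \<in> borel_measurable M" "g \<in> borel_measurable M"
  shows "(\<lambda>x. f x + g x) \<in> borel_measurable M"
  by (rule borel_measurable_torusI) (simp add: exp_circle_add)

lemma continuous_torus_add_const: "continuous_on UNIV (\<lambda>\<theta> :: 'd::finite torus. \<theta> + \<alpha>)"
  unfolding continuous_on_open_vimage[OF open_UNIV]
proof (intro allI impI)
  fix U :: "'d torus set" assume "open U"
  then obtain V where V: "open V" "U = torus_emb -` V"
    by (rule open_torusE)
  have "continuous_on UNIV (\<lambda>\<theta> :: 'd torus. torus_emb (\<theta> + \<alpha>))"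
    unfolding torus_emb_def
    by (intro continuous_on_vec_lambda) (auto simp: exp_circle_add intro!: continuous_intros continuous_exp_component)
  from open_vimage[OF V(1) this] show "open ((\<lambda>\<theta>. \<theta> + \<alpha>) -` U \<inter> UNIV)"
    unfolding V by (simp add: vimage_def)
qed

lemma continuous_torus_bounded:
  fixes \<phi> :: "'d::finite torus \<Rightarrow> real"
  assumes "continuous_on UNIV \<phi>"
  obtains C where "\<And>\<theta>. \<bar>\<phi> \<theta>\<bar> \<le> C"
proof -
  have "compact (range \<phi>)"
    using compact_continuous_image[OF assms compact_torus] .
  then obtain C where "\<forall>x\<in>range \<phi>. norm x \<le> C"
    using compact_imp_bounded bounded_iff by blast
  then show ?thesis
    by (intro that[of C]) auto
qed

text \<open>
  The complement of the support is covered by the null sets among the preimages of a countable base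
  of the Euclidean space.
\<close>

lemma AE_supp_measure:
  fixes \<mu> :: "'d::finite torus measure"
  assumes "sets \<mu> = sets borel"
  shows "AE \<alpha> in \<mu>. \<alpha> \<in> supp_measure \<mu>"
proof -
  obtain \<B> :: "(complex ^ 'd) set set" where B: "countable \<B>" "topological_basis \<B>"
    using ex_countable_basis by blast
  define N where "N = {V \<in> \<B>. emeasure \<mu> (torus_emb -` V) = 0}"
  have "AE \<alpha> in \<mu>. \<forall>V\<in>N. \<alpha> \<notin> torus_emb -` V"
  proof (subst AE_ball_countable, goal_cases)
    case 1 then show ?case using B by (auto simp: N_def)
  next
    case 2
    have "torus_emb -` V \<in> null_sets \<mu>" if "V \<in> N" for V
    proof -
      have "open (torus_emb -` V)"
        using that B open_vimage[OF _ continuous_torus_emb] topological_basis_open by (auto simp: N_def)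
      then show ?thesis using that assms by (auto simp: N_def)
    qed
    then show ?case using AE_not_in by blast
  qed
  then show ?thesis
  proof (rule AE_mp, intro AE_I2 impI)
    fix \<alpha> assume *: "\<forall>V\<in>N. \<alpha> \<notin> torus_emb -` V"
    show "\<alpha> \<in> supp_measure \<mu>"
      unfolding supp_measure_def
    proof (intro CollectI allI impI, rule ccontr)
      fix U :: "'d torus set" assume U: "open U" "\<alpha> \<in> U" "\<not> emeasure \<mu> U > 0"
      then obtain V where V: "open V" "U = torus_emb -` V"
        by (auto elim: open_torusE)
      with U B obtain W where W: "W \<in> \<B>" "torus_emb \<alpha> \<in> W" "W \<subseteq> V"
        using topological_basisE by (metis vimageE)
      have "emeasure \<mu> (torus_emb -` W) \<le> emeasure \<mu> U"
        using W V U assms by (intro emeasure_mono) (auto intro: borel_open)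
      then have "W \<in> N" using W U by (auto simp: N_def not_less)
      then show False using * W by auto
    qed
  qed
qed

lemma supp_subset_closed:
  assumes "closed F" "AE \<alpha> in \<mu>. \<alpha> \<in> F" "sets \<mu> = sets borel"
  shows "supp_measure \<mu> \<subseteq> F"
proof (rule ccontr)
  assume "\<not> ?thesis"
  then obtain x where "x \<in> supp_measure \<mu>" "x \<in> - F" by auto
  then have "emeasure \<mu> (- F) > 0"
    using assms(1) unfolding supp_measure_def by auto
  moreover have "- F \<in> sets \<mu>" using assms by (simp add: borel_closed)
  then have "emeasure \<mu> (- F) = 0"
    using assms(2) by (subst AE_iff_measurable[symmetric, where P="\<lambda>\<alpha>. \<alpha> \<in> F"])
      (use assms(3) sets_eq_imp_space_eq[OF assms(3)] in auto)
  ultimately show False by simp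
qed

section \<open>Characters and trigonometric polynomials\<close>

definition character :: "int ^ 'd \<Rightarrow> 'd::finite torus \<Rightarrow> complex"
  where "character k \<theta> = exp_circle (int_pairing k \<theta>)"

lemma exp_circle_sum: "exp_circle (sum f A) = (\<Prod>i\<in>A. exp_circle (f i))"
  by (induction A rule: infinite_finite_induct) (auto simp: exp_circle_add)

lemma character_eq_prod: "character k \<theta> = (\<Prod>i\<in>UNIV. exp_circle (\<theta> $ i) powi (k $ i))"
  by (simp add: character_def int_pairing_def exp_circle_sum exp_circle_int_scale)

lemma character_eq_1_iff: "character k \<theta> = 1 \<longleftrightarrow> int_pairing k \<theta> = 0"
  unfolding character_def using exp_circle_eq_iff[of _ 0] by simp

lemma fourier_coeff_eq: "fourier_coeff \<mu> k = (\<integral>\<alpha>. character k \<alpha> \<partial>\<mu>)"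
  by (simp add: fourier_coeff_def character_def)

lemma norm_character [simp]: "norm (character k \<theta>) = 1"
  by (simp add: character_def)

lemma character_0 [simp]: "character 0 \<theta> = 1" "character k 0 = 1"
  by (simp_all add: character_eq_prod)

lemma character_add: "character k (\<theta> + \<alpha>) = character k \<theta> * character k \<alpha>"
  by (simp add: character_eq_prod exp_circle_add power_int_mult_distrib prod.distrib)

lemma character_plus: "character (k + l) \<theta> = character k \<theta> * character l \<theta>"
  by (simp add: character_eq_prod power_int_add prod.distrib)

lemma character_uminus: "character (- k) \<theta> = cnj (character k \<theta>)"
proof -
  have *: "inverse z = cnj z" if "norm z = 1" for z :: complex
  proof (rule inverse_unique)
    show "z * cnj z = 1"
      using that by (simp flip: complex_norm_square)
  qed
  have "exp_circle a powi (- n) = cnj (exp_circle a powi n)" for a n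
    by (subst power_int_minus, rule *) (simp add: norm_power_int)
  then show ?thesis
    by (simp add: character_eq_prod)
qed

lemma character_uminus_arg: "character k (- \<theta>) = cnj (character k \<theta>)"
proof -
  have "character k \<theta> * character k (- \<theta>) = character k \<theta> * cnj (character k \<theta>)"
    using character_add[of k \<theta> "- \<theta>"] character_plus[of k "- k" \<theta>] by (simp add: character_uminus)
  moreover have "character k \<theta> \<noteq> 0"
    using norm_character[of k \<theta>] by force
  ultimately show ?thesis by simp
qed

lemma continuous_character: "continuous_on UNIV (character k)"
  unfolding character_eq_prod[abs_def]
  by (intro continuous_on_prod continuous_on_power_int continuous_exp_component) auto

lemma borel_measurable_character [measurable]: "character k \<in> borel_measurable borel"
  by (rule borel_measurable_continuous_onI[OF continuous_character])

text \<open>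
  Half a period in a coordinate with \<open>k $ i \<noteq> 0\<close> turns the character by the angle \<open>\<pi>\<close>.
\<close>

lemma character_nontrivial:
  assumes "k \<noteq> 0"
  obtains \<alpha> where "character k \<alpha> = - 1"
proof -
  obtain i where i: "k $ i \<noteq> 0"
    using assms by (auto simp: vec_eq_iff)
  define x where "x = 1 / (2 * real_of_int (k $ i))"
  have *: "exp_circle (to_circle x) powi (k $ i) = -1"
  proof -
    have "real_of_int (k $ i) * x = 1 / 2"
      using i by (simp add: x_def)
    then have "of_int (k $ i) * complex_of_real x = 1 / 2"
      by (metis of_real_mult of_real_of_int_eq of_real_1 of_real_divide of_real_numeral)
    then have "of_int (k $ i) * (2 * complex_of_real pi * \<i> * complex_of_real x) = of_real pi * \<i>"
      by (simp only: mult.left_commute[of "of_int (k $ i)"] mult.assoc) simp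
    then show ?thesis
      by (simp only: exp_circle_to_circle exp_power_int exp_pi_i)
  qed
  have "character k (axis i (to_circle x)) = (\<Prod>j\<in>UNIV. if j = i then -1 else 1)"
    unfolding character_eq_prod by (intro prod.cong) (auto simp: axis_def *)
  then show ?thesis
    using that by simp
qed

lemma character_axis: "character (axis i 1) \<theta> = exp_circle (\<theta> $ i)"
proof -
  have "character (axis i 1) \<theta> = (\<Prod>j\<in>UNIV. if j = i then exp_circle (\<theta> $ i) else 1)"
    unfolding character_eq_prod by (intro prod.cong) (auto simp: axis_def)
  then show ?thesis by simp
qed

text \<open>
  An inductive set rather than a finite sum over frequencies: the properties of trigonometric
  polynomials needed below are additive, so each follows by induction from the case of one
  character.
\<close>

inductive_set trig_poly :: "('d::finite torus \<Rightarrow> complex) set" where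
  monomial: "(\<lambda>\<theta>. c * character k \<theta>) \<in> trig_poly"
| sum: "p \<in> trig_poly \<Longrightarrow> q \<in> trig_poly \<Longrightarrow> (\<lambda>\<theta>. p \<theta> + q \<theta>) \<in> trig_poly"

lemma trig_poly_mult:
  assumes "p \<in> trig_poly" "q \<in> trig_poly"
  shows "(\<lambda>\<theta>. p \<theta> * q \<theta>) \<in> trig_poly"
  using assms(1)
proof induction
  case (monomial c k)
  show ?case
    using assms(2)
  proof induction
    case (monomial c' k')
    then show ?case
      using trig_poly.monomial[of "c * c'" "k + k'"] by (simp add: character_plus mult_ac)
  qed (simp add: trig_poly.sum distrib_left)
qed (simp add: trig_poly.sum distrib_right)

lemma trig_poly_cnj: "p \<in> trig_poly \<Longrightarrow> (\<lambda>\<theta>. cnj (p \<theta>)) \<in> trig_poly"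
proof (induction rule: trig_poly.induct)
  case (monomial c k)
  then show ?case
    using trig_poly.monomial[of "cnj c" "- k"] by (simp add: character_uminus)
qed (simp add: trig_poly.sum)

text \<open>
  The Stone-Weierstrass theorem, applied on the image of the torus under \<open>torus_emb\<close>, which is a
  compact Hausdorff space. The characters of the coordinate frequencies already separate points.
\<close>

lemma trig_poly_dense:
  fixes \<phi> :: "'d::finite torus \<Rightarrow> real"
  assumes "continuous_on UNIV \<phi>" "\<epsilon> > 0"
  obtains p where "p \<in> trig_poly" "\<And>\<theta>. \<bar>\<phi> \<theta> - Re (p \<theta>)\<bar> < \<epsilon>"
proof -
  let ?inv = "inv (torus_emb :: 'd torus \<Rightarrow> _)"
  let ?R = "{\<lambda>z. Re (p (?inv z)) |p. p \<in> trig_poly}"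
  have inv [simp]: "?inv (torus_emb \<theta>) = \<theta>" for \<theta>
    by (simp add: inj_torus_emb)
  have cont_inv: "continuous_on (range torus_emb) ?inv"
    by (rule continuous_on_inv[OF continuous_torus_emb compact_torus]) simp
  interpret function_ring_on ?R "range torus_emb"
  proof
    show "compact (range (torus_emb :: 'd torus \<Rightarrow> _))"
      by (rule compact_continuous_image[OF continuous_torus_emb compact_torus])
  next
    fix f assume "f \<in> ?R"
    then obtain p where p: "f = (\<lambda>z. Re (p (?inv z)))" "p \<in> trig_poly" by auto
    from p(2) have "continuous_on UNIV p"
      by induction (auto intro!: continuous_intros continuous_character)
    then show "continuous_on (range torus_emb) f"
      unfolding p by (intro continuous_intros continuous_on_compose2[OF _ cont_inv]) auto
  next
    fix f g
    assume "f \<in> ?R" "g \<in> ?R"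
    then obtain p q where p: "f = (\<lambda>z. Re (p (?inv z)))" "p \<in> trig_poly" and q: "g = (\<lambda>z. Re (q (?inv z)))" "q \<in> trig_poly"
      by auto
    show "(\<lambda>z. f z + g z) \<in> ?R"
      using trig_poly.sum[OF p(2) q(2)] unfolding p(1) q(1)
      by (intro CollectI exI[of _ "\<lambda>\<theta>. p \<theta> + q \<theta>"]) simp
    have half: "(\<lambda>\<theta>. 1 / 2 * r \<theta>) \<in> trig_poly" if "r \<in> trig_poly" for r :: "'d torus \<Rightarrow> complex"
      using trig_poly_mult[OF trig_poly.monomial[of "1/2" 0] that] by simp
    \<comment> \<open>Real parts are closed under products because trigonometric polynomials are closed under conjugation.\<close>
    have "Re z * Re w = Re (1 / 2 * (z * w + z * cnj w))" for z w
      by simp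
    then show "(\<lambda>z. f z * g z) \<in> ?R"
      unfolding p(1) q(1)
      by (intro CollectI exI[of _ "\<lambda>\<theta>. 1 / 2 * (p \<theta> * q \<theta> + p \<theta> * cnj (q \<theta>))"] conjI half trig_poly.sum
          trig_poly_mult trig_poly_cnj p q) auto
  next
    fix c :: real
    show "(\<lambda>_. c) \<in> ?R"
      using trig_poly.monomial[of "of_real c" 0] by (intro CollectI exI[of _ "\<lambda>_. of_real c"]) simp
  next
    fix z w assume "z \<in> range (torus_emb :: 'd torus \<Rightarrow> _)" "w \<in> range (torus_emb :: 'd torus \<Rightarrow> _)" "z \<noteq> w"
    then obtain x y :: "'d torus" where xy: "z = torus_emb x" "w = torus_emb y" "x \<noteq> y"
      by auto
    then obtain i where "character (axis i 1) x \<noteq> character (axis i 1) y"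
      by (auto simp: vec_eq_iff character_axis exp_circle_eq_iff)
    then obtain c where "Re (c * character (axis i 1) x) \<noteq> Re (c * character (axis i 1) y)"
    proof (cases "Re (character (axis i 1) x) = Re (character (axis i 1) y)")
      case False
      then show ?thesis using that[of 1] by simp
    next
      case True
      with \<open>character (axis i 1) x \<noteq> _\<close> have "Im (character (axis i 1) x) \<noteq> Im (character (axis i 1) y)"
        by (simp add: complex_eq_iff)
      then show ?thesis using that[of \<i>] by simp
    qed
    then have "Re (c * character (axis i 1) (?inv z)) \<noteq> Re (c * character (axis i 1) (?inv w))"
      by (simp add: xy)
    then show "\<exists>f\<in>?R. f z \<noteq> f w"
      by (intro bexI[of _ "\<lambda>z. Re (c * character (axis i 1) (?inv z))"] CollectI
          exI[of _ "\<lambda>\<theta>. c * character (axis i 1) \<theta>"] conjI trig_poly.monomial refl)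
  qed
  have "continuous_on (range torus_emb) (\<lambda>z. \<phi> (?inv z))"
    by (rule continuous_on_compose2[OF assms(1) cont_inv]) auto
  from Stone_Weierstrass_basic[OF this assms(2)]
  obtain g where "g \<in> ?R" "\<forall>z\<in>range torus_emb. \<bar>\<phi> (?inv z) - g z\<bar> < \<epsilon>"
    by blast
  then show ?thesis
    using that by auto
qed

section \<open>Measures on the torus and their Fourier coefficients\<close>

lemma borel_probD:
  assumes "borel_prob \<mu>"
  shows "prob_space \<mu>" "sets \<mu> = sets borel" "space \<mu> = UNIV"
  using assms sets_eq_imp_space_eq[of \<mu> borel] by (auto simp: borel_prob_def)

lemma borel_prob_measurable:
  assumes "borel_prob \<mu>"
  shows "measurable \<mu> N = measurable borel N"
  using borel_probD[OF assms] by (intro measurable_cong_sets) auto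

lemma borel_prob_integrable_bounded:
  fixes f :: "'a::topological_space \<Rightarrow> 'b::{banach, second_countable_topology}"
  assumes "borel_prob \<mu>" "f \<in> borel_measurable borel" "\<And>x. norm (f x) \<le> C"
  shows "integrable \<mu> f"
proof -
  interpret prob_space \<mu> by (rule borel_probD[OF assms(1)])
  show ?thesis
    using assms(2,3) by (intro integrable_const_bound[where B=C])
      (auto simp: borel_prob_measurable[OF assms(1)])
qed

lemma borel_prob_integral_diff_le:
  fixes f g :: "'a::topological_space \<Rightarrow> real"
  assumes mu: "borel_prob \<mu>" and f: "f \<in> borel_measurable borel" "\<And>x. \<bar>f x\<bar> \<le> C"
    and g: "g \<in> borel_measurable borel" "\<And>x. \<bar>g x\<bar> \<le> D" and le: "\<And>x. \<bar>f x - g x\<bar> \<le> \<epsilon>"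
  shows "\<bar>(\<integral>x. f x \<partial>\<mu>) - (\<integral>x. g x \<partial>\<mu>)\<bar> \<le> \<epsilon>"
proof -
  interpret prob_space \<mu> by (rule borel_probD[OF mu])
  have int: "integrable \<mu> f" "integrable \<mu> g"
    by (rule borel_prob_integrable_bounded[OF mu f(1), of C], simp add: f(2))
       (rule borel_prob_integrable_bounded[OF mu g(1), of D], simp add: g(2))
  then have "\<bar>(\<integral>x. f x \<partial>\<mu>) - (\<integral>x. g x \<partial>\<mu>)\<bar> = \<bar>\<integral>x. f x - g x \<partial>\<mu>\<bar>"
    by simp
  also have "\<dots> \<le> (\<integral>x. \<bar>f x - g x\<bar> \<partial>\<mu>)"
    by (rule integral_abs_bound)
  also have "\<dots> \<le> (\<integral>x. \<epsilon> \<partial>\<mu>)"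
    using int le by (intro integral_mono) auto
  finally show ?thesis by (simp add: prob_space)
qed

lemma integrable_character:
  "borel_prob \<mu> \<Longrightarrow> integrable \<mu> (character k)"
  by (rule borel_prob_integrable_bounded[where C=1]) auto

text \<open>
  The indicator of an open set is the pointwise limit of continuous functions, namely truncated
  multiples of the distance to the complement in the embedding.
\<close>

lemma torus_measure_eqI:
  fixes \<mu> \<nu> :: "'d::finite torus measure"
  assumes mu: "borel_prob \<mu>" and nu: "borel_prob \<nu>"
    and eq: "\<And>\<phi> :: 'd torus \<Rightarrow> real. continuous_on UNIV \<phi> \<Longrightarrow> (\<integral>\<theta>. \<phi> \<theta> \<partial>\<mu>) = (\<integral>\<theta>. \<phi> \<theta> \<partial>\<nu>)"
  shows "\<mu> = \<nu>"
proof (rule measure_eqI_generator_eq[where E="{U. open U}" and \<Omega>=UNIV and A="\<lambda>_. UNIV"])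
  interpret mu: prob_space \<mu> by (rule borel_probD[OF mu])
  interpret nu: prob_space \<nu> by (rule borel_probD[OF nu])
  show "Int_stable {U :: 'd torus set. open U}"
    by (auto simp: Int_stable_def open_Int)
  show "sets \<mu> = sigma_sets UNIV {U. open U}" "sets \<nu> = sigma_sets UNIV {U. open U}"
    using borel_probD[OF mu] borel_probD[OF nu] by (simp_all add: borel_def)
  show "emeasure \<mu> UNIV \<noteq> \<infinity>" by simp
  fix U :: "'d torus set" assume "U \<in> {U. open U}"
  then have U: "open U" by simp
  show "emeasure \<mu> U = emeasure \<nu> U"
  proof (cases "U = UNIV")
    case True
    then show ?thesis
      using mu.emeasure_space_1 nu.emeasure_space_1 borel_probD[OF mu] borel_probD[OF nu] by simp
  next
    case False
    define F where "F = torus_emb ` (- U)"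
    have F: "closed F" "F \<noteq> {}"
      using False U by (auto simp: F_def closed_torus_emb closed_Compl)
    define \<phi> where "\<phi> n \<theta> = min 1 (real n * infdist (torus_emb \<theta>) F)" for n \<theta>
    have cont: "continuous_on UNIV (\<phi> n)" for n
      unfolding \<phi>_def by (intro continuous_intros continuous_torus_emb)
    have lim: "(\<lambda>n. \<phi> n \<theta>) \<longlonglongrightarrow> indicator U \<theta>" for \<theta>
    proof (cases "\<theta> \<in> U")
      case False
      then have "torus_emb \<theta> \<in> F" by (simp add: F_def)
      then show ?thesis using False by (simp add: \<phi>_def)
    next
      case True
      then have "torus_emb \<theta> \<notin> F"
        using inj_torus_emb by (auto simp: F_def inj_def)
      then have pos: "infdist (torus_emb \<theta>) F > 0"
        using F infdist_pos_not_in_closed by blast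
      then obtain N where "1 < real N * infdist (torus_emb \<theta>) F"
        using reals_Archimedean3 by blast
      have "\<phi> n \<theta> = 1" if "n \<ge> N" for n
      proof -
        have "real N * infdist (torus_emb \<theta>) F \<le> real n * infdist (torus_emb \<theta>) F"
          using pos that by (intro mult_right_mono) auto
        with \<open>1 < _\<close> show ?thesis by (simp add: \<phi>_def)
      qed
      then have "(\<lambda>n. \<phi> n \<theta>) \<longlonglongrightarrow> 1"
        by (intro tendsto_eventually eventually_sequentiallyI)
      then show ?thesis using True by simp
    qed
    have bound: "\<bar>\<phi> n \<theta>\<bar> \<le> 1" for n \<theta>
    proof -
      have "0 \<le> real n * infdist (torus_emb \<theta>) F"
        by (simp add: infdist_nonneg)
      then show ?thesis by (simp add: \<phi>_def)
    qed
    have conv: "(\<lambda>n. \<integral>\<theta>. \<phi> n \<theta> \<partial>\<eta>) \<longlonglongrightarrow> measure \<eta> U" if eta: "borel_prob \<eta>" for \<eta>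
    proof -
      interpret prob_space \<eta> by (rule borel_probD[OF eta])
      have [measurable]: "U \<in> sets \<eta>" "\<And>n. \<phi> n \<in> borel_measurable \<eta>"
        using U cont borel_probD[OF eta]
        by (auto simp: borel_prob_measurable[OF eta] intro: borel_measurable_continuous_onI)
      have "(\<lambda>n. \<integral>\<theta>. \<phi> n \<theta> \<partial>\<eta>) \<longlonglongrightarrow> (\<integral>\<theta>. indicator U \<theta> \<partial>\<eta>)"
        using lim bound by (intro integral_dominated_convergence[where w="\<lambda>_. 1"]) auto
      then show ?thesis by (simp add: borel_probD[OF eta])
    qed
    have "measure \<mu> U = measure \<nu> U"
      using conv[OF mu] conv[OF nu] eq[OF cont] by (simp add: LIMSEQ_unique)
    then show ?thesis
      by (simp add: mu.emeasure_eq_measure nu.emeasure_eq_measure)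
  qed
qed auto

text \<open>
  Equal coefficients give equal integrals of trigonometric polynomials, hence of continuous
  functions by uniform density.
\<close>

theorem fourier_coeff_unique:
  fixes \<mu> \<nu> :: "'d::finite torus measure"
  assumes mu: "borel_prob \<mu>" and nu: "borel_prob \<nu>"
    and eq: "\<And>k. fourier_coeff \<mu> k = fourier_coeff \<nu> k"
  shows "\<mu> = \<nu>"
proof (rule torus_measure_eqI[OF mu nu])
  fix \<phi> :: "'d torus \<Rightarrow> real" assume cont: "continuous_on UNIV \<phi>"
  have meas [measurable]: "p \<in> borel_measurable borel" if "p \<in> trig_poly" for p :: "'d torus \<Rightarrow> complex"
    using that by induction measurable
  have int: "integrable \<eta> p" if "p \<in> trig_poly" "borel_prob \<eta>" for p :: "'d torus \<Rightarrow> complex" and \<eta>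
    using that(1) by induction (auto intro: integrable_character that(2))
  have poly: "(\<integral>\<theta>. p \<theta> \<partial>\<mu>) = (\<integral>\<theta>. p \<theta> \<partial>\<nu>)" if "p \<in> trig_poly" for p
    using that
  proof induction
    case (monomial c k)
    then show ?case using eq[of k] by (simp add: fourier_coeff_eq)
  qed (simp add: int mu nu)
  obtain C where C: "\<And>\<theta>. \<bar>\<phi> \<theta>\<bar> \<le> C"
    using continuous_torus_bounded[OF cont] by blast
  have phi [measurable]: "\<phi> \<in> borel_measurable borel"
    using cont by (rule borel_measurable_continuous_onI)
  have "\<bar>(\<integral>\<theta>. \<phi> \<theta> \<partial>\<mu>) - (\<integral>\<theta>. \<phi> \<theta> \<partial>\<nu>)\<bar> \<le> \<epsilon>" if pos: "\<epsilon> > 0" for \<epsilon>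
  proof -
    obtain p where p: "p \<in> trig_poly" "\<And>\<theta>. \<bar>\<phi> \<theta> - Re (p \<theta>)\<bar> < \<epsilon> / 2"
      using trig_poly_dense[OF cont half_gt_zero[OF pos]] by blast
    have bound: "\<bar>Re (p \<theta>)\<bar> \<le> C + \<epsilon> / 2" for \<theta>
      using p(2)[of \<theta>] C[of \<theta>] by linarith
    have [measurable]: "p \<in> borel_measurable borel"
      using meas[OF p(1)] .
    have near: "\<bar>(\<integral>\<theta>. \<phi> \<theta> \<partial>\<eta>) - (\<integral>\<theta>. Re (p \<theta>) \<partial>\<eta>)\<bar> \<le> \<epsilon> / 2" if "borel_prob \<eta>" for \<eta>
      using that by (rule borel_prob_integral_diff_le[OF _ phi C _ bound less_imp_le[OF p(2)]]) simp
    have "(\<integral>\<theta>. Re (p \<theta>) \<partial>\<mu>) = (\<integral>\<theta>. Re (p \<theta>) \<partial>\<nu>)"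
      using poly[OF p(1)] by (simp add: int p(1) mu nu)
    then show ?thesis
      using near[OF mu] near[OF nu] by linarith
  qed
  then have "\<bar>(\<integral>\<theta>. \<phi> \<theta> \<partial>\<mu>) - (\<integral>\<theta>. \<phi> \<theta> \<partial>\<nu>)\<bar> \<le> 0 + \<epsilon>" if "\<epsilon> > 0" for \<epsilon>
    using that by (simp only: add_0_left)
  from field_le_epsilon[OF this]
  have "\<bar>(\<integral>\<theta>. \<phi> \<theta> \<partial>\<mu>) - (\<integral>\<theta>. \<phi> \<theta> \<partial>\<nu>)\<bar> \<le> 0" .
  then show "(\<integral>\<theta>. \<phi> \<theta> \<partial>\<mu>) = (\<integral>\<theta>. \<phi> \<theta> \<partial>\<nu>)"
    by simp
qed

section \<open>Haar measure\<close>

lemma haar_probD: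
  assumes "haar_prob m"
  shows "borel_prob m"
  using assms by (simp add: haar_prob_def)

lemma distr_haar_add:
  fixes m :: "'d::finite torus measure"
  assumes haar: "haar_prob m"
  shows "distr m m (\<lambda>\<theta>. \<theta> + \<alpha>) = m"
proof (rule measure_eqI)
  note m = haar_probD[OF haar] borel_probD[OF haar_probD[OF haar]]
  note [measurable_cong] = m(3)
  fix E assume "E \<in> sets (distr m m (\<lambda>\<theta>. \<theta> + \<alpha>))"
  then have E [measurable]: "E \<in> sets borel" by (simp add: m)
  have "emeasure (distr m m (\<lambda>\<theta>. \<theta> + \<alpha>)) E = emeasure m ((\<lambda>\<theta>. \<theta> + \<alpha>) -` E)"
    using E by (subst emeasure_distr) (auto simp: m)
  also have "(\<lambda>\<theta>. \<theta> + \<alpha>) -` E = (+) (- \<alpha>) ` E"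
  proof (intro equalityI subsetI)
    fix \<theta> assume "\<theta> \<in> (\<lambda>\<theta>. \<theta> + \<alpha>) -` E"
    then show "\<theta> \<in> (+) (- \<alpha>) ` E"
      by (intro image_eqI[of _ _ "\<theta> + \<alpha>"]) auto
  qed auto
  also have "emeasure m \<dots> = emeasure m E"
    using haar E unfolding haar_prob_def by blast
  finally show "emeasure (distr m m (\<lambda>\<theta>. \<theta> + \<alpha>)) E = emeasure m E" .
qed simp

lemma haar_nn_integral_add:
  fixes m :: "'d::finite torus measure"
  assumes haar: "haar_prob m" and [measurable]: "f \<in> borel_measurable borel"
  shows "(\<integral>\<^sup>+\<theta>. f (\<theta> + \<alpha>) \<partial>m) = (\<integral>\<^sup>+\<theta>. f \<theta> \<partial>m)"
proof -
  note [measurable_cong] = borel_probD(2)[OF haar_probD[OF haar]]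
  have "(\<integral>\<^sup>+\<theta>. f \<theta> \<partial>m) = (\<integral>\<^sup>+\<theta>. f \<theta> \<partial>distr m m (\<lambda>\<theta>. \<theta> + \<alpha>))"
    by (simp add: distr_haar_add[OF haar])
  also have "\<dots> = (\<integral>\<^sup>+\<theta>. f (\<theta> + \<alpha>) \<partial>m)"
    by (subst nn_integral_distr) auto
  finally show ?thesis ..
qed

lemma haar_integral_add:
  fixes m :: "'d::finite torus measure" and f :: "_ \<Rightarrow> 'b::{banach, second_countable_topology}"
  assumes haar: "haar_prob m" and [measurable]: "f \<in> borel_measurable borel"
  shows "(\<integral>\<theta>. f (\<theta> + \<alpha>) \<partial>m) = (\<integral>\<theta>. f \<theta> \<partial>m)"
proof -
  note [measurable_cong] = borel_probD(2)[OF haar_probD[OF haar]]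
  have "(\<integral>\<theta>. f \<theta> \<partial>m) = (\<integral>\<theta>. f \<theta> \<partial>distr m m (\<lambda>\<theta>. \<theta> + \<alpha>))"
    by (simp add: distr_haar_add[OF haar])
  also have "\<dots> = (\<integral>\<theta>. f (\<theta> + \<alpha>) \<partial>m)"
    by (subst integral_distr) auto
  finally show ?thesis ..
qed

lemma haar_AE_add:
  fixes m :: "'d::finite torus measure"
  assumes haar: "haar_prob m" and "AE \<theta> in m. P \<theta>"
  shows "AE \<theta> in m. P (\<theta> + \<alpha>)"
proof -
  note [measurable_cong] = borel_probD(2)[OF haar_probD[OF haar]]
  have "AE \<theta> in distr m m (\<lambda>\<theta>. \<theta> + \<alpha>). P \<theta>"
    unfolding distr_haar_add[OF haar] by (rule assms)
  then show ?thesis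
    by (rule AE_distrD[rotated]) measurable
qed

text \<open>
  Translating by a point where the character is \<open>- 1\<close> changes the sign of its integral.
\<close>

lemma fourier_coeff_haar:
  fixes m :: "'d::finite torus measure"
  assumes haar: "haar_prob m"
  shows "fourier_coeff m k = (if k = 0 then 1 else 0)"
proof (cases "k = 0")
  case True
  interpret prob_space m by (rule borel_probD[OF haar_probD[OF haar]])
  show ?thesis using True by (simp add: fourier_coeff_eq prob_space)
next
  case False
  then obtain \<alpha> where \<alpha>: "character k \<alpha> = - 1"
    by (rule character_nontrivial)
  have "fourier_coeff m k = (\<integral>\<theta>. character k (\<theta> + \<alpha>) \<partial>m)"
    unfolding fourier_coeff_eq by (rule haar_integral_add[OF haar, symmetric]) simp
  also have "\<dots> = - fourier_coeff m k"
    by (simp add: character_add \<alpha> fourier_coeff_eq)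
  finally show ?thesis using False by simp
qed

text \<open>
  Finitely many translates of a nonempty open set cover the compact torus, so they cannot be null.
\<close>

lemma haar_pos_open:
  fixes m :: "'d::finite torus measure"
  assumes haar: "haar_prob m" and U: "open U" "U \<noteq> {}"
  shows "emeasure m U > 0"
proof (rule ccontr)
  note m = borel_probD[OF haar_probD[OF haar]]
  interpret prob_space m by (rule m)
  assume "\<not> emeasure m U > 0"
  then have null: "emeasure m U = 0" by (simp add: not_less)
  obtain u where u: "u \<in> U" using U by blast
  define V where "V \<alpha> = (\<lambda>\<theta>. \<theta> + \<alpha>) -` U" for \<alpha>
  have openV: "open (V \<alpha>)" for \<alpha>
    unfolding V_def using U(1) continuous_torus_add_const by (rule open_vimage)
  have "\<theta> \<in> V (u - \<theta>)" for \<theta>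
    using u by (simp add: V_def)
  then have cover: "UNIV \<subseteq> (\<Union>\<alpha>\<in>UNIV. V \<alpha>)"
    by blast
  obtain A where A: "finite A" "UNIV \<subseteq> (\<Union>\<alpha>\<in>A. V \<alpha>)"
    by (rule compactE_image[OF compact_torus openV cover])
  have "V \<alpha> \<in> null_sets m" for \<alpha>
  proof -
    have "U \<in> null_sets m"
      using null U(1) m(2) by (simp add: null_sets_def)
    then have "AE \<theta> in m. \<theta> \<notin> U"
      by (rule AE_not_in)
    then have "AE \<theta> in m. \<theta> + \<alpha> \<notin> U"
      by (rule haar_AE_add[OF haar])
    moreover have "V \<alpha> \<in> sets m"
      using openV[of \<alpha>] unfolding m(2) by (rule borel_open)
    ultimately show ?thesis
      using AE_iff_null_sets[of "V \<alpha>" m] by (simp add: V_def)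
  qed
  then have "(\<Union>\<alpha>\<in>A. V \<alpha>) \<in> null_sets m"
    by (intro null_sets.finite_UN A(1))
  moreover have "(\<Union>\<alpha>\<in>A. V \<alpha>) = space m"
    using A(2) m(3) by blast
  ultimately show False
    using emeasure_space_1 by (simp add: null_sets_def)
qed

lemma haar_integral_Re_character:
  assumes haar: "haar_prob m" and k: "k \<noteq> 0"
  shows "(\<integral>\<theta>. Re (character k \<theta>) \<partial>m) = 0"
  using fourier_coeff_haar[OF haar, of k] k integral_Re[OF integrable_character[OF haar_probD[OF haar]], of k]
  by (simp add: fourier_coeff_eq)

text \<open>
  The square of \<open>Re e\<^sub>k\<close> is \<open>1/2 + Re e\<^sub>2\<^sub>k / 2\<close>. Its positive integral is what keeps \<open>Re e\<^sub>k\<close>,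
  whose own integral is zero, from being constant.
\<close>

lemma haar_integral_Re_character_sq:
  assumes haar: "haar_prob m" and k: "k \<noteq> 0"
  shows "(\<integral>\<theta>. (Re (character k \<theta>))\<^sup>2 \<partial>m) = 1 / 2"
proof -
  interpret prob_space m by (rule borel_probD[OF haar_probD[OF haar]])
  have "k + k \<noteq> 0" using k by (auto simp: vec_eq_iff)
  have "(Re (character k \<theta>))\<^sup>2 = 1 / 2 + Re (character (k + k) \<theta>) / 2" for \<theta>
  proof -
    have "(Re (character k \<theta>))\<^sup>2 + (Im (character k \<theta>))\<^sup>2 = 1"
      using norm_character[of k \<theta>] by (simp add: cmod_def)
    moreover have "Re (character (k + k) \<theta>) = (Re (character k \<theta>))\<^sup>2 - (Im (character k \<theta>))\<^sup>2"
      unfolding character_plus by (simp add: power2_eq_square)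
    ultimately show ?thesis by (simp add: field_simps)
  qed
  then show ?thesis
    using haar_integral_Re_character[OF haar \<open>k + k \<noteq> 0\<close>] integrable_character[OF haar_probD[OF haar], of "k + k"]
    by (simp add: prob_space)
qed

lemma Re_character_not_AE_const:
  assumes haar: "haar_prob m" and k: "k \<noteq> 0"
  shows "\<not> (AE \<theta> in m. Re (character k \<theta>) = c)"
proof
  assume *: "AE \<theta> in m. Re (character k \<theta>) = c"
  note [measurable_cong] = borel_probD(2)[OF haar_probD[OF haar]]
  interpret prob_space m by (rule borel_probD[OF haar_probD[OF haar]])
  have "(\<integral>\<theta>. Re (character k \<theta>) \<partial>m) = (\<integral>\<theta>. c \<partial>m)"
    using * by (intro integral_cong_AE) auto
  then have "c = 0"
    using haar_integral_Re_character[OF haar k] by (simp add: prob_space)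
  have "(\<integral>\<theta>. (Re (character k \<theta>))\<^sup>2 \<partial>m) = (\<integral>\<theta>. 0 \<partial>m)"
    using * \<open>c = 0\<close> by (intro integral_cong_AE) auto
  then show False
    using haar_integral_Re_character_sq[OF haar k] by simp
qed

section \<open>Fourier coefficients equal to one and the support\<close>

text \<open>
  An average of points of the unit circle is \<open>1\<close> only if almost all of them are \<open>1\<close>: integrate
  \<open>1 - Re e\<^sub>k \<ge> 0\<close>.
\<close>

lemma fourier_coeff_eq_1_iff:
  assumes mu: "borel_prob \<mu>"
  shows "fourier_coeff \<mu> k = 1 \<longleftrightarrow> (AE \<alpha> in \<mu>. character k \<alpha> = 1)"
proof
  interpret prob_space \<mu> by (rule borel_probD[OF mu])
  note [measurable_cong] = borel_probD(2)[OF mu]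
  assume *: "fourier_coeff \<mu> k = 1"
  have int: "integrable \<mu> (character k)"
    by (rule integrable_character[OF mu])
  have int': "integrable \<mu> (\<lambda>\<alpha>. 1 - Re (character k \<alpha>))"
    by (intro Bochner_Integration.integrable_diff integrable_const integrable_Re int)
  have "(\<integral>\<alpha>. 1 - Re (character k \<alpha>) \<partial>\<mu>) = 1 - Re (fourier_coeff \<mu> k)"
    unfolding fourier_coeff_eq using int by (subst Bochner_Integration.integral_diff) (auto simp: prob_space)
  then have "(\<integral>\<alpha>. 1 - Re (character k \<alpha>) \<partial>\<mu>) = 0"
    using * by simp
  moreover have "AE \<alpha> in \<mu>. 0 \<le> 1 - Re (character k \<alpha>)"
    using complex_Re_le_cmod[of "character k _"] by simp
  ultimately have "AE \<alpha> in \<mu>. 1 - Re (character k \<alpha>) = 0"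
    using integral_nonneg_eq_0_iff_AE[OF int'] by blast
  then show "AE \<alpha> in \<mu>. character k \<alpha> = 1"
  proof (rule AE_mp, intro AE_I2 impI)
    fix \<alpha> assume "1 - Re (character k \<alpha>) = 0"
    moreover have "(Re (character k \<alpha>))\<^sup>2 + (Im (character k \<alpha>))\<^sup>2 = 1"
      using norm_character[of k \<alpha>] by (simp add: cmod_def)
    ultimately show "character k \<alpha> = 1"
      by (simp add: complex_eq_iff)
  qed
next
  interpret prob_space \<mu> by (rule borel_probD[OF mu])
  note [measurable_cong] = borel_probD(2)[OF mu]
  assume *: "AE \<alpha> in \<mu>. character k \<alpha> = 1"
  have "fourier_coeff \<mu> k = (\<integral>\<alpha>. 1 \<partial>\<mu>)"
    unfolding fourier_coeff_eq using * by (intro integral_cong_AE) auto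
  then show "fourier_coeff \<mu> k = 1" by (simp add: prob_space)
qed

lemma closed_character_eq_1: "closed {\<theta>. character k \<theta> = 1}"
  using continuous_character by (intro closed_Collect_eq) auto

text \<open>
  The set where a character is \<open>1\<close> is closed, so it has full measure exactly if it contains the
  support.
\<close>

lemma fourier_coeff_eq_1_iff_supp:
  assumes mu: "borel_prob \<mu>"
  shows "fourier_coeff \<mu> k = 1 \<longleftrightarrow> (\<forall>\<alpha>\<in>supp_measure \<mu>. int_pairing k \<alpha> = 0)"
proof
  assume "fourier_coeff \<mu> k = 1"
  then have "AE \<alpha> in \<mu>. \<alpha> \<in> {\<theta>. character k \<theta> = 1}"
    using fourier_coeff_eq_1_iff[OF mu] by simp
  from supp_subset_closed[OF closed_character_eq_1 this borel_probD(2)[OF mu]]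
  show "\<forall>\<alpha>\<in>supp_measure \<mu>. int_pairing k \<alpha> = 0"
    by (auto simp flip: character_eq_1_iff)
next
  assume "\<forall>\<alpha>\<in>supp_measure \<mu>. int_pairing k \<alpha> = 0"
  then have "\<alpha> \<in> supp_measure \<mu> \<longrightarrow> character k \<alpha> = 1" for \<alpha>
    by (simp add: character_eq_1_iff)
  from AE_mp[OF AE_supp_measure[OF borel_probD(2)[OF mu]] AE_I2[OF this]]
  show "fourier_coeff \<mu> k = 1"
    unfolding fourier_coeff_eq_1_iff[OF mu] .
qed

lemma dense_sums_imp_pairing_nonzero:
  fixes S :: "'d::finite torus set"
  assumes dense: "UNIV = closure (\<Union>n\<in>{1..}. set_multiple S n)" and k: "k \<noteq> 0"
  shows "\<exists>\<alpha>\<in>S. int_pairing k \<alpha> \<noteq> 0"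
proof (rule ccontr)
  assume "\<not> ?thesis"
  then have S: "character k \<alpha> = 1" if "\<alpha> \<in> S" for \<alpha>
    using that by (simp add: character_eq_1_iff)
  have "character k \<alpha> = 1" if "\<alpha> \<in> set_multiple S n" for \<alpha> n
    using that S by (induction S n arbitrary: \<alpha> rule: set_multiple.induct) (auto simp: character_add)
  then have "closure (\<Union>n\<in>{1..}. set_multiple S n) \<subseteq> {\<theta>. character k \<theta> = 1}"
    by (intro closure_minimal closed_character_eq_1) auto
  moreover obtain \<theta> :: "'d torus" where "character k \<theta> = - 1"
    using character_nontrivial[OF k] .
  moreover have "\<theta> \<in> closure (\<Union>n\<in>{1..}. set_multiple S n)"
    unfolding dense[symmetric] by (rule UNIV_I)
  ultimately have "character k \<theta> = 1" by blast
  with \<open>character k \<theta> = - 1\<close> show False by simp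
qed

section \<open>The Markov operator\<close>

lemma borel_measurable_markov_op [measurable]:
  fixes \<phi> :: "'d::finite torus \<Rightarrow> real"
  assumes mu: "borel_prob \<mu>" and [measurable]: "\<phi> \<in> borel_measurable borel"
  shows "markov_op \<mu> \<phi> \<in> borel_measurable borel"
proof -
  interpret prob_space \<mu> by (rule borel_probD[OF mu])
  note [measurable_cong] = borel_probD(2)[OF mu]
  show ?thesis unfolding markov_op_def by measurable
qed

lemma integrable_translate:
  fixes \<phi> :: "'d::finite torus \<Rightarrow> real"
  assumes mu: "borel_prob \<mu>" and [measurable]: "\<phi> \<in> borel_measurable borel" and "\<And>\<theta>. \<bar>\<phi> \<theta>\<bar> \<le> C"
  shows "integrable \<mu> (\<lambda>\<alpha>. \<phi> (\<theta> + \<alpha>))"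
  using assms(3) by (intro borel_prob_integrable_bounded[OF mu, where C=C]) auto

lemma markov_op_le:
  fixes \<phi> \<psi> :: "'d::finite torus \<Rightarrow> real"
  assumes mu: "borel_prob \<mu>" and [measurable]: "\<phi> \<in> borel_measurable borel" "\<psi> \<in> borel_measurable borel"
    and \<phi>: "\<And>\<theta>. \<bar>\<phi> \<theta>\<bar> \<le> C" and \<psi>: "\<And>\<theta>. \<bar>\<psi> \<theta>\<bar> \<le> D" and le: "\<And>\<theta>. \<bar>\<phi> \<theta> - \<psi> \<theta>\<bar> \<le> \<epsilon>"
  shows "\<bar>markov_op \<mu> \<phi> \<theta> - markov_op \<mu> \<psi> \<theta>\<bar> \<le> \<epsilon>"
  unfolding markov_op_def using \<phi> \<psi> le
  by (intro borel_prob_integral_diff_le[OF mu, where C=C and D=D]) auto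

lemma funpow_markov_op_bounded:
  fixes \<phi> :: "'d::finite torus \<Rightarrow> real"
  assumes mu: "borel_prob \<mu>" and \<phi>: "\<phi> \<in> borel_measurable borel" "\<And>\<theta>. \<bar>\<phi> \<theta>\<bar> \<le> C"
  shows "(markov_op \<mu> ^^ j) \<phi> \<in> borel_measurable borel" "\<bar>(markov_op \<mu> ^^ j) \<phi> \<theta>\<bar> \<le> C"
proof -
  have "(markov_op \<mu> ^^ j) \<phi> \<in> borel_measurable borel \<and> (\<forall>\<theta>. \<bar>(markov_op \<mu> ^^ j) \<phi> \<theta>\<bar> \<le> C)"
  proof (induction j)
    case (Suc j)
    have "\<bar>markov_op \<mu> ((markov_op \<mu> ^^ j) \<phi>) \<theta> - markov_op \<mu> (\<lambda>_. 0) \<theta>\<bar> \<le> C" for \<theta>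
      using Suc by (intro markov_op_le[OF mu, where C=C and D=0]) auto
    then show ?case
      using Suc borel_measurable_markov_op[OF mu] by (simp add: markov_op_def[of \<mu> "\<lambda>_. 0"])
  qed (use \<phi> in auto)
  then show "(markov_op \<mu> ^^ j) \<phi> \<in> borel_measurable borel" "\<bar>(markov_op \<mu> ^^ j) \<phi> \<theta>\<bar> \<le> C"
    by auto
qed

lemma funpow_markov_op_le:
  fixes \<phi> \<psi> :: "'d::finite torus \<Rightarrow> real"
  assumes mu: "borel_prob \<mu>" and \<phi>: "\<phi> \<in> borel_measurable borel" "\<And>\<theta>. \<bar>\<phi> \<theta>\<bar> \<le> C"
    and \<psi>: "\<psi> \<in> borel_measurable borel" "\<And>\<theta>. \<bar>\<psi> \<theta>\<bar> \<le> D" and le: "\<And>\<theta>. \<bar>\<phi> \<theta> - \<psi> \<theta>\<bar> \<le> \<epsilon>"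
  shows "\<bar>(markov_op \<mu> ^^ j) \<phi> \<theta> - (markov_op \<mu> ^^ j) \<psi> \<theta>\<bar> \<le> \<epsilon>"
proof (induction j arbitrary: \<theta>)
  case (Suc j)
  note b = funpow_markov_op_bounded[OF mu \<phi>] funpow_markov_op_bounded[OF mu \<psi>]
  show ?case
    unfolding funpow.simps comp_def by (rule markov_op_le[OF mu b(1,3) b(2,4) Suc])
qed (use le in simp)

lemma funpow_markov_op_add:
  fixes \<phi> \<psi> :: "'d::finite torus \<Rightarrow> real"
  assumes mu: "borel_prob \<mu>" and \<phi>: "\<phi> \<in> borel_measurable borel" "\<And>\<theta>. \<bar>\<phi> \<theta>\<bar> \<le> C"
    and \<psi>: "\<psi> \<in> borel_measurable borel" "\<And>\<theta>. \<bar>\<psi> \<theta>\<bar> \<le> D"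
  shows "(markov_op \<mu> ^^ j) (\<lambda>\<theta>. \<phi> \<theta> + \<psi> \<theta>) = (\<lambda>\<theta>. (markov_op \<mu> ^^ j) \<phi> \<theta> + (markov_op \<mu> ^^ j) \<psi> \<theta>)"
proof (induction j)
  case (Suc j)
  note b = funpow_markov_op_bounded[OF mu \<phi>] funpow_markov_op_bounded[OF mu \<psi>]
  show ?case
    unfolding funpow.simps comp_def Suc
    by (intro ext, subst (1 2 3) markov_op_def, rule Bochner_Integration.integral_add)
       (rule integrable_translate[OF mu b(1,2)] integrable_translate[OF mu b(3,4)])+
qed simp

text \<open>
  Characters are eigenfunctions. Stated for real parts because the Markov operator acts on real
  functions; the factor \<open>c\<close> makes the real and the imaginary part of a character both available.
\<close>

lemma funpow_markov_op_character:
  fixes \<mu> :: "'d::finite torus measure"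
  assumes mu: "borel_prob \<mu>"
  shows "(markov_op \<mu> ^^ j) (\<lambda>\<theta>. Re (c * character k \<theta>)) = (\<lambda>\<theta>. Re (c * fourier_coeff \<mu> k ^ j * character k \<theta>))"
proof (induction j)
  case (Suc j)
  have step: "(\<integral>\<alpha>. Re (c * fourier_coeff \<mu> k ^ j * character k (\<theta> + \<alpha>)) \<partial>\<mu>) =
      Re (c * fourier_coeff \<mu> k ^ Suc j * character k \<theta>)" for \<theta>
  proof -
    have "(\<integral>\<alpha>. Re (c * fourier_coeff \<mu> k ^ j * character k (\<theta> + \<alpha>)) \<partial>\<mu>) =
        (\<integral>\<alpha>. Re (c * fourier_coeff \<mu> k ^ j * character k \<theta> * character k \<alpha>) \<partial>\<mu>)"
      by (simp only: character_add mult.assoc)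
    also have "\<dots> = Re (\<integral>\<alpha>. c * fourier_coeff \<mu> k ^ j * character k \<theta> * character k \<alpha> \<partial>\<mu>)"
      by (intro integral_Re integrable_mult_right integrable_character[OF mu])
    also have "(\<integral>\<alpha>. c * fourier_coeff \<mu> k ^ j * character k \<theta> * character k \<alpha> \<partial>\<mu>) =
        c * fourier_coeff \<mu> k ^ Suc j * character k \<theta>"
      by (simp add: fourier_coeff_eq mult_ac)
    finally show ?thesis .
  qed
  show ?case
    unfolding funpow.simps comp_def Suc by (rule ext, subst markov_op_def, rule step)
qed simp

lemma norm_fourier_coeff_le_1:
  assumes mu: "borel_prob \<mu>"
  shows "norm (fourier_coeff \<mu> k) \<le> 1"
proof -
  interpret prob_space \<mu> by (rule borel_probD[OF mu])
  have "norm (fourier_coeff \<mu> k) \<le> (\<integral>\<alpha>. norm (character k \<alpha>) \<partial>\<mu>)"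
    unfolding fourier_coeff_eq by (rule integral_norm_bound)
  then show ?thesis by (simp add: prob_space)
qed

text \<open>
  The geometric sums are bounded by \<open>2 / norm (z - 1)\<close>.
\<close>

lemma geometric_average_tendsto_0:
  fixes z :: complex
  assumes "norm z \<le> 1" "z \<noteq> 1"
  shows "(\<lambda>n. (\<Sum>j<n. z ^ j) / of_nat n) \<longlonglongrightarrow> 0"
proof (rule Lim_null_comparison)
  show "\<forall>\<^sub>F n in sequentially. norm ((\<Sum>j<n. z ^ j) / of_nat n) \<le> (2 / norm (z - 1)) / real n"
  proof (rule eventually_sequentiallyI[of 1])
    fix n :: nat
    have "norm (z ^ n - 1) \<le> norm (z ^ n) + 1"
      by (metis norm_one norm_triangle_ineq4)
    also have "norm (z ^ n) \<le> 1"
      using assms(1) by (simp add: norm_power power_le_one)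
    finally have "norm (z ^ n - 1) \<le> 2" by simp
    then have "norm (z ^ n - 1) / norm (z - 1) / real n \<le> (2 / norm (z - 1)) / real n"
      by (intro divide_right_mono) auto
    then show "norm ((\<Sum>j<n. z ^ j) / of_nat n) \<le> (2 / norm (z - 1)) / real n"
      by (simp only: geometric_sum[OF assms(2)] norm_divide norm_of_nat)
  qed
  show "(\<lambda>n. (2 / norm (z - 1)) / real n) \<longlonglongrightarrow> 0"
    by (rule lim_const_over_n)
qed

text \<open>
  For a single character the average is a geometric average, for trigonometric polynomials use
  linearity, and for continuous functions a uniform approximation, which the Markov operator does
  not spoil.
\<close>

lemma averages_converge:
  fixes \<mu> m :: "'d::finite torus measure"
  assumes mu: "borel_prob \<mu>" and haar: "haar_prob m"
    and ne: "\<And>k. k \<noteq> 0 \<Longrightarrow> fourier_coeff \<mu> k \<noteq> 1" and cont: "continuous_on UNIV \<phi>"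
  shows "(\<lambda>n. 1 / real n * (\<Sum>j<n. (markov_op \<mu> ^^ j) \<phi> \<theta>)) \<longlonglongrightarrow> (\<integral>\<theta>'. \<phi> \<theta>' \<partial>m)"
proof -
  define av where "av \<phi> n = 1 / real n * (\<Sum>j<n. (markov_op \<mu> ^^ j) \<phi> \<theta>)" for \<phi> n
  have poly: "(\<lambda>\<theta>. Re (p \<theta>)) \<in> borel_measurable borel \<and> (\<exists>C. \<forall>\<theta>. \<bar>Re (p \<theta>)\<bar> \<le> C) \<and>
      av (\<lambda>\<theta>. Re (p \<theta>)) \<longlonglongrightarrow> (\<integral>\<theta>. Re (p \<theta>) \<partial>m)" if "p \<in> trig_poly" for p
    using that
  proof induction
    case (monomial c k)
    have "\<bar>Re (c * character k \<theta>)\<bar> \<le> norm c" for \<theta>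
      using abs_Re_le_cmod[of "c * character k \<theta>"] by (simp add: norm_mult)
    moreover have "(\<lambda>\<theta>. Re (c * character k \<theta>)) \<in> borel_measurable borel"
      by measurable
    moreover have "av (\<lambda>\<theta>. Re (c * character k \<theta>)) \<longlonglongrightarrow> (\<integral>\<theta>. Re (c * character k \<theta>) \<partial>m)"
    proof -
      have "(\<integral>\<theta>. Re (c * character k \<theta>) \<partial>m) = Re (\<integral>\<theta>. c * character k \<theta> \<partial>m)"
        by (intro integral_Re integrable_mult_right integrable_character haar_probD[OF haar])
      then have int: "(\<integral>\<theta>. Re (c * character k \<theta>) \<partial>m) = Re (c * (if k = 0 then 1 else 0))"
        by (simp add: fourier_coeff_haar[OF haar] flip: fourier_coeff_eq)
      let ?z = "fourier_coeff \<mu> k"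
      have eq: "av (\<lambda>\<theta>. Re (c * character k \<theta>)) n =
          Re (c * character k \<theta> * ((\<Sum>j<n. ?z ^ j) / of_nat n))" for n
      proof -
        have "(\<Sum>j<n. Re (c * ?z ^ j * character k \<theta>)) = Re (c * character k \<theta> * (\<Sum>j<n. ?z ^ j))"
          unfolding Re_sum[symmetric] sum_distrib_left by (simp only: mult_ac)
        then have "av (\<lambda>\<theta>. Re (c * character k \<theta>)) n = Re (c * character k \<theta> * (\<Sum>j<n. ?z ^ j)) / real n"
          unfolding av_def funpow_markov_op_character[OF mu] by simp
        also have "\<dots> = Re (c * character k \<theta> * (\<Sum>j<n. ?z ^ j) / of_real (real n))"
          by (simp only: Re_divide_of_real)
        finally show ?thesis by simp
      qed
      have "(\<lambda>n. (\<Sum>j<n. ?z ^ j) / of_nat n) \<longlonglongrightarrow> (if k = 0 then 1 else 0)"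
      proof (cases "k = 0")
        case True
        interpret prob_space \<mu> by (rule borel_probD[OF mu])
        have "?z = 1" using True by (simp add: fourier_coeff_eq prob_space)
        then have "(\<Sum>j<n. ?z ^ j) / of_nat n = 1" if "n \<ge> 1" for n
          using that by simp
        then have "(\<lambda>n. (\<Sum>j<n. ?z ^ j) / of_nat n) \<longlonglongrightarrow> 1"
          by (intro tendsto_eventually eventually_sequentiallyI)
        then show ?thesis using True by simp
      next
        case False
        then show ?thesis
          using geometric_average_tendsto_0[OF norm_fourier_coeff_le_1[OF mu] ne[OF False]] by simp
      qed
      then have "(\<lambda>n. Re (c * character k \<theta> * ((\<Sum>j<n. ?z ^ j) / of_nat n))) \<longlonglongrightarrow>
          Re (c * character k \<theta> * (if k = 0 then 1 else 0))"
        by (intro tendsto_intros)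
      then show ?thesis
        unfolding int eq by (cases "k = 0") auto
    qed
    ultimately show ?case by blast
  next
    case (sum p q)
    then obtain C D where C: "\<And>\<theta>. \<bar>Re (p \<theta>)\<bar> \<le> C" and D: "\<And>\<theta>. \<bar>Re (q \<theta>)\<bar> \<le> D"
      and [measurable]: "(\<lambda>\<theta>. Re (p \<theta>)) \<in> borel_measurable borel" "(\<lambda>\<theta>. Re (q \<theta>)) \<in> borel_measurable borel"
      and lim: "av (\<lambda>\<theta>. Re (p \<theta>)) \<longlonglongrightarrow> (\<integral>\<theta>. Re (p \<theta>) \<partial>m)" "av (\<lambda>\<theta>. Re (q \<theta>)) \<longlonglongrightarrow> (\<integral>\<theta>. Re (q \<theta>) \<partial>m)"
      by blast
    have "av (\<lambda>\<theta>. Re (p \<theta>) + Re (q \<theta>)) = (\<lambda>n. av (\<lambda>\<theta>. Re (p \<theta>)) n + av (\<lambda>\<theta>. Re (q \<theta>)) n)"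
      unfolding av_def by (subst funpow_markov_op_add[OF mu _ C _ D]) (auto simp: sum.distrib distrib_left)
    moreover have "(\<integral>\<theta>. Re (p \<theta>) + Re (q \<theta>) \<partial>m) = (\<integral>\<theta>. Re (p \<theta>) \<partial>m) + (\<integral>\<theta>. Re (q \<theta>) \<partial>m)"
      using C D by (intro Bochner_Integration.integral_add borel_prob_integrable_bounded[OF haar_probD[OF haar]]) auto
    ultimately have "av (\<lambda>\<theta>. Re (p \<theta> + q \<theta>)) \<longlonglongrightarrow> (\<integral>\<theta>. Re (p \<theta> + q \<theta>) \<partial>m)"
      using tendsto_add[OF lim] by simp
    moreover have "\<bar>Re (p \<theta> + q \<theta>)\<bar> \<le> C + D" for \<theta>
      using C[of \<theta>] D[of \<theta>] by simp
    moreover have "(\<lambda>\<theta>. Re (p \<theta> + q \<theta>)) \<in> borel_measurable borel"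
      by simp
    ultimately show ?case by blast
  qed
  obtain C where C: "\<And>\<theta>. \<bar>\<phi> \<theta>\<bar> \<le> C"
    using continuous_torus_bounded[OF cont] by blast
  have phi: "\<phi> \<in> borel_measurable borel"
    using cont by (rule borel_measurable_continuous_onI)
  have "av \<phi> \<longlonglongrightarrow> (\<integral>\<theta>. \<phi> \<theta> \<partial>m)"
  proof (rule LIMSEQ_I)
    fix \<epsilon> :: real assume pos: "0 < \<epsilon>"
    then have "0 < \<epsilon> / 3" by simp
    then obtain p where p: "p \<in> trig_poly" "\<And>\<theta>. \<bar>\<phi> \<theta> - Re (p \<theta>)\<bar> < \<epsilon> / 3"
      using trig_poly_dense[OF cont] by blast
    obtain D where D: "\<And>\<theta>. \<bar>Re (p \<theta>)\<bar> \<le> D"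
      using poly[OF p(1)] by blast
    have meas: "(\<lambda>\<theta>. Re (p \<theta>)) \<in> borel_measurable borel"
      and lim: "av (\<lambda>\<theta>. Re (p \<theta>)) \<longlonglongrightarrow> (\<integral>\<theta>. Re (p \<theta>) \<partial>m)"
      using poly[OF p(1)] by blast+
    obtain N where N: "\<And>n. n \<ge> N \<Longrightarrow> \<bar>av (\<lambda>\<theta>. Re (p \<theta>)) n - (\<integral>\<theta>. Re (p \<theta>) \<partial>m)\<bar> < \<epsilon> / 3"
      using LIMSEQ_D[OF lim \<open>0 < \<epsilon> / 3\<close>] unfolding real_norm_def by blast
    have le: "\<bar>\<phi> \<theta> - Re (p \<theta>)\<bar> \<le> \<epsilon> / 3" for \<theta>
      using p(2)[of \<theta>] by simp
    have int: "\<bar>(\<integral>\<theta>. \<phi> \<theta> \<partial>m) - (\<integral>\<theta>. Re (p \<theta>) \<partial>m)\<bar> \<le> \<epsilon> / 3"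
      by (rule borel_prob_integral_diff_le[OF haar_probD[OF haar] phi C meas D le])
    have "norm (av \<phi> n - (\<integral>\<theta>. \<phi> \<theta> \<partial>m)) < \<epsilon>" if "n \<ge> N" for n
    proof -
      have "\<bar>(\<Sum>j<n. (markov_op \<mu> ^^ j) \<phi> \<theta>) - (\<Sum>j<n. (markov_op \<mu> ^^ j) (\<lambda>\<theta>. Re (p \<theta>)) \<theta>)\<bar> \<le>
          (\<Sum>j<n. \<bar>(markov_op \<mu> ^^ j) \<phi> \<theta> - (markov_op \<mu> ^^ j) (\<lambda>\<theta>. Re (p \<theta>)) \<theta>\<bar>)"
        unfolding sum_subtractf[symmetric] by (rule sum_abs)
      also have "\<dots> \<le> (\<Sum>j<n. \<epsilon> / 3)"
        by (intro sum_mono funpow_markov_op_le[OF mu phi C meas D le])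
      finally have *: "\<bar>(\<Sum>j<n. (markov_op \<mu> ^^ j) \<phi> \<theta>) - (\<Sum>j<n. (markov_op \<mu> ^^ j) (\<lambda>\<theta>. Re (p \<theta>)) \<theta>)\<bar> \<le> real n * (\<epsilon> / 3)"
        by simp
      have "\<bar>av \<phi> n - av (\<lambda>\<theta>. Re (p \<theta>)) n\<bar> \<le> 1 / real n * (real n * (\<epsilon> / 3))"
        unfolding av_def right_diff_distrib[symmetric] abs_mult
        using mult_left_mono[OF *, of "1 / real n"] by simp
      also have "\<dots> \<le> \<epsilon> / 3"
        using pos by simp
      finally show ?thesis
        using N[OF that] int unfolding real_norm_def by linarith
    qed
    then show "\<exists>no. \<forall>n\<ge>no. norm (av \<phi> n - (\<integral>\<theta>. \<phi> \<theta> \<partial>m)) < \<epsilon>"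
      by blast
  qed
  then show ?thesis
    by (simp add: av_def[abs_def])
qed

text \<open>
  A walk that starts at \<open>0\<close> visits only sums of elements of the support from its first step on. If
  their closure were not everything, the distance to it would be a continuous function with positive
  Haar integral whose averages along this walk tend to zero.
\<close>

lemma averages_imp_dense_sums:
  fixes \<mu> m :: "'d::finite torus measure"
  assumes mu: "borel_prob \<mu>" and haar: "haar_prob m"
    and lim: "\<And>\<phi>. continuous_on UNIV \<phi> \<Longrightarrow>
      (\<lambda>n. 1 / real n * (\<Sum>j<n. (markov_op \<mu> ^^ j) \<phi> 0)) \<longlonglongrightarrow> (\<integral>\<theta>'. \<phi> \<theta>' \<partial>m)"
  shows "UNIV = closure (\<Union>n\<in>{1..}. set_multiple (supp_measure \<mu>) n)"
proof (rule ccontr)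
  define S where "S = supp_measure \<mu>"
  define F where "F = closure (\<Union>n\<in>{1..}. set_multiple S n)"
  assume "\<not> ?thesis"
  then have F: "closed F" "F \<noteq> UNIV"
    by (auto simp: F_def S_def)
  have supp: "AE \<alpha> in \<mu>. \<alpha> \<in> S"
    unfolding S_def by (rule AE_supp_measure[OF borel_probD(2)[OF mu]])
  have "S \<noteq> {}"
  proof
    interpret prob_space \<mu> by (rule borel_probD[OF mu])
    assume "S = {}"
    then show False using supp by (simp add: AE_False)
  qed
  have SF: "set_multiple S n \<subseteq> F" if "n \<ge> 1" for n
    using that closure_subset unfolding F_def by fastforce
  have "F \<noteq> {}" using SF[of "Suc 0"] \<open>S \<noteq> {}\<close> by auto
  define \<phi> where "\<phi> \<theta> = infdist (torus_emb \<theta>) (torus_emb ` F)" for \<theta>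
  have cont: "continuous_on UNIV \<phi>"
    unfolding \<phi>_def by (intro continuous_intros continuous_torus_emb)
  have \<phi>_F: "\<phi> \<theta> = 0" if "\<theta> \<in> F" for \<theta>
    using that by (simp add: \<phi>_def)
  have \<phi>_pos: "\<phi> \<theta> > 0" if "\<theta> \<notin> F" for \<theta>
  proof -
    have "torus_emb \<theta> \<notin> torus_emb ` F"
      using that inj_torus_emb by (auto simp: inj_def)
    then show ?thesis
      unfolding \<phi>_def using closed_torus_emb[OF F(1)] \<open>F \<noteq> {}\<close> by (intro infdist_pos_not_in_closed) auto
  qed
  have step: "\<theta> + \<alpha> \<in> set_multiple S (Suc n)" if "\<theta> \<in> set_multiple S n" "\<alpha> \<in> S" for \<theta> \<alpha> n
    using that by (cases n) (auto simp: add.commute[of \<theta> \<alpha>])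
  \<comment> \<open>After \<open>j\<close> steps from a sum of \<open>n\<close> elements the walk is at a sum of \<open>n + j\<close> elements.  The case
    \<open>n = j = 0\<close> is excluded because \<open>0\<close> need not be a sum of elements of the support; it contributes the
    single term \<open>\<phi> 0\<close> to each average.\<close>
  have vanish: "(markov_op \<mu> ^^ j) \<phi> \<theta> = 0" if "\<theta> \<in> set_multiple S n" "n + j \<ge> 1" for j n \<theta>
    using that
  proof (induction j arbitrary: n \<theta>)
    case 0
    then show ?case using SF[of n] \<phi>_F by auto
  next
    case (Suc j)
    have "AE \<alpha> in \<mu>. (markov_op \<mu> ^^ j) \<phi> (\<theta> + \<alpha>) = 0"
      using supp
    proof (rule AE_mp, intro AE_I2 impI)
      fix \<alpha> assume "\<alpha> \<in> S"
      then show "(markov_op \<mu> ^^ j) \<phi> (\<theta> + \<alpha>) = 0"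
        using Suc.IH[of "\<theta> + \<alpha>" "Suc n"] step Suc.prems by simp
    qed
    then have "(\<integral>\<alpha>. (markov_op \<mu> ^^ j) \<phi> (\<theta> + \<alpha>) \<partial>\<mu>) = 0"
      by (rule integral_eq_zero_AE)
    then show ?case by (simp add: markov_op_def[of \<mu> "(markov_op \<mu> ^^ j) \<phi>"])
  qed
  have "(\<Sum>j<n. (markov_op \<mu> ^^ j) \<phi> 0) = \<phi> 0" if "n \<ge> 1" for n
  proof -
    have "(\<Sum>j<n. (markov_op \<mu> ^^ j) \<phi> 0) = (\<Sum>j\<in>{0}. (markov_op \<mu> ^^ j) \<phi> 0)"
      using that vanish[of 0 0] by (intro sum.mono_neutral_right) auto
    then show ?thesis by simp
  qed
  then have "(\<lambda>n. 1 / real n * (\<Sum>j<n. (markov_op \<mu> ^^ j) \<phi> 0)) \<longlonglongrightarrow> 0"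
    using lim_const_over_n[of "\<phi> 0"]
    by (elim Lim_transform_eventually) (auto intro!: eventually_sequentiallyI[of 1])
  then have "(\<integral>\<theta>. \<phi> \<theta> \<partial>m) = 0"
    using lim[OF cont] LIMSEQ_unique by blast
  moreover have int: "integrable m \<phi>"
  proof -
    obtain C where "\<And>\<theta>. \<bar>\<phi> \<theta>\<bar> \<le> C"
      using continuous_torus_bounded[OF cont] by blast
    then show ?thesis
      using borel_measurable_continuous_onI[OF cont]
      by (intro borel_prob_integrable_bounded[OF haar_probD[OF haar], where C=C]) auto
  qed
  moreover have "AE \<theta> in m. 0 \<le> \<phi> \<theta>"
    by (simp add: \<phi>_def infdist_nonneg)
  ultimately have "AE \<theta> in m. \<phi> \<theta> = 0"
    using integral_nonneg_eq_0_iff_AE[OF int] by simp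
  then have "AE \<theta> in m. \<theta> \<notin> - F"
  proof (rule AE_mp, intro AE_I2 impI)
    fix \<theta> assume "\<phi> \<theta> = 0"
    then show "\<theta> \<notin> - F" using \<phi>_pos[of \<theta>] by auto
  qed
  moreover have "- F \<in> sets m"
    using F borel_probD(2)[OF haar_probD[OF haar]] by (simp add: open_Compl)
  ultimately have "emeasure m (- F) = 0"
    using AE_iff_null_sets[of "- F" m] by (simp add: null_sets_def)
  moreover have "emeasure m (- F) > 0"
    using F by (intro haar_pos_open[OF haar]) (auto simp: open_Compl)
  ultimately show False by simp
qed

section \<open>Stationary observables\<close>

text \<open>
  The measure with this density has the Fourier coefficients of Haar measure. This turns the
  uniqueness theorem for measures into one for bounded functions.
\<close>

lemma haar_density_eq_1:
  fixes m :: "'d::finite torus measure" and g :: "'d torus \<Rightarrow> real"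
  assumes haar: "haar_prob m" and [measurable]: "g \<in> borel_measurable borel"
    and nonneg: "\<And>\<theta>. 0 \<le> g \<theta>" and bound: "\<And>\<theta>. g \<theta> \<le> C"
    and one: "(\<integral>\<theta>. g \<theta> \<partial>m) = 1"
    and zero: "\<And>k. k \<noteq> 0 \<Longrightarrow> (\<integral>\<theta>. g \<theta> *\<^sub>R character k \<theta> \<partial>m) = 0"
  shows "AE \<theta> in m. g \<theta> = 1"
proof -
  note m = borel_probD[OF haar_probD[OF haar]]
  note [measurable_cong] = m(2)
  interpret prob_space m by (rule m)
  have int: "integrable m g"
    using nonneg bound by (intro borel_prob_integrable_bounded[OF haar_probD[OF haar], where C=C]) auto
  define \<nu> where "\<nu> = density m (\<lambda>\<theta>. ennreal (g \<theta>))"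
  have "(\<integral>\<^sup>+\<theta>. ennreal (g \<theta>) \<partial>m) = 1"
    using nn_integral_eq_integral[OF int] nonneg one by simp
  then have "prob_space \<nu>"
    by (intro prob_spaceI) (simp add: \<nu>_def emeasure_density cong: nn_integral_cong_simp)
  then have nu: "borel_prob \<nu>"
    by (simp add: borel_prob_def \<nu>_def m)
  have "fourier_coeff \<nu> k = fourier_coeff m k" for k
  proof -
    have "fourier_coeff \<nu> k = (\<integral>\<theta>. g \<theta> *\<^sub>R character k \<theta> \<partial>m)"
      unfolding fourier_coeff_eq \<nu>_def using nonneg by (intro integral_density) auto
    also have "\<dots> = (if k = 0 then 1 else 0)"
    proof (cases "k = 0")
      case True
      have "(\<integral>\<theta>. g \<theta> *\<^sub>R (1::complex) \<partial>m) = complex_of_real (\<integral>\<theta>. g \<theta> \<partial>m)"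
        using int by (subst integral_complex_of_real[symmetric]) (simp add: scaleR_conv_of_real)
      then show ?thesis using True one by simp
    qed (simp add: zero)
    finally show ?thesis by (simp add: fourier_coeff_haar[OF haar])
  qed
  then have "\<nu> = m"
    by (intro fourier_coeff_unique nu haar_probD[OF haar])
  then have "density m (\<lambda>\<theta>. ennreal (g \<theta>)) = density m (\<lambda>_. 1)"
    by (simp add: \<nu>_def density_1)
  then have "AE \<theta> in m. ennreal (g \<theta>) = 1"
    by (intro density_unique) auto
  then show ?thesis
    by (simp add: ennreal_eq_1)
qed

text \<open>
  By Fubini and translation invariance, the \<open>k\<close>-th Fourier coefficient of the Markov image of an
  observable is that of the observable times the conjugate of \<open>fourier_coeff \<mu> k\<close>. For a stationary
  observable all coefficients with \<open>k \<noteq> 0\<close> therefore vanish, and a positive affine image of it is a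
  density to which the previous lemma applies.
\<close>

lemma stationary_observable_const:
  fixes \<mu> m :: "'d::finite torus measure"
  assumes mu: "borel_prob \<mu>" and haar: "haar_prob m"
    and ne: "\<And>k. k \<noteq> 0 \<Longrightarrow> fourier_coeff \<mu> k \<noteq> 1"
    and \<phi>: "\<phi> \<in> L_infty m" and stat: "stationary_observable \<mu> m \<phi>"
  shows "\<exists>c. AE \<theta> in m. \<phi> \<theta> = c"
proof -
  note m = borel_probD[OF haar_probD[OF haar]]
  note [measurable_cong] = m(2) borel_probD(2)[OF mu]
  interpret m: prob_space m by (rule m)
  interpret mu: prob_space \<mu> by (rule borel_probD[OF mu])
  interpret P: pair_prob_space \<mu> m ..
  have [measurable]: "\<phi> \<in> borel_measurable borel"
    using \<phi> by (simp add: L_infty_def borel_prob_measurable[OF haar_probD[OF haar]])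
  obtain C0 where C0: "AE \<theta> in m. \<bar>\<phi> \<theta>\<bar> \<le> C0"
    using \<phi> by (auto simp: L_infty_def)
  define C where "C = \<bar>C0\<bar>"
  \<comment> \<open>The observable is bounded only almost everywhere; truncate it to make every integral below finite.
    By Fubini the Markov operator does not see the change, up to a null set.\<close>
  define \<psi> where "\<psi> \<theta> = max (- C) (min C (\<phi> \<theta>))" for \<theta>
  have [measurable]: "\<psi> \<in> borel_measurable borel"
    unfolding \<psi>_def by measurable
  have bound: "\<bar>\<psi> \<theta>\<bar> \<le> C" for \<theta>
    by (simp add: \<psi>_def C_def)
  have eq: "AE \<theta> in m. \<phi> \<theta> = \<psi> \<theta>"
    using C0 by eventually_elim (auto simp: \<psi>_def C_def)
  have "AE \<alpha> in \<mu>. AE \<theta> in m. \<phi> (\<theta> + \<alpha>) = \<psi> (\<theta> + \<alpha>)"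
    using haar_AE_add[OF haar eq] by simp
  then have "AE \<theta> in m. AE \<alpha> in \<mu>. \<phi> (\<theta> + \<alpha>) = \<psi> (\<theta> + \<alpha>)"
    by (subst P.AE_commute[symmetric]) measurable
  then have "AE \<theta> in m. markov_op \<mu> \<phi> \<theta> = markov_op \<mu> \<psi> \<theta>"
    unfolding markov_op_def by eventually_elim (auto intro!: integral_cong_AE)
  with eq stat have fixed: "AE \<theta> in m. markov_op \<mu> \<psi> \<theta> = \<psi> \<theta>"
    unfolding stationary_observable_def by eventually_elim simp
  define a where "a k = (\<integral>\<theta>. \<psi> \<theta> *\<^sub>R character k \<theta> \<partial>m)" for k
  have norm_le: "norm (\<psi> \<theta> *\<^sub>R character k \<theta>') \<le> C" for \<theta> \<theta>' k
    using bound[of \<theta>] by simp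
  have a_0: "a k = 0" if k: "k \<noteq> 0" for k
  proof -
    have [measurable]: "markov_op \<mu> \<psi> \<in> borel_measurable borel"
      by (rule borel_measurable_markov_op[OF mu]) simp
    have "a k = (\<integral>\<theta>. markov_op \<mu> \<psi> \<theta> *\<^sub>R character k \<theta> \<partial>m)"
      unfolding a_def using fixed by (intro integral_cong_AE) (auto elim!: eventually_mono)
    also have "\<dots> = (\<integral>\<theta>. (\<integral>\<alpha>. \<psi> (\<theta> + \<alpha>) *\<^sub>R character k \<theta> \<partial>\<mu>) \<partial>m)"
      unfolding markov_op_def
      by (intro Bochner_Integration.integral_cong refl integral_scaleR_left[symmetric]
          integrable_translate[OF mu, where C=C and \<phi>=\<psi>]) (auto simp: bound)
    also have "\<dots> = (\<integral>\<alpha>. (\<integral>\<theta>. \<psi> (\<theta> + \<alpha>) *\<^sub>R character k \<theta> \<partial>m) \<partial>\<mu>)"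
      by (rule P.Fubini_integral, rule P.integrable_const_bound[where B=C]) (auto simp: split_beta norm_le simp del: norm_scaleR)
    also have "\<dots> = (\<integral>\<alpha>. cnj (character k \<alpha>) * a k \<partial>\<mu>)"
    proof (rule Bochner_Integration.integral_cong[OF refl])
      fix \<alpha>
      have "(\<integral>\<theta>. \<psi> (\<theta> + \<alpha>) *\<^sub>R character k \<theta> \<partial>m) =
          (\<integral>\<theta>. cnj (character k \<alpha>) * (\<psi> (\<theta> + \<alpha>) *\<^sub>R character k (\<theta> + \<alpha>)) \<partial>m)"
      proof (rule Bochner_Integration.integral_cong[OF refl])
        fix \<theta>
        have "character k \<theta> = cnj (character k \<alpha>) * character k (\<theta> + \<alpha>)"
          using character_add[of k "\<theta> + \<alpha>" "- \<alpha>"] by (simp add: character_uminus_arg)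
        then show "\<psi> (\<theta> + \<alpha>) *\<^sub>R character k \<theta> = cnj (character k \<alpha>) * (\<psi> (\<theta> + \<alpha>) *\<^sub>R character k (\<theta> + \<alpha>))"
          by (metis mult_scaleR_right)
      qed
      also have "\<dots> = cnj (character k \<alpha>) * (\<integral>\<theta>. \<psi> (\<theta> + \<alpha>) *\<^sub>R character k (\<theta> + \<alpha>) \<partial>m)"
        by (rule integral_mult_right_zero)
      also have "(\<integral>\<theta>. \<psi> (\<theta> + \<alpha>) *\<^sub>R character k (\<theta> + \<alpha>) \<partial>m) = a k"
        unfolding a_def by (rule haar_integral_add[OF haar]) measurable
      finally show "(\<integral>\<theta>. \<psi> (\<theta> + \<alpha>) *\<^sub>R character k \<theta> \<partial>m) = cnj (character k \<alpha>) * a k" .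
    qed
    also have "\<dots> = cnj (fourier_coeff \<mu> k) * a k"
      unfolding fourier_coeff_eq by simp
    finally have "a k * (1 - cnj (fourier_coeff \<mu> k)) = 0"
      by (simp add: algebra_simps)
    moreover have "cnj (fourier_coeff \<mu> k) \<noteq> 1"
      using ne[OF k] by (metis complex_cnj_cnj complex_cnj_one)
    ultimately show ?thesis by simp
  qed
  \<comment> \<open>Adding \<open>C + 1\<close> makes the function at least \<open>1\<close>, so its integral \<open>Z\<close> is a positive normalisation.\<close>
  define Z where "Z = C + 1 + (\<integral>\<theta>. \<psi> \<theta> \<partial>m)"
  have int: "integrable m \<psi>"
    using bound by (intro borel_prob_integrable_bounded[OF haar_probD[OF haar], where C=C]) auto
  have "- C \<le> (\<integral>\<theta>. \<psi> \<theta> \<partial>m)"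
  proof -
    have "- C \<le> \<psi> \<theta>" for \<theta>
      using bound[of \<theta>] by simp
    then have "(\<integral>\<theta>. - C \<partial>m) \<le> (\<integral>\<theta>. \<psi> \<theta> \<partial>m)"
      using int by (intro integral_mono) auto
    then show ?thesis by (simp add: m.prob_space)
  qed
  then have Z: "Z > 0" by (simp add: Z_def)
  define g where "g \<theta> = (C + 1 + \<psi> \<theta>) / Z" for \<theta>
  have [measurable]: "g \<in> borel_measurable borel"
    unfolding g_def by measurable
  have "AE \<theta> in m. g \<theta> = 1"
  proof (rule haar_density_eq_1[OF haar])
    show "g \<in> borel_measurable borel" by measurable
    show "0 \<le> g \<theta>" for \<theta>
      using bound[of \<theta>] Z by (simp add: g_def abs_le_iff)
    show "g \<theta> \<le> (C + 1 + C) / Z" for \<theta>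
      using bound[of \<theta>] Z by (simp add: g_def divide_right_mono)
    show "(\<integral>\<theta>. g \<theta> \<partial>m) = 1"
      using Z int by (simp add: g_def Z_def m.prob_space)
    fix k :: "int ^ 'd" assume k: "k \<noteq> 0"
    have "g \<theta> *\<^sub>R character k \<theta> = (1 / Z) *\<^sub>R ((C + 1) *\<^sub>R character k \<theta> + \<psi> \<theta> *\<^sub>R character k \<theta>)" for \<theta>
      unfolding scaleR_add_left[symmetric] g_def by simp
    moreover have "integrable m (\<lambda>\<theta>. \<psi> \<theta> *\<^sub>R character k \<theta>)"
      by (rule borel_prob_integrable_bounded[OF haar_probD[OF haar] _ norm_le]) measurable
    moreover have "integrable m (\<lambda>\<theta>. (C + 1) *\<^sub>R character k \<theta>)"
      by (intro integrable_scaleR_right integrable_character haar_probD[OF haar])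
    ultimately have "(\<integral>\<theta>. g \<theta> *\<^sub>R character k \<theta> \<partial>m) = (1 / Z) *\<^sub>R ((C + 1) *\<^sub>R fourier_coeff m k + a k)"
      by (simp only: integral_scaleR_right Bochner_Integration.integral_add fourier_coeff_eq a_def)
    then show "(\<integral>\<theta>. g \<theta> *\<^sub>R character k \<theta> \<partial>m) = 0"
      using k a_0 by (simp add: fourier_coeff_haar[OF haar])
  qed
  with eq have "AE \<theta> in m. \<phi> \<theta> = Z - C - 1"
    by eventually_elim (use Z in \<open>simp add: g_def field_simps\<close>)
  then show ?thesis by blast
qed

section \<open>Stationary measures\<close>

lemma image_diff_eq_vimage: "(\<lambda>\<theta>. \<theta> - \<alpha>) ` E = (\<lambda>\<theta>. \<theta> + \<alpha> :: 'a::ab_group_add) -` E"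
proof (intro equalityI subsetI)
  fix \<theta> assume "\<theta> \<in> (\<lambda>\<theta>. \<theta> + \<alpha>) -` E"
  then show "\<theta> \<in> (\<lambda>\<theta>. \<theta> - \<alpha>) ` E"
    by (intro image_eqI[of _ _ "\<theta> + \<alpha>"]) auto
qed auto

lemma stationary_haar:
  fixes \<mu> m :: "'d::finite torus measure"
  assumes mu: "borel_prob \<mu>" and haar: "haar_prob m"
  shows "stationary_measure \<mu> m"
proof -
  interpret prob_space \<mu> by (rule borel_probD[OF mu])
  have "emeasure m ((\<lambda>\<theta>. \<theta> - \<alpha>) ` E) = emeasure m E" if "E \<in> sets borel" for \<alpha> E
  proof -
    have "(\<lambda>\<theta>. \<theta> - \<alpha>) ` E = (+) (- \<alpha>) ` E" by auto
    then show ?thesis using haar that unfolding haar_prob_def by metis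
  qed
  then show ?thesis
    by (simp add: stationary_measure_def haar_probD[OF haar] emeasure_space_1)
qed

text \<open>
  Stationarity read as a convolution: \<open>\<eta>\<close> is the law of the sum of independent points with laws \<open>\<mu>\<close>
  and \<open>\<eta>\<close>.
\<close>

lemma stationary_measure_distr:
  fixes \<mu> \<eta> :: "'d::finite torus measure"
  assumes mu: "borel_prob \<mu>" and stat: "stationary_measure \<mu> \<eta>"
  shows "distr (\<mu> \<Otimes>\<^sub>M \<eta>) borel (\<lambda>(\<alpha>, \<theta>). \<theta> + \<alpha>) = \<eta>"
proof (rule measure_eqI)
  have eta: "borel_prob \<eta>" using stat by (simp add: stationary_measure_def)
  note [measurable_cong] = borel_probD(2)[OF mu] borel_probD(2)[OF eta]
  interpret prob_space \<eta> by (rule borel_probD[OF eta])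
  show "sets (distr (\<mu> \<Otimes>\<^sub>M \<eta>) borel (\<lambda>(\<alpha>, \<theta>). \<theta> + \<alpha>)) = sets \<eta>"
    by (simp add: borel_probD[OF eta])
  fix E assume "E \<in> sets (distr (\<mu> \<Otimes>\<^sub>M \<eta>) borel (\<lambda>(\<alpha>, \<theta>). \<theta> + \<alpha>))"
  then have E [measurable]: "E \<in> sets borel" by simp
  have "emeasure (distr (\<mu> \<Otimes>\<^sub>M \<eta>) borel (\<lambda>(\<alpha>, \<theta>). \<theta> + \<alpha>)) E =
      emeasure (\<mu> \<Otimes>\<^sub>M \<eta>) ((\<lambda>(\<alpha>, \<theta>). \<theta> + \<alpha>) -` E \<inter> space (\<mu> \<Otimes>\<^sub>M \<eta>))"
    by (subst emeasure_distr) auto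
  also have "\<dots> = (\<integral>\<^sup>+\<alpha>. emeasure \<eta> (Pair \<alpha> -` ((\<lambda>(\<alpha>, \<theta>). \<theta> + \<alpha>) -` E \<inter> space (\<mu> \<Otimes>\<^sub>M \<eta>))) \<partial>\<mu>)"
    by (rule emeasure_pair_measure_alt) measurable
  also have "\<dots> = (\<integral>\<^sup>+\<alpha>. emeasure \<eta> ((\<lambda>\<theta>. \<theta> - \<alpha>) ` E) \<partial>\<mu>)"
    unfolding image_diff_eq_vimage
    by (intro nn_integral_cong arg_cong[where f="emeasure \<eta>"])
      (auto simp: space_pair_measure borel_probD[OF mu] borel_probD[OF eta])
  also have "\<dots> = emeasure \<eta> E"
    using stat E by (simp add: stationary_measure_def)
  finally show "emeasure (distr (\<mu> \<Otimes>\<^sub>M \<eta>) borel (\<lambda>(\<alpha>, \<theta>). \<theta> + \<alpha>)) E = emeasure \<eta> E" .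
qed

lemma fourier_coeff_stationary:
  fixes \<mu> \<eta> :: "'d::finite torus measure"
  assumes mu: "borel_prob \<mu>" and stat: "stationary_measure \<mu> \<eta>"
  shows "fourier_coeff \<eta> k = fourier_coeff \<mu> k * fourier_coeff \<eta> k"
proof -
  have eta: "borel_prob \<eta>" using stat by (simp add: stationary_measure_def)
  note [measurable_cong] = borel_probD(2)[OF mu] borel_probD(2)[OF eta]
  interpret eta: prob_space \<eta> by (rule borel_probD[OF eta])
  interpret mu: prob_space \<mu> by (rule borel_probD[OF mu])
  interpret P: pair_prob_space \<mu> \<eta> ..
  have "fourier_coeff \<eta> k = (\<integral>\<theta>. character k \<theta> \<partial>distr (\<mu> \<Otimes>\<^sub>M \<eta>) borel (\<lambda>(\<alpha>, \<theta>). \<theta> + \<alpha>))"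
    by (simp only: stationary_measure_distr[OF mu stat] fourier_coeff_eq)
  also have "\<dots> = (\<integral>(\<alpha>, \<theta>). character k \<alpha> * character k \<theta> \<partial>(\<mu> \<Otimes>\<^sub>M \<eta>))"
    by (subst integral_distr) (auto simp: split_beta' character_add mult_ac)
  also have "\<dots> = (\<integral>\<alpha>. (\<integral>\<theta>. character k \<alpha> * character k \<theta> \<partial>\<eta>) \<partial>\<mu>)"
    by (subst P.integral_fst'[symmetric])
      (auto intro!: P.integrable_const_bound[where B=1] simp: split_beta norm_mult)
  also have "\<dots> = fourier_coeff \<mu> k * fourier_coeff \<eta> k"
    by (simp add: fourier_coeff_eq)
  finally show ?thesis .
qed

lemma stationary_measure_unique:
  fixes \<mu> m :: "'d::finite torus measure"
  assumes mu: "borel_prob \<mu>" and haar: "haar_prob m"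
    and ne: "\<And>k. k \<noteq> 0 \<Longrightarrow> fourier_coeff \<mu> k \<noteq> 1" and stat: "stationary_measure \<mu> \<eta>"
  shows "\<eta> = m"
proof (rule fourier_coeff_unique)
  show eta: "borel_prob \<eta>" using stat by (simp add: stationary_measure_def)
  show "borel_prob m" by (rule haar_probD[OF haar])
  fix k :: "int ^ 'd"
  show "fourier_coeff \<eta> k = fourier_coeff m k"
  proof (cases "k = 0")
    case True
    interpret prob_space \<eta> by (rule borel_probD[OF eta])
    have "fourier_coeff \<eta> k = 1" using True by (simp add: fourier_coeff_eq prob_space)
    then show ?thesis using True by (simp add: fourier_coeff_haar[OF haar])
  next
    case False
    then show ?thesis
      using fourier_coeff_stationary[OF mu stat, of k] ne[OF False] by (simp add: fourier_coeff_haar[OF haar])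
  qed
qed

text \<open>
  If \<open>e\<^sub>k = 1\<close> almost everywhere for \<open>\<mu>\<close>, the steps of the walk preserve the density \<open>1 + Re e\<^sub>k\<close>.
\<close>

lemma stationary_density:
  fixes \<mu> m :: "'d::finite torus measure"
  assumes mu: "borel_prob \<mu>" and haar: "haar_prob m" and k: "k \<noteq> 0" and eq: "fourier_coeff \<mu> k = 1"
  shows "\<exists>\<eta>. stationary_measure \<mu> \<eta> \<and> \<eta> \<noteq> m"
proof -
  note m = borel_probD[OF haar_probD[OF haar]]
  note [measurable_cong] = m(2) borel_probD(2)[OF mu]
  interpret m: prob_space m by (rule m)
  interpret mu: prob_space \<mu> by (rule borel_probD[OF mu])
  define h where "h \<theta> = ennreal (1 + Re (character k \<theta>))" for \<theta>
  have [measurable]: "h \<in> borel_measurable borel"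
    unfolding h_def by measurable
  have nonneg: "0 \<le> 1 + Re (character k \<theta>)" for \<theta>
    using abs_Re_le_cmod[of "character k \<theta>"] by simp
  have int: "integrable m (\<lambda>\<theta>. Re (character k \<theta>))"
    by (intro integrable_Re integrable_character haar_probD[OF haar])
  then have int1: "integrable m (\<lambda>\<theta>. 1 + Re (character k \<theta>))"
    by (intro Bochner_Integration.integrable_add) auto
  define \<eta> where "\<eta> = density m h"
  have "(\<integral>\<theta>. 1 + Re (character k \<theta>) \<partial>m) = 1 + 0"
    using int haar_integral_Re_character[OF haar k]
    by (subst Bochner_Integration.integral_add) (auto simp: m.prob_space)
  then have "(\<integral>\<^sup>+\<theta>. h \<theta> \<partial>m) = 1"
    unfolding h_def using nn_integral_eq_integral[OF int1] nonneg by simp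
  then have "prob_space \<eta>"
    by (intro prob_spaceI) (simp add: \<eta>_def emeasure_density cong: nn_integral_cong_simp)
  then have eta: "borel_prob \<eta>"
    by (simp add: borel_prob_def \<eta>_def m)
  have "(\<integral>\<^sup>+\<alpha>. emeasure \<eta> ((\<lambda>\<theta>. \<theta> - \<alpha>) ` E) \<partial>\<mu>) = emeasure \<eta> E" if E [measurable]: "E \<in> sets borel" for E
  proof -
    have "AE \<alpha> in \<mu>. character k \<alpha> = 1"
      using eq fourier_coeff_eq_1_iff[OF mu] by simp
    then have "AE \<alpha> in \<mu>. emeasure \<eta> ((\<lambda>\<theta>. \<theta> - \<alpha>) ` E) = emeasure \<eta> E"
    proof eventually_elim
      fix \<alpha> assume "character k \<alpha> = 1"
      then have h: "h (\<theta> + \<alpha>) = h \<theta>" for \<theta>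
        by (simp add: h_def character_add)
      have "(\<lambda>\<theta>. \<theta> + \<alpha>) -` E \<inter> space borel \<in> sets borel"
        by measurable
      then have "emeasure \<eta> ((\<lambda>\<theta>. \<theta> - \<alpha>) ` E) = (\<integral>\<^sup>+\<theta>. h \<theta> * indicator ((\<lambda>\<theta>. \<theta> + \<alpha>) -` E) \<theta> \<partial>m)"
        unfolding image_diff_eq_vimage \<eta>_def by (subst emeasure_density) (auto simp: m)
      also have "\<dots> = (\<integral>\<^sup>+\<theta>. h (\<theta> + \<alpha>) * indicator E (\<theta> + \<alpha>) \<partial>m)"
        by (simp add: h indicator_def)
      also have "\<dots> = (\<integral>\<^sup>+\<theta>. h \<theta> * indicator E \<theta> \<partial>m)"
        by (rule haar_nn_integral_add[OF haar]) measurable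
      also have "\<dots> = emeasure \<eta> E"
        unfolding \<eta>_def by (subst emeasure_density) (auto simp: m)
      finally show "emeasure \<eta> ((\<lambda>\<theta>. \<theta> - \<alpha>) ` E) = emeasure \<eta> E" .
    qed
    then have "(\<integral>\<^sup>+\<alpha>. emeasure \<eta> ((\<lambda>\<theta>. \<theta> - \<alpha>) ` E) \<partial>\<mu>) = (\<integral>\<^sup>+\<alpha>. emeasure \<eta> E \<partial>\<mu>)"
      by (rule nn_integral_cong_AE)
    then show ?thesis by (simp add: mu.emeasure_space_1)
  qed
  then have "stationary_measure \<mu> \<eta>"
    using eta by (simp add: stationary_measure_def)
  moreover have "\<eta> \<noteq> m"
  proof
    assume "\<eta> = m"
    then have "density m h = density m (\<lambda>_. 1)"
      by (simp add: \<eta>_def density_1)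
    then have "AE \<theta> in m. h \<theta> = 1"
      by (intro m.density_unique) auto
    then have "AE \<theta> in m. Re (character k \<theta>) = 0"
      by eventually_elim (simp add: h_def ennreal_eq_1)
    then show False
      using Re_character_not_AE_const[OF haar k] by blast
  qed
  ultimately show ?thesis by blast
qed

section \<open>Ergodic transformations\<close>

text \<open>
  The definition of ergodicity speaks of exactly invariant sets. The set of points whose orbit
  visits \<open>D\<close> infinitely often is exactly invariant, and it differs from an almost invariant \<open>D\<close> by a
  null set.
\<close>

lemma ergodic_AE_invariant:
  assumes erg: "ergodic M T" and prob: "prob_space M" and D [measurable]: "D \<in> sets M"
    and inv: "AE x in M. T x \<in> D \<longleftrightarrow> x \<in> D"
  shows "(AE x in M. x \<in> D) \<or> (AE x in M. x \<notin> D)"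
proof -
  interpret prob_space M by (rule prob)
  have T [measurable]: "T \<in> measurable M M" and distr: "distr M M T = M"
    using erg by (auto simp: ergodic_def)
  have iter [measurable]: "T ^^ n \<in> measurable M M" for n
    by (induction n) (auto simp: id_def comp_def)
  have AE_n: "AE x in M. (T ^^ n) x \<in> D \<longleftrightarrow> x \<in> D" for n
  proof (induction n)
    case (Suc n)
    have "AE x in distr M M T. (T ^^ n) x \<in> D \<longleftrightarrow> x \<in> D"
      unfolding distr by (rule Suc)
    then have "AE x in M. (T ^^ n) (T x) \<in> D \<longleftrightarrow> T x \<in> D"
      by (rule AE_distrD[OF T])
    with inv show ?case
      by eventually_elim (simp add: funpow_swap1)
  qed simp
  define B where "B = {x \<in> space M. \<forall>k::nat. \<exists>n::nat. k \<le> n \<and> (T ^^ n) x \<in> D}"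
  have B [measurable]: "B \<in> sets M"
    unfolding B_def by measurable
  have "T -` B \<inter> space M = B"
  proof (intro equalityI subsetI)
    fix x assume x: "x \<in> T -` B \<inter> space M"
    have "\<exists>n\<ge>k. (T ^^ n) x \<in> D" for k
    proof -
      obtain n where "n \<ge> k" "(T ^^ n) (T x) \<in> D"
        using x by (auto simp: B_def)
      then show ?thesis
        by (intro exI[of _ "Suc n"]) (simp add: funpow_swap1)
    qed
    then show "x \<in> B" using x by (auto simp: B_def)
  next
    fix x assume x: "x \<in> B"
    have "\<exists>n\<ge>k. (T ^^ n) (T x) \<in> D" for k
    proof -
      obtain n where "n \<ge> Suc k" "(T ^^ n) x \<in> D"
        using x unfolding B_def by blast
      then show ?thesis
        by (intro exI[of _ "n - 1"]) (cases n; simp add: funpow_swap1)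
    qed
    then show "x \<in> T -` B \<inter> space M"
      using x measurable_space[OF T] by (auto simp: B_def)
  qed
  then have "emeasure M B = 0 \<or> emeasure M (space M - B) = 0"
    using erg B by (simp add: ergodic_def)
  then have "(AE x in M. x \<notin> B) \<or> (AE x in M. x \<in> B)"
    using AE_iff_null_sets[OF B] AE_iff_null_sets[of "space M - B" M] by (auto simp: null_sets_def)
  moreover have "AE x in M. \<forall>n. (T ^^ n) x \<in> D \<longleftrightarrow> x \<in> D"
    using AE_n by (simp add: AE_all_countable)
  then have "AE x in M. x \<in> B \<longleftrightarrow> x \<in> D"
    using AE_space by eventually_elim (auto simp: B_def)
  ultimately show ?thesis
  proof (elim disjE)
    assume "AE x in M. x \<notin> B" "AE x in M. x \<in> B \<longleftrightarrow> x \<in> D"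
    then have "AE x in M. x \<notin> D" by eventually_elim simp
    then show ?thesis ..
  next
    assume "AE x in M. x \<in> B" "AE x in M. x \<in> B \<longleftrightarrow> x \<in> D"
    then have "AE x in M. x \<in> D" by eventually_elim simp
    then show ?thesis ..
  qed
qed

text \<open>
  Let \<open>D\<close> be the set where the density of \<open>\<nu>\<close> exceeds \<open>1\<close>. Both measures are preserved, so each
  gives equal mass to the two differences between \<open>D\<close> and its preimage; but \<open>\<nu>\<close> is strictly larger
  than \<open>M\<close> on non-null subsets of \<open>D\<close> and at most \<open>M\<close> off \<open>D\<close>. Hence \<open>D\<close> is almost invariant. It
  cannot have full measure, since \<open>\<nu>\<close> has total mass \<open>1\<close>; so it is null, \<open>\<nu> \<le> M\<close>, and equal total
  masses give equality.
\<close>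

lemma ergodic_unique_invariant_density:
  assumes erg: "ergodic M T" and M: "prob_space M" and \<nu>: "prob_space \<nu>" and sets: "sets \<nu> = sets M"
    and ac: "absolutely_continuous M \<nu>" and inv: "distr \<nu> M T = \<nu>"
  shows "\<nu> = M"
proof -
  interpret M: prob_space M by (rule M)
  interpret \<nu>: prob_space \<nu> by (rule \<nu>)
  note [measurable_cong] = sets
  have space: "space \<nu> = space M" using sets by (rule sets_eq_imp_space_eq)
  have T [measurable]: "T \<in> measurable M M" and distr: "distr M M T = M"
    using erg by (auto simp: ergodic_def)
  define h where "h = RN_deriv M \<nu>"
  have [measurable]: "h \<in> borel_measurable M"
    by (simp add: h_def)
  have dens: "density M h = \<nu>"
    unfolding h_def by (rule M.density_RN_deriv[OF ac sets])
  have \<nu>_eq: "emeasure \<nu> E = (\<integral>\<^sup>+x. h x * indicator E x \<partial>M)" if "E \<in> sets M" for E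
    using that by (subst dens[symmetric]) (simp add: emeasure_density)
  define D where "D = {x \<in> space M. h x > 1}"
  have D [measurable]: "D \<in> sets M"
    unfolding D_def by measurable
  have small: "emeasure \<nu> E \<le> emeasure M E" if [measurable]: "E \<in> sets M" and "E \<inter> D = {}" for E
  proof -
    have "emeasure \<nu> E \<le> (\<integral>\<^sup>+x. indicator E x \<partial>M)"
      unfolding \<nu>_eq[OF that(1)] using that(2)
      by (intro nn_integral_mono) (auto simp: D_def split: split_indicator)
    then show ?thesis by simp
  qed
  have large: "emeasure M E = 0" if [measurable]: "E \<in> sets M" and E: "E \<subseteq> D" "emeasure \<nu> E \<le> emeasure M E" for E
  proof -
    have "h x * indicator E x = indicator E x + (h x - 1) * indicator E x" if "x \<in> space M" for x
      using E(1) by (auto simp: D_def subset_eq split: split_indicator intro!: add_diff_inverse_ennreal[symmetric] less_imp_le)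
    then have "emeasure \<nu> E = (\<integral>\<^sup>+x. indicator E x + (h x - 1) * indicator E x \<partial>M)"
      unfolding \<nu>_eq[OF that(1)] by (intro nn_integral_cong)
    also have "\<dots> = emeasure M E + (\<integral>\<^sup>+x. (h x - 1) * indicator E x \<partial>M)"
      by (subst nn_integral_add) auto
    finally have "emeasure M E + (\<integral>\<^sup>+x. (h x - 1) * indicator E x \<partial>M) \<le> emeasure M E + 0"
      using E(2) by simp
    then have "(\<integral>\<^sup>+x. (h x - 1) * indicator E x \<partial>M) \<le> 0"
      by (subst (asm) ennreal_add_left_cancel_le) auto
    then have "AE x in M. (h x - 1) * indicator E x = 0"
      by (subst nn_integral_0_iff_AE[symmetric]) auto
    then have "AE x in M. x \<notin> E"
      using AE_space
    proof eventually_elim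
      case (elim x)
      show ?case
      proof
        assume "x \<in> E"
        then have "h x > 1" using E(1) by (auto simp: D_def)
        then have "h x - 1 \<noteq> 0" by (simp add: diff_eq_0_iff_ennreal not_le)
        with elim \<open>x \<in> E\<close> show False by simp
      qed
    qed
    then show ?thesis using AE_iff_null_sets[OF that(1)] by (simp add: null_sets_def)
  qed
  define D' where "D' = T -` D \<inter> space M"
  have D' [measurable]: "D' \<in> sets M"
    unfolding D'_def by measurable
  have "emeasure M D' = emeasure M D"
    using arg_cong[OF distr, of "\<lambda>N. emeasure N D"] by (simp add: D'_def emeasure_distr)
  then have M_eq: "measure M (D - D') = measure M (D' - D)"
    using M.finite_measure_Diff'[OF D D'] M.finite_measure_Diff'[OF D' D]
    by (simp add: M.emeasure_eq_measure Int_commute[of D' D])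
  have "emeasure \<nu> D' = emeasure \<nu> D"
    using arg_cong[OF inv, of "\<lambda>N. emeasure N D"] by (simp add: D'_def emeasure_distr space)
  then have "measure \<nu> (D - D') = measure \<nu> (D' - D)"
    using \<nu>.finite_measure_Diff'[of D D'] \<nu>.finite_measure_Diff'[of D' D] sets
    by (simp add: \<nu>.emeasure_eq_measure Int_commute[of D' D])
  then have \<nu>_D: "emeasure \<nu> (D - D') = emeasure \<nu> (D' - D)"
    by (simp add: \<nu>.emeasure_eq_measure)
  have M_D: "emeasure M (D - D') = emeasure M (D' - D)"
    using M_eq by (simp add: M.emeasure_eq_measure)
  have "emeasure \<nu> (D - D') \<le> emeasure M (D - D')"
    using small[of "D' - D"] \<nu>_D M_D by auto
  then have null: "emeasure M (D - D') = 0"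
    by (intro large) auto
  then have "emeasure M (D' - D) = 0"
    using M_D by simp
  with null have "AE x in M. x \<notin> D - D'" "AE x in M. x \<notin> D' - D"
    using AE_iff_null_sets[of "D - D'" M] AE_iff_null_sets[of "D' - D" M] by (simp_all add: null_sets_def)
  then have "AE x in M. T x \<in> D \<longleftrightarrow> x \<in> D"
    using AE_space by eventually_elim (auto simp: D'_def)
  from ergodic_AE_invariant[OF erg M D this]
  have not_D: "AE x in M. x \<notin> D"
  proof
    assume "AE x in M. x \<in> D"
    then have "emeasure M D = 1"
      by (subst M.emeasure_eq_1_AE) auto
    moreover have "emeasure \<nu> D \<le> 1"
      by (rule \<nu>.emeasure_le_1)
    ultimately have "emeasure M D = 0"
      by (intro large) auto
    with \<open>emeasure M D = 1\<close> show ?thesis by simp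
  qed simp
  have le: "emeasure \<nu> E \<le> emeasure M E" if E [measurable]: "E \<in> sets M" for E
    unfolding \<nu>_eq[OF E] nn_integral_indicator[OF E, symmetric] using not_D AE_space
    by (intro nn_integral_mono_AE) (auto elim!: eventually_elim2 simp: D_def not_less split: split_indicator)
  show ?thesis
  proof (rule measure_eqI[OF sets])
    fix E assume "E \<in> sets \<nu>"
    then have E [measurable]: "E \<in> sets M" by (simp add: sets)
    have "measure \<nu> E \<le> measure M E" "measure \<nu> (space M - E) \<le> measure M (space M - E)"
      using le[of E] le[of "space M - E"] by (simp_all add: M.emeasure_eq_measure \<nu>.emeasure_eq_measure)
    moreover have "measure \<nu> (space M - E) = 1 - measure \<nu> E"
      using \<nu>.prob_compl[of E] by (simp add: space sets)
    moreover have "measure M (space M - E) = 1 - measure M E"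
      using M.prob_compl[of E] by simp
    ultimately have "measure \<nu> E = measure M E" by linarith
    then show "emeasure \<nu> E = emeasure M E"
      by (simp add: M.emeasure_eq_measure \<nu>.emeasure_eq_measure)
  qed
qed

section \<open>The skew product\<close>

lemma borel_measurable_torus_sum [measurable (raw)]:
  fixes f :: "'b \<Rightarrow> 'a \<Rightarrow> 'd::finite torus"
  assumes "\<And>i. i \<in> I \<Longrightarrow> f i \<in> borel_measurable M"
  shows "(\<lambda>x. \<Sum>i\<in>I. f i x) \<in> borel_measurable M"
  using assms
proof (induction I rule: infinite_finite_induct)
  case (insert i I)
  then show ?case by (simp add: borel_measurable_torus_add)
qed auto

text \<open>
  Indices range over any semiring, so that the one-sided and the two-sided system share this
  formula.
\<close>

lemma funpow_skew_product:
  fixes \<beta> :: "'i::semiring_1 \<Rightarrow> 'a::ab_group_add"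
  shows "(skew_product ^^ n) (\<beta>, \<theta>) = (\<lambda>i. \<beta> (i + of_nat n), \<theta> + (\<Sum>j<n. \<beta> (of_nat j)))"
  by (induction n) (auto simp: skew_product_def add_ac)

locale torus_walk =
  fixes \<mu> m :: "'d::finite torus measure"
  assumes mu: "borel_prob \<mu>" and haar: "haar_prob m"
begin

lemma sets_mu [measurable_cong, simp]: "sets \<mu> = sets borel"
  and sets_m [measurable_cong, simp]: "sets m = sets borel"
  and space_mu [simp]: "space \<mu> = UNIV"
  and space_m [simp]: "space m = UNIV"
  using borel_probD[OF mu] borel_probD[OF haar_probD[OF haar]] by auto

sublocale mu: prob_space \<mu>
  by (rule borel_probD[OF mu])

sublocale m: prob_space m
  by (rule borel_probD[OF haar_probD[OF haar]])

abbreviation noise :: "('i \<Rightarrow> 'd torus) measure"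
  where "noise \<equiv> PiM UNIV (\<lambda>_. \<mu>)"

abbreviation K :: "(('i \<Rightarrow> 'd torus) \<times> 'd torus) measure"
  where "K \<equiv> skew_measure \<mu> m"

lemma prob_noise: "prob_space (noise :: ('i \<Rightarrow> 'd torus) measure)"
  by (rule prob_space_PiM) (rule mu.prob_space_axioms)

lemma space_noise [simp]: "space (noise :: ('i \<Rightarrow> 'd torus) measure) = UNIV"
  by (simp add: space_PiM)

lemma sets_K [measurable_cong]: "sets (K :: (('i \<Rightarrow> 'd torus) \<times> 'd torus) measure) = sets (noise \<Otimes>\<^sub>M m)"
  by (simp only: skew_measure_def)

lemma space_K [simp]: "space (K :: (('i \<Rightarrow> 'd torus) \<times> 'd torus) measure) = UNIV"
  by (simp add: skew_measure_def space_pair_measure)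

lemma prob_K: "prob_space (K :: (('i \<Rightarrow> 'd torus) \<times> 'd torus) measure)"
proof -
  interpret N: prob_space "noise :: ('i \<Rightarrow> 'd torus) measure" by (rule prob_noise)
  interpret pair_prob_space "noise :: ('i \<Rightarrow> 'd torus) measure" m ..
  show ?thesis unfolding skew_measure_def by (rule prob_space_axioms)
qed

lemma measurable_coordinate: "(\<lambda>\<beta> :: 'i \<Rightarrow> 'd torus. \<beta> i) \<in> borel_measurable noise"
proof -
  have "(\<lambda>\<beta>. \<beta> i) \<in> measurable (noise :: ('i \<Rightarrow> 'd torus) measure) \<mu>"
    by (rule measurable_component_singleton) simp
  then show ?thesis by simp
qed

lemma measurable_reindex:
  fixes f :: "'j \<Rightarrow> 'i"
  shows "(\<lambda>\<beta> :: 'i \<Rightarrow> 'd torus. \<lambda>j. \<beta> (f j)) \<in> measurable noise noise"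
  by (rule measurable_PiM_single') (auto simp: space_PiM)

lemma distr_noise_reindex:
  fixes f :: "'j \<Rightarrow> 'i"
  assumes "inj f"
  shows "distr noise noise (\<lambda>\<beta> :: 'i \<Rightarrow> 'd torus. \<lambda>j. \<beta> (f j)) = noise"
  using distr_PiM_reindex[of UNIV "\<lambda>_. \<mu>" f UNIV] assms mu.prob_space_axioms
  by (simp add: restrict_UNIV)

lemma distr_K_fst: "distr K noise fst = (noise :: ('i \<Rightarrow> 'd torus) measure)"
  unfolding skew_measure_def by (rule m.distr_pair_fst)

lemma measurable_skew_product [measurable]:
  "(skew_product :: ('i::semiring_1 \<Rightarrow> 'd torus) \<times> 'd torus \<Rightarrow> _) \<in> measurable K K"
proof -
  let ?N = "(noise :: ('i \<Rightarrow> 'd torus) measure) \<Otimes>\<^sub>M m"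
  have "(\<lambda>x. snd x) \<in> borel_measurable ?N"
    using measurable_snd[of "noise :: ('i \<Rightarrow> 'd torus) measure" m]
    by (simp cong: measurable_cong_sets)
  then have "(\<lambda>x. snd x + fst x 0) \<in> borel_measurable ?N"
    by (intro borel_measurable_torus_add measurable_compose[OF measurable_fst measurable_coordinate])
  then have "(\<lambda>x. snd x + fst x 0) \<in> measurable ?N m"
    by (simp cong: measurable_cong_sets)
  moreover have "(\<lambda>x. \<lambda>i. fst x (i + 1)) \<in> measurable ?N noise"
    by (rule measurable_compose[OF measurable_fst measurable_reindex])
  ultimately have "(\<lambda>x. (\<lambda>i. fst x (i + 1), snd x + fst x 0)) \<in> measurable ?N ?N"
    by (intro measurable_Pair)
  then show ?thesis
    by (simp only: skew_measure_def skew_product_def split_beta')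
qed

lemma
  assumes [measurable]: "f \<in> borel_measurable (K :: (('i \<Rightarrow> 'd torus) \<times> 'd torus) measure)"
  shows nn_integral_K_m_noise: "(\<integral>\<^sup>+x. f x \<partial>K) = (\<integral>\<^sup>+\<theta>. (\<integral>\<^sup>+\<beta>. f (\<beta>, \<theta>) \<partial>noise) \<partial>m)"
    and nn_integral_K_noise_m: "(\<integral>\<^sup>+x. f x \<partial>K) = (\<integral>\<^sup>+\<beta>. (\<integral>\<^sup>+\<theta>. f (\<beta>, \<theta>) \<partial>m) \<partial>noise)"
proof -
  interpret N: prob_space "noise :: ('i \<Rightarrow> 'd torus) measure" by (rule prob_noise)
  interpret pair_prob_space "noise :: ('i \<Rightarrow> 'd torus) measure" m ..
  have [measurable]: "f \<in> borel_measurable (noise \<Otimes>\<^sub>M m)" by measurable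
  show "(\<integral>\<^sup>+x. f x \<partial>K) = (\<integral>\<^sup>+\<theta>. (\<integral>\<^sup>+\<beta>. f (\<beta>, \<theta>) \<partial>noise) \<partial>m)"
    unfolding skew_measure_def by (rule nn_integral_snd[symmetric]) measurable
  show "(\<integral>\<^sup>+x. f x \<partial>K) = (\<integral>\<^sup>+\<beta>. (\<integral>\<^sup>+\<theta>. f (\<beta>, \<theta>) \<partial>m) \<partial>noise)"
    unfolding skew_measure_def by (rule m.nn_integral_fst[symmetric]) measurable
qed

lemma emeasure_K_Times:
  assumes "X \<in> sets (noise :: ('i \<Rightarrow> 'd torus) measure)" "E \<in> sets borel"
  shows "emeasure K (X \<times> E) = emeasure noise X * emeasure m E"
  unfolding skew_measure_def by (rule m.emeasure_pair_measure_Times) (use assms in auto)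

lemma distr_K_snd: "distr (K :: (('i \<Rightarrow> 'd torus) \<times> 'd torus) measure) m snd = m"
proof (rule measure_eqI)
  let ?K = "K :: (('i \<Rightarrow> 'd torus) \<times> 'd torus) measure"
  interpret N: prob_space "noise :: ('i \<Rightarrow> 'd torus) measure" by (rule prob_noise)
  fix E assume "E \<in> sets (distr ?K m snd)"
  then have E [measurable]: "E \<in> sets borel" by simp
  have UNIV: "(UNIV :: ('i \<Rightarrow> 'd torus) set) \<in> sets noise"
    using sets.top[of "noise :: ('i \<Rightarrow> 'd torus) measure"] by simp
  have [measurable]: "snd \<in> measurable ?K m"
    by (simp only: skew_measure_def measurable_snd)
  have "emeasure (distr ?K m snd) E = emeasure ?K (snd -` E)"
    by (subst emeasure_distr) auto
  also have "snd -` E = (UNIV :: ('i \<Rightarrow> 'd torus) set) \<times> E"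
    by auto
  also have "emeasure ?K \<dots> = emeasure m E"
    using N.emeasure_space_1 by (simp add: emeasure_K_Times[OF UNIV E])
  finally show "emeasure (distr ?K m snd) E = emeasure m E" .
qed simp

lemma K_eqI_Times:
  assumes "sets M = sets (K :: (('i \<Rightarrow> 'd torus) \<times> 'd torus) measure)"
    and "\<And>X E. X \<in> sets noise \<Longrightarrow> E \<in> sets borel \<Longrightarrow> emeasure M (X \<times> E) = emeasure noise X * emeasure m E"
  shows "M = K"
proof -
  interpret N: prob_space "noise :: ('i \<Rightarrow> 'd torus) measure" by (rule prob_noise)
  show ?thesis
    unfolding skew_measure_def
    by (rule pair_measure_eqI[symmetric, OF N.sigma_finite_measure_axioms m.sigma_finite_measure_axioms])
      (use assms in \<open>auto simp: sets_K\<close>)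
qed

text \<open>
  For fixed noise the second coordinate is only translated, which Haar measure ignores; what remains
  is the shift on the noise, which is injective on indices and hence preserves the product measure.
\<close>

lemma distr_skew_product:
  "distr K K (skew_product :: ('i::semiring_1_cancel \<Rightarrow> 'd torus) \<times> 'd torus \<Rightarrow> _) = K"
proof (rule K_eqI_Times)
  fix X :: "('i \<Rightarrow> 'd torus) set" and E :: "'d torus set" assume X [measurable]: "X \<in> sets noise" and E [measurable]: "E \<in> sets borel"
  let ?\<sigma> = "\<lambda>\<beta> :: 'i \<Rightarrow> 'd torus. \<lambda>i. \<beta> (i + 1)"
  have XE: "X \<times> E \<in> sets K"
    by (simp add: sets_K)
  have \<sigma>: "?\<sigma> \<in> measurable noise noise"
    by (rule measurable_reindex)
  have tr: "(\<lambda>\<theta>. indicator E (\<theta> + a) :: ennreal) \<in> borel_measurable m" for a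
    by measurable
  have ind: "(\<lambda>\<beta>. indicator X (?\<sigma> \<beta>) :: ennreal) \<in> borel_measurable noise"
    using measurable_compose[OF \<sigma> borel_measurable_indicator[OF X]] .
  have "emeasure (distr K K skew_product) (X \<times> E) = (\<integral>\<^sup>+x. indicator (X \<times> E) x \<partial>distr K K skew_product)"
    using XE by (intro nn_integral_indicator[symmetric]) simp
  also have "\<dots> = (\<integral>\<^sup>+x. indicator (X \<times> E) (skew_product x) \<partial>K)"
    using XE by (intro nn_integral_distr measurable_skew_product borel_measurable_indicator) simp
  also have "\<dots> = (\<integral>\<^sup>+\<beta>. (\<integral>\<^sup>+\<theta>. indicator X (?\<sigma> \<beta>) * indicator E (\<theta> + \<beta> 0) \<partial>m) \<partial>noise)"
    by (subst nn_integral_K_noise_m[OF measurable_compose[OF measurable_skew_product borel_measurable_indicator[OF XE]]])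
      (simp add: skew_product_def indicator_times)
  also have "\<dots> = (\<integral>\<^sup>+\<beta>. indicator X (?\<sigma> \<beta>) * (\<integral>\<^sup>+\<theta>. indicator E (\<theta> + \<beta> 0) \<partial>m) \<partial>noise)"
    by (intro nn_integral_cong nn_integral_cmult tr)
  also have "\<dots> = (\<integral>\<^sup>+\<beta>. indicator X (?\<sigma> \<beta>) * emeasure m E \<partial>noise)"
    using haar_nn_integral_add[OF haar, of "indicator E"] by (simp only: borel_measurable_indicator[OF E] nn_integral_indicator sets_m E)
  also have "\<dots> = (\<integral>\<^sup>+\<beta>. indicator X (?\<sigma> \<beta>) \<partial>noise) * emeasure m E"
    by (rule nn_integral_multc[OF ind])
  also have "(\<integral>\<^sup>+\<beta>. indicator X (?\<sigma> \<beta>) \<partial>noise) = (\<integral>\<^sup>+\<beta>. indicator X \<beta> \<partial>distr noise noise ?\<sigma>)"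
    using X by (intro nn_integral_distr[symmetric] \<sigma> borel_measurable_indicator) simp
  also have "\<dots> = emeasure noise X"
    by (subst distr_noise_reindex) (auto simp: inj_def)
  finally show "emeasure (distr K K skew_product) (X \<times> E) = emeasure noise X * emeasure m E" .
qed simp

lemma cylinder_sets:
  fixes F :: "'i \<Rightarrow> 'd torus set"
  assumes "finite J" "\<And>j. j \<in> J \<Longrightarrow> F j \<in> sets borel"
  shows "{\<beta>. \<forall>j\<in>J. \<beta> j \<in> F j} \<in> sets noise"
proof -
  have "{\<beta> \<in> space noise. \<forall>j\<in>J. \<beta> j \<in> F j} \<in> sets noise"
    using assms by measurable
  then show ?thesis by simp
qed

text \<open>
  Finite measures on the product space are compared on boxes whose first factor is a cylinder. For a
  fixed second factor both sides are measures in the first, and cylinders generate the product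
  \<open>\<sigma>\<close>-algebra.
\<close>

lemma K_eqI_cylinder:
  fixes M :: "(('i \<Rightarrow> 'd torus) \<times> 'd torus) measure"
  assumes sets: "sets M = sets K" and fin: "finite_measure M"
    and eq: "\<And>J F E. finite J \<Longrightarrow> (\<And>j. j \<in> J \<Longrightarrow> F j \<in> sets borel) \<Longrightarrow> E \<in> sets borel \<Longrightarrow>
      emeasure M ({\<beta>. \<forall>j\<in>J. \<beta> j \<in> F j} \<times> E) = emeasure K ({\<beta>. \<forall>j\<in>J. \<beta> j \<in> F j} \<times> E)"
  shows "M = K"
proof (rule K_eqI_Times[OF sets])
  fix X :: "('i \<Rightarrow> 'd torus) set" and E :: "'d torus set" assume X: "X \<in> sets noise" and E [measurable]: "E \<in> sets borel"
  note [measurable_cong] = sets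
  interpret finite_measure M by (rule fin)
  have space: "space M = UNIV" using sets_eq_imp_space_eq[OF sets] by simp
  define M' where "M' = distr (density M (indicator (UNIV \<times> E))) noise fst"
  have [measurable]: "UNIV \<times> E \<in> sets (K :: (('i \<Rightarrow> 'd torus) \<times> 'd torus) measure)"
    using sets.top[of "noise :: ('i \<Rightarrow> 'd torus) measure"] by (simp add: sets_K)
  have M': "emeasure M' Y = emeasure M (Y \<times> E)" if Y [measurable]: "Y \<in> sets noise" for Y
  proof -
    have YE: "fst -` Y \<inter> space M \<in> sets M" by measurable
    have "emeasure M' Y = emeasure (density M (indicator (UNIV \<times> E))) (fst -` Y)"
      unfolding M'_def by (subst emeasure_distr) (auto simp: space)
    also have "\<dots> = (\<integral>\<^sup>+x. indicator (UNIV \<times> E) x * indicator (fst -` Y) x \<partial>M)"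
      using YE by (subst emeasure_density) (auto simp: space)
    also have "\<dots> = (\<integral>\<^sup>+x. indicator (Y \<times> E) x \<partial>M)"
      by (intro nn_integral_cong) (auto split: split_indicator)
    also have "\<dots> = emeasure M (Y \<times> E)"
      by (rule nn_integral_indicator) (simp add: sets sets_K)
    finally show ?thesis .
  qed
  have "M' = scale_measure (emeasure m E) noise"
  proof (rule measure_eqI_PiM_infinite)
    show "finite_measure M'"
    proof
      show "emeasure M' (space M') \<noteq> \<infinity>"
        using M'[OF sets.top] by (simp add: M'_def)
    qed
    fix F :: "'i \<Rightarrow> 'd torus set" and J assume J: "finite J" "J \<subseteq> UNIV" "\<And>i. i \<in> J \<Longrightarrow> F i \<in> sets \<mu>"
    have "prod_emb UNIV (\<lambda>_. \<mu>) J (Pi\<^sub>E J F) = {\<beta>. \<forall>j\<in>J. \<beta> j \<in> F j}"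
      by (auto simp: prod_emb_def PiE_iff)
    then show "emeasure M' (prod_emb UNIV (\<lambda>_. \<mu>) J (Pi\<^sub>E J F)) =
        emeasure (scale_measure (emeasure m E) noise) (prod_emb UNIV (\<lambda>_. \<mu>) J (Pi\<^sub>E J F))"
      using eq[of J F E] J E cylinder_sets[of J F] by (simp add: M' emeasure_K_Times mult.commute)
  qed (simp_all add: M'_def)
  then show "emeasure M (X \<times> E) = emeasure noise X * emeasure m E"
    using M'[OF X] by (simp add: mult.commute)
qed

section \<open>Ergodicity forces nontrivial Fourier coefficients\<close>

text \<open>
  If \<open>e\<^sub>k = 1\<close> almost everywhere for \<open>\<mu>\<close>, the condition \<open>Re e\<^sub>k > 0\<close> on the second coordinate is
  almost invariant. Ergodicity would give \<open>Re e\<^sub>k\<close> a constant sign, and as its integral is zero it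
  would vanish.
\<close>

lemma ergodic_imp_fourier_coeff_ne_1:
  assumes erg: "ergodic (K :: (('i::semiring_1_cancel \<Rightarrow> 'd torus) \<times> 'd torus) measure) skew_product"
    and k: "k \<noteq> 0"
  shows "fourier_coeff \<mu> k \<noteq> 1"
proof
  assume "fourier_coeff \<mu> k = 1"
  then have one: "AE \<alpha> in \<mu>. character k \<alpha> = 1"
    using fourier_coeff_eq_1_iff[OF mu] by simp
  let ?K = "K :: (('i::semiring_1_cancel \<Rightarrow> 'd torus) \<times> 'd torus) measure"
  define D where "D = {x \<in> space ?K. Re (character k (snd x)) > 0}"
  have D [measurable]: "D \<in> sets ?K"
    unfolding D_def by measurable
  have "AE \<beta> in (noise :: ('i \<Rightarrow> 'd torus) measure). character k (\<beta> 0) = 1"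
    by (rule AE_PiM_component) (use one mu.prob_space_axioms in auto)
  then have "AE \<beta> in distr ?K noise fst. character k (\<beta> 0) = 1"
    by (simp only: distr_K_fst)
  then have "AE x in ?K. character k (fst x 0) = 1"
    by (rule AE_distrD[rotated]) measurable
  then have "AE x in ?K. skew_product x \<in> D \<longleftrightarrow> x \<in> D"
    by eventually_elim (auto simp: D_def skew_product_def split_beta character_add)
  from ergodic_AE_invariant[OF erg prob_K D this]
  have "(AE x in ?K. Re (character k (snd x)) > 0) \<or> (AE x in ?K. Re (character k (snd x)) \<le> 0)"
    by (simp add: D_def not_less)
  moreover have transfer: "(AE \<theta> in m. P \<theta>) \<longleftrightarrow> (AE x in ?K. P (snd x))" if [measurable]: "Measurable.pred borel P" for P
    by (subst distr_K_snd[symmetric], subst AE_distr_iff) measurable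
  ultimately have "(AE \<theta> in m. 0 \<le> Re (character k \<theta>)) \<or> (AE \<theta> in m. 0 \<le> - Re (character k \<theta>))"
    by (subst (1 2) transfer) (auto elim: eventually_mono)
  moreover have int: "integrable m (\<lambda>\<theta>. Re (character k \<theta>))"
    by (intro integrable_Re integrable_character haar_probD[OF haar])
  note zero = haar_integral_Re_character[OF haar k]
  have "AE \<theta> in m. Re (character k \<theta>) = 0" if "AE \<theta> in m. 0 \<le> Re (character k \<theta>)"
    using integral_nonneg_eq_0_iff_AE[OF int that] zero by simp
  moreover have "AE \<theta> in m. Re (character k \<theta>) = 0" if "AE \<theta> in m. 0 \<le> - Re (character k \<theta>)"
    using integral_nonneg_eq_0_iff_AE[OF integrable_minus[OF int] that] zero by simp
  ultimately have "AE \<theta> in m. Re (character k \<theta>) = 0"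
    by blast
  then show False
    using Re_character_not_AE_const[OF haar k] by blast
qed

section \<open>Conditioning on an invariant set\<close>

text \<open>
  The conditional probability given \<open>A\<close>. A set has full measure exactly if conditioning on it
  changes nothing, so ergodicity becomes an equality of measures, which can be tested on cylinders.
\<close>

definition conditional :: "(('i \<Rightarrow> 'd torus) \<times> 'd torus) set \<Rightarrow> (('i \<Rightarrow> 'd torus) \<times> 'd torus) measure"
  where "conditional A = density K (\<lambda>x. indicator A x / emeasure K A)"

lemma sets_conditional [simp, measurable_cong]: "sets (conditional A) = sets K"
  and space_conditional [simp]: "space (conditional A) = UNIV"
  by (simp_all add: conditional_def)

lemma emeasure_conditional:
  assumes "A \<in> sets K" "B \<in> sets K"
  shows "emeasure (conditional A) B = emeasure K (A \<inter> B) / emeasure K A"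
proof -
  note [measurable] = assms
  have "emeasure (conditional A) B = (\<integral>\<^sup>+x. indicator A x / emeasure K A * indicator B x \<partial>K)"
    unfolding conditional_def by (subst emeasure_density) auto
  also have "\<dots> = (\<integral>\<^sup>+x. indicator (A \<inter> B) x / emeasure K A \<partial>K)"
    by (intro nn_integral_cong) (auto split: split_indicator)
  also have "\<dots> = emeasure K (A \<inter> B) / emeasure K A"
    by (subst nn_integral_divide) auto
  finally show ?thesis .
qed

lemma prob_conditional:
  fixes A :: "(('i \<Rightarrow> 'd torus) \<times> 'd torus) set"
  assumes "A \<in> sets K" "emeasure K A \<noteq> 0"
  shows "prob_space (conditional A)"
proof
  interpret K: prob_space "K :: (('i \<Rightarrow> 'd torus) \<times> 'd torus) measure" by (rule prob_K)
  have "UNIV \<in> sets (K :: (('i \<Rightarrow> 'd torus) \<times> 'd torus) measure)"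
    using sets.top[of "K :: (('i \<Rightarrow> 'd torus) \<times> 'd torus) measure"] by simp
  from emeasure_conditional[OF assms(1) this]
  show "emeasure (conditional A) (space (conditional A)) = 1"
    using ennreal_divide_self[of "emeasure K A"] assms(2) K.emeasure_finite[of A]
    by (simp add: less_top[symmetric])
qed

lemma conditional_eq_K_imp:
  assumes A: "A \<in> sets K" and eq: "conditional A = K"
  shows "emeasure K (space K - A) = 0"
proof -
  have "emeasure K (space K - A) = emeasure (conditional A) (space K - A)"
    by (simp only: eq)
  also have "\<dots> = 0"
    using A sets.compl_sets[OF A] by (subst emeasure_conditional) auto
  finally show ?thesis .
qed

lemma ergodicI_conditional:
  assumes "\<And>A. A \<in> sets (K :: (('i::semiring_1_cancel \<Rightarrow> 'd torus) \<times> 'd torus) measure) \<Longrightarrow> skew_product -` A = A \<Longrightarrow> emeasure K A \<noteq> 0 \<Longrightarrow>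
    conditional A = K"
  shows "ergodic (K :: (('i \<Rightarrow> 'd torus) \<times> 'd torus) measure) skew_product"
  unfolding ergodic_def
proof (intro conjI ballI impI measurable_skew_product distr_skew_product)
  fix A :: "(('i \<Rightarrow> 'd torus) \<times> 'd torus) set"
  assume A: "A \<in> sets K" "skew_product -` A \<inter> space K = A"
  show "emeasure K A = 0 \<or> emeasure K (space K - A) = 0"
    using assms[of A] A conditional_eq_K_imp[of A] by (cases "emeasure K A = 0") simp_all
qed

section \<open>The one-sided skew product\<close>

text \<open>
  The first \<open>n\<close> coordinates of the noise and its tail are independent.
\<close>

lemma nn_integral_noise_comb_seq:
  fixes f :: "(nat \<Rightarrow> 'd torus) \<Rightarrow> ennreal"
  assumes f: "f \<in> borel_measurable noise"
  shows "(\<integral>\<^sup>+\<beta>. f \<beta> \<partial>noise) = (\<integral>\<^sup>+\<omega>. (\<integral>\<^sup>+\<omega>'. f (comb_seq n \<omega> \<omega>') \<partial>noise) \<partial>noise)"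
proof -
  interpret N: prob_space "noise :: (nat \<Rightarrow> 'd torus) measure" by (rule prob_noise)
  interpret sequence_space \<mu> ..
  have "(\<integral>\<^sup>+\<beta>. f \<beta> \<partial>noise) = (\<integral>\<^sup>+\<beta>. f \<beta> \<partial>distr (noise \<Otimes>\<^sub>M noise) noise (\<lambda>(\<omega>, \<omega>'). comb_seq n \<omega> \<omega>'))"
    by (simp only: PiM_comb_seq)
  also have "\<dots> = (\<integral>\<^sup>+x. f ((\<lambda>(\<omega>, \<omega>'). comb_seq n \<omega> \<omega>') x) \<partial>(noise \<Otimes>\<^sub>M noise))"
    using f by (intro nn_integral_distr[OF measurable_comb_seq]) simp
  also have "\<dots> = (\<integral>\<^sup>+\<omega>. (\<integral>\<^sup>+\<omega>'. f (comb_seq n \<omega> \<omega>') \<partial>noise) \<partial>noise)"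
    using N.nn_integral_fst[OF measurable_compose[OF measurable_comb_seq f], symmetric] by simp
  finally show ?thesis .
qed

lemma nn_integral_noise_coordinate:
  assumes "f \<in> borel_measurable borel"
  shows "(\<integral>\<^sup>+\<beta>. f (\<beta> i) \<partial>(noise :: ('i \<Rightarrow> 'd torus) measure)) = (\<integral>\<^sup>+\<alpha>. f \<alpha> \<partial>\<mu>)"
proof -
  have "distr (noise :: ('i \<Rightarrow> 'd torus) measure) \<mu> (\<lambda>\<beta>. \<beta> i) = \<mu>"
    by (rule distr_PiM_component) (auto intro: mu.prob_space_axioms)
  then have "(\<integral>\<^sup>+\<alpha>. f \<alpha> \<partial>\<mu>) = (\<integral>\<^sup>+\<alpha>. f \<alpha> \<partial>distr (noise :: ('i \<Rightarrow> 'd torus) measure) \<mu> (\<lambda>\<beta>. \<beta> i))"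
    by simp
  also have "\<dots> = (\<integral>\<^sup>+\<beta>. f (\<beta> i) \<partial>noise)"
    using assms by (intro nn_integral_distr) (auto intro: measurable_component_singleton cong: measurable_cong_sets)
  finally show ?thesis ..
qed

lemma funpow_skew_product_comb_seq:
  "(skew_product ^^ n) (comb_seq n \<omega> \<omega>', \<theta>) = (\<omega>', \<theta> + (\<Sum>j<n. \<omega> j))"
  by (simp add: funpow_skew_product comb_seq_add comb_seq_less)

lemma invariant_funpow:
  assumes "f -` A = A"
  shows "(f ^^ n) x \<in> A \<longleftrightarrow> x \<in> A"
  using assms by (induction n arbitrary: x) (auto simp: funpow_swap1)

text \<open>
  For an invariant \<open>A\<close>, whether a point lies in \<open>A\<close> can be decided after \<open>n\<close> steps, when only the
  tail of the noise and the displaced second coordinate are left. Given the first \<open>n\<close> coordinates,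
  the probability of \<open>A\<close> is thus \<open>\<phi>\<close> at the displaced point, where \<open>\<phi> \<theta>\<close> is the probability of \<open>A\<close>
  over a fixed \<open>\<theta>\<close>. For \<open>n = 1\<close> this says that \<open>\<phi>\<close> is stationary, hence a constant; for general \<open>n\<close>
  it then says that \<open>A\<close> is independent of all cylinders.
\<close>

lemma observables_const_imp_ergodic_one_sided:
  assumes const: "\<And>\<phi>. \<phi> \<in> L_infty m \<Longrightarrow> stationary_observable \<mu> m \<phi> \<Longrightarrow> \<exists>c. AE \<theta> in m. \<phi> \<theta> = c"
  shows "ergodic (K :: ((nat \<Rightarrow> 'd torus) \<times> 'd torus) measure) skew_product"
proof (rule ergodicI_conditional)
  fix A :: "((nat \<Rightarrow> 'd torus) \<times> 'd torus) set"
  assume A [measurable]: "A \<in> sets K" and inv: "skew_product -` A = A" and pos: "emeasure K A \<noteq> 0"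
  interpret N: prob_space "noise :: (nat \<Rightarrow> 'd torus) measure" by (rule prob_noise)
  interpret K: prob_space "K :: ((nat \<Rightarrow> 'd torus) \<times> 'd torus) measure" by (rule prob_K)
  interpret Nm: pair_prob_space "noise :: (nat \<Rightarrow> 'd torus) measure" m ..
  have ind: "(\<lambda>x. indicator A x :: ennreal) \<in> borel_measurable (noise \<Otimes>\<^sub>M m)"
    using A by (simp add: sets_K)
  have ind_\<beta>: "(\<lambda>\<beta>. indicator A (\<beta>, \<theta>) :: ennreal) \<in> borel_measurable noise" for \<theta>
    by (rule measurable_compose[OF measurable_Pair2' ind]) simp
  define \<phi> where "\<phi> \<theta> = (\<integral>\<^sup>+\<beta>. indicator A (\<beta>, \<theta>) \<partial>noise)" for \<theta>
  have \<phi>_m: "\<phi> \<in> borel_measurable m"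
    unfolding \<phi>_def using N.borel_measurable_nn_integral_fst[OF measurable_pair_swap[OF ind]] by simp
  then have \<phi>_borel [measurable]: "\<phi> \<in> borel_measurable borel"
    by (simp cong: measurable_cong_sets)
  have \<phi>_le: "\<phi> \<theta> \<le> 1" for \<theta>
  proof -
    have "\<phi> \<theta> \<le> (\<integral>\<^sup>+\<beta>. 1 \<partial>(noise :: (nat \<Rightarrow> 'd torus) measure))"
      unfolding \<phi>_def by (intro nn_integral_mono) (auto split: split_indicator)
    then show ?thesis using N.emeasure_space_1 by simp
  qed
  have split: "(\<integral>\<^sup>+\<beta>. indicator A (\<beta>, \<theta>) * g \<beta> \<partial>noise) = (\<integral>\<^sup>+\<omega>. \<phi> (\<theta> + (\<Sum>j<n. \<omega> j)) * g \<omega> \<partial>noise)"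
    if g: "g \<in> borel_measurable noise" "\<And>\<omega> \<omega>'. g (comb_seq n \<omega> \<omega>') = g \<omega>"
    for n \<theta> and g :: "(nat \<Rightarrow> 'd torus) \<Rightarrow> ennreal"
  proof -
    have "indicator A (comb_seq n \<omega> \<omega>', \<theta>) = (indicator A (\<omega>', \<theta> + (\<Sum>j<n. \<omega> j)) :: ennreal)" for \<omega> \<omega>'
      using invariant_funpow[OF inv, of n "(comb_seq n \<omega> \<omega>', \<theta>)"]
      by (simp add: funpow_skew_product_comb_seq indicator_def)
    then have "(\<integral>\<^sup>+\<beta>. indicator A (\<beta>, \<theta>) * g \<beta> \<partial>noise) =
        (\<integral>\<^sup>+\<omega>. (\<integral>\<^sup>+\<omega>'. indicator A (\<omega>', \<theta> + (\<Sum>j<n. \<omega> j)) * g \<omega> \<partial>noise) \<partial>noise)"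
      using ind_\<beta>[of \<theta>] g by (subst nn_integral_noise_comb_seq[where n=n]) auto
    also have "\<dots> = (\<integral>\<^sup>+\<omega>. \<phi> (\<theta> + (\<Sum>j<n. \<omega> j)) * g \<omega> \<partial>noise)"
      unfolding \<phi>_def by (intro nn_integral_cong nn_integral_multc ind_\<beta>)
    finally show ?thesis .
  qed
  have fixed: "\<phi> \<theta> = (\<integral>\<^sup>+\<alpha>. \<phi> (\<theta> + \<alpha>) \<partial>\<mu>)" for \<theta>
  proof -
    have "\<phi> \<theta> = (\<integral>\<^sup>+\<omega>. \<phi> (\<theta> + \<omega> 0) \<partial>(noise :: (nat \<Rightarrow> 'd torus) measure))"
      using split[of "\<lambda>_. 1" 1 \<theta>] by (simp add: \<phi>_def)
    also have "\<dots> = (\<integral>\<^sup>+\<alpha>. \<phi> (\<theta> + \<alpha>) \<partial>\<mu>)"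
      by (rule nn_integral_noise_coordinate) measurable
    finally show ?thesis .
  qed
  have fin: "\<phi> \<theta> \<noteq> \<top>" for \<theta>
    using \<phi>_le[of \<theta>] by (auto simp: top_unique)
  let ?\<phi> = "\<lambda>\<theta>. enn2real (\<phi> \<theta>)"
  have "markov_op \<mu> ?\<phi> \<theta> = ?\<phi> \<theta>" for \<theta>
  proof -
    have "markov_op \<mu> ?\<phi> \<theta> = enn2real (\<integral>\<^sup>+\<alpha>. ennreal (?\<phi> (\<theta> + \<alpha>)) \<partial>\<mu>)"
      unfolding markov_op_def by (intro integral_eq_nn_integral) auto
    also have "\<dots> = enn2real (\<integral>\<^sup>+\<alpha>. \<phi> (\<theta> + \<alpha>) \<partial>\<mu>)"
      using fin by (simp add: less_top)
    finally show ?thesis by (simp only: fixed[symmetric])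
  qed
  then have "stationary_observable \<mu> m ?\<phi>"
    by (simp add: stationary_observable_def)
  moreover have "?\<phi> \<in> L_infty m"
  proof -
    have "?\<phi> \<theta> \<le> 1" for \<theta>
      using enn2real_mono[OF \<phi>_le[of \<theta>]] by simp
    then show ?thesis
      unfolding L_infty_def using \<phi>_m by (intro CollectI conjI exI[of _ 1]) auto
  qed
  ultimately obtain c' where c': "AE \<theta> in m. ?\<phi> \<theta> = c'"
    using const by blast
  define c where "c = ennreal c'"
  have c: "AE \<theta> in m. \<phi> \<theta> = c"
    using c' by eventually_elim (use fin in \<open>auto simp: c_def less_top\<close>)
  have c_translate: "AE \<theta> in m. \<phi> (\<theta> + \<alpha>) = c" for \<alpha>
    by (rule haar_AE_add[OF haar c])
  have cyl: "emeasure K (A \<inter> (X \<times> E)) = c * emeasure K (X \<times> E)"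
    if X: "X \<in> sets noise" "\<And>\<omega> \<omega>'. comb_seq n \<omega> \<omega>' \<in> X \<longleftrightarrow> \<omega> \<in> X" and E [measurable]: "E \<in> sets borel"
    for X n E
  proof -
    have XE: "X \<times> E \<in> sets K" using X E by (simp add: sets_K)
    have "emeasure K (A \<inter> (X \<times> E)) = (\<integral>\<^sup>+x. indicator (A \<inter> (X \<times> E)) x \<partial>K)"
      using A XE by (intro nn_integral_indicator[symmetric]) auto
    also have "\<dots> = (\<integral>\<^sup>+\<theta>. (\<integral>\<^sup>+\<beta>. indicator (A \<inter> (X \<times> E)) (\<beta>, \<theta>) \<partial>noise) \<partial>m)"
      using A XE by (intro nn_integral_K_m_noise) auto
    also have "\<dots> = (\<integral>\<^sup>+\<theta>. (\<integral>\<^sup>+\<beta>. indicator A (\<beta>, \<theta>) * (indicator X \<beta> * indicator E \<theta>) \<partial>noise) \<partial>m)"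
      by (intro nn_integral_cong) (auto split: split_indicator)
    also have "\<dots> = (\<integral>\<^sup>+\<theta>. (\<integral>\<^sup>+\<omega>. \<phi> (\<theta> + (\<Sum>j<n. \<omega> j)) * (indicator X \<omega> * indicator E \<theta>) \<partial>noise) \<partial>m)"
      using X by (intro nn_integral_cong split) (auto simp: indicator_def)
    also have "\<dots> = (\<integral>\<^sup>+\<omega>. (\<integral>\<^sup>+\<theta>. \<phi> (\<theta> + (\<Sum>j<n. \<omega> j)) * (indicator X \<omega> * indicator E \<theta>) \<partial>m) \<partial>noise)"
    proof (rule Nm.Fubini')
      have [measurable]: "(\<lambda>\<omega> :: nat \<Rightarrow> 'd torus. \<Sum>j<n. \<omega> j) \<in> borel_measurable noise"
        by (intro borel_measurable_torus_sum measurable_coordinate)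
      show "(\<lambda>(\<omega>, \<theta>). \<phi> (\<theta> + (\<Sum>j<n. \<omega> j)) * (indicator X \<omega> * indicator E \<theta>)) \<in> borel_measurable (noise \<Otimes>\<^sub>M m)"
        using X(1) by measurable
    qed
    also have "\<dots> = (\<integral>\<^sup>+\<omega>. (\<integral>\<^sup>+\<theta>. c * (indicator X \<omega> * indicator E \<theta>) \<partial>m) \<partial>noise)"
    proof (rule nn_integral_cong, rule nn_integral_cong_AE)
      fix \<omega> :: "nat \<Rightarrow> 'd torus"
      show "AE \<theta> in m. \<phi> (\<theta> + (\<Sum>j<n. \<omega> j)) * (indicator X \<omega> * indicator E \<theta>) = c * (indicator X \<omega> * indicator E \<theta>)"
        using c_translate[of "\<Sum>j<n. \<omega> j"] by eventually_elim simp
    qed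
    also have "\<dots> = (\<integral>\<^sup>+\<omega>. (\<integral>\<^sup>+\<theta>. c * indicator (X \<times> E) (\<omega>, \<theta>) \<partial>m) \<partial>noise)"
      by (simp add: indicator_times)
    also have "\<dots> = (\<integral>\<^sup>+x. c * indicator (X \<times> E) x \<partial>K)"
      using XE by (intro nn_integral_K_noise_m[symmetric]) auto
    also have "\<dots> = c * emeasure K (X \<times> E)"
      using XE by (rule nn_integral_cmult_indicator)
    finally show ?thesis .
  qed
  have UNIV: "(UNIV :: (nat \<Rightarrow> 'd torus) set) \<in> sets noise"
    using sets.top[of "noise :: (nat \<Rightarrow> 'd torus) measure"] by simp
  have "emeasure K A = c"
    using cyl[of UNIV 0 UNIV] UNIV K.emeasure_space_1 by simp
  show "conditional A = K"
  proof (rule K_eqI_cylinder)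
    show "sets (conditional A) = sets K" by simp
    interpret C: prob_space "conditional A" by (rule prob_conditional[OF A pos])
    show "finite_measure (conditional A)" by (rule C.finite_measure_axioms)
    fix J and F :: "nat \<Rightarrow> 'd torus set" and E :: "'d torus set"
    assume J: "finite J" and F: "\<And>j. j \<in> J \<Longrightarrow> F j \<in> sets borel" and E: "E \<in> sets borel"
    let ?X = "{\<beta>. \<forall>j\<in>J. \<beta> j \<in> F j}"
    have X: "?X \<in> sets noise" by (rule cylinder_sets[OF J F])
    obtain n where n: "\<And>j. j \<in> J \<Longrightarrow> j < n"
      using J finite_nat_set_iff_bounded[of J] by auto
    have "emeasure K (A \<inter> (?X \<times> E)) = c * emeasure K (?X \<times> E)"
      by (rule cyl[OF X _ E, of n]) (auto simp: comb_seq_less n)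
    moreover have "?X \<times> E \<in> sets K"
      using X E by (simp add: sets_K)
    ultimately have "emeasure (conditional A) (?X \<times> E) = c * emeasure K (?X \<times> E) / c"
      using A by (simp add: emeasure_conditional \<open>emeasure K A = c\<close>)
    also have "\<dots> = emeasure K (?X \<times> E)"
    proof -
      have "c \<noteq> 0" "c \<noteq> \<top>"
        using pos K.emeasure_finite[of A] by (simp_all add: \<open>emeasure K A = c\<close>)
      from ennreal_mult_divide_eq[OF this, of "emeasure K (?X \<times> E)"] show ?thesis
        by (simp only: mult.commute)
    qed
    finally show "emeasure (conditional A) (?X \<times> E) = emeasure K (?X \<times> E)" .
  qed
qed

section \<open>The two-sided skew product\<close>

text \<open>
  The factor map that forgets the coordinates of negative index.
\<close>

definition future :: "(int \<Rightarrow> 'd torus) \<times> 'd torus \<Rightarrow> (nat \<Rightarrow> 'd torus) \<times> 'd torus"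
  where "future = (\<lambda>(\<beta>, \<theta>). (\<lambda>i. \<beta> (int i), \<theta>))"

lemma measurable_future [measurable]: "future \<in> measurable K K"
proof -
  let ?N = "(noise :: (int \<Rightarrow> 'd torus) measure) \<Otimes>\<^sub>M m"
  have "(\<lambda>x. (\<lambda>i. fst x (int i), snd x)) \<in> measurable ?N (noise \<Otimes>\<^sub>M m)"
    by (intro measurable_Pair measurable_compose[OF measurable_fst measurable_reindex] measurable_snd)
  then show ?thesis
    by (simp only: skew_measure_def future_def split_beta')
qed

lemma future_skew_product: "future (skew_product x) = skew_product (future x)"
  by (cases x) (simp add: future_def skew_product_def add.commute)

lemma distr_future: "distr K K future = K"
proof (rule K_eqI_Times)
  fix X :: "(nat \<Rightarrow> 'd torus) set" and E :: "'d torus set"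
  assume X: "X \<in> sets noise" and E: "E \<in> sets borel"
  let ?\<pi> = "\<lambda>\<beta> :: int \<Rightarrow> 'd torus. \<lambda>i. \<beta> (int i)"
  have \<pi>: "?\<pi> \<in> measurable noise noise" by (rule measurable_reindex)
  have \<pi>X: "?\<pi> -` X \<in> sets noise"
    using measurable_sets[OF \<pi> X] by simp
  have XE: "X \<times> E \<in> sets K" using X E by (simp add: sets_K)
  have "emeasure (distr K K future) (X \<times> E) = emeasure K ((?\<pi> -` X) \<times> E)"
    using XE by (subst emeasure_distr[OF measurable_future]) (auto simp: future_def intro!: arg_cong[where f="emeasure K"])
  also have "\<dots> = emeasure noise (?\<pi> -` X) * emeasure m E"
    by (rule emeasure_K_Times[OF \<pi>X E])
  also have "emeasure noise (?\<pi> -` X) = emeasure (distr noise noise ?\<pi>) X"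
    using X by (subst emeasure_distr[OF \<pi>]) auto
  also have "distr noise noise ?\<pi> = noise"
    by (rule distr_noise_reindex) (auto simp: inj_def)
  finally show "emeasure (distr K K future) (X \<times> E) = emeasure noise X * emeasure m E" .
qed simp

lemma distr_conditional_skew_product:
  fixes A :: "(('i::semiring_1_cancel \<Rightarrow> 'd torus) \<times> 'd torus) set"
  assumes A: "A \<in> sets K" and inv: "skew_product -` A = A"
  shows "distr (conditional A) K skew_product = conditional A"
proof (rule measure_eqI)
  fix B assume "B \<in> sets (distr (conditional A) K (skew_product :: ('i \<Rightarrow> 'd torus) \<times> 'd torus \<Rightarrow> _))"
  then have B: "B \<in> sets K" by simp
  have T: "skew_product \<in> measurable (conditional A) K"
    using measurable_skew_product by (simp cong: measurable_cong_sets)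
  have TB: "skew_product -` B \<in> sets (K :: (('i \<Rightarrow> 'd torus) \<times> 'd torus) measure)"
    using measurable_sets[OF measurable_skew_product B] by simp
  have "emeasure (distr (conditional A) K skew_product) B = emeasure (conditional A) (skew_product -` B)"
    using B by (subst emeasure_distr[OF T]) auto
  also have "\<dots> = emeasure K (A \<inter> skew_product -` B) / emeasure K A"
    by (rule emeasure_conditional[OF A TB])
  also have "A \<inter> skew_product -` B = skew_product -` (A \<inter> B)"
    using inv by auto
  also have "emeasure K (skew_product -` (A \<inter> B)) = emeasure (distr K K skew_product) (A \<inter> B)"
    using A B by (subst emeasure_distr[OF measurable_skew_product]) auto
  also have "\<dots> = emeasure K (A \<inter> B)"
    by (simp only: distr_skew_product)
  also have "\<dots> / emeasure K A = emeasure (conditional A) B"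
    by (rule emeasure_conditional[OF A B, symmetric])
  finally show "emeasure (distr (conditional A) K skew_product) B = emeasure (conditional A) B" .
qed simp

lemma emeasure_vimage_funpow:
  assumes T: "T \<in> measurable M M" "distr M M T = M" and B: "B \<in> sets M"
  shows "emeasure M ((T ^^ n) -` B \<inter> space M) = emeasure M B"
proof -
  have meas: "T ^^ n \<in> measurable M M" for n
    by (induction n) (use T in \<open>auto simp: id_def comp_def intro: measurable_compose\<close>)
  have "distr M M (T ^^ n) = M"
  proof (induction n)
    case (Suc n)
    have "distr M M (T ^^ Suc n) = distr (distr M M (T ^^ n)) M T"
      unfolding funpow.simps by (rule distr_distr[OF T(1) meas, symmetric])
    then show ?case unfolding Suc T .
  qed (simp add: distr_id id_def)
  then show ?thesis
    using emeasure_distr[OF meas B, of n] by simp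
qed

text \<open>
  The law of the future under the conditional measure is invariant and absolutely continuous, hence
  the product measure. A general cylinder depends on the future after finitely many steps of the
  skew product, and these preserve both measures.
\<close>

lemma one_sided_imp_two_sided_ergodic:
  assumes erg: "ergodic (K :: ((nat \<Rightarrow> 'd torus) \<times> 'd torus) measure) skew_product"
  shows "ergodic (K :: ((int \<Rightarrow> 'd torus) \<times> 'd torus) measure) skew_product"
proof (rule ergodicI_conditional)
  fix A :: "((int \<Rightarrow> 'd torus) \<times> 'd torus) set"
  assume A: "A \<in> sets K" and inv: "skew_product -` A = A" and pos: "emeasure K A \<noteq> 0"
  interpret C: prob_space "conditional A" by (rule prob_conditional[OF A pos])
  have fut: "future \<in> measurable (conditional A) K"
    using measurable_future by (simp cong: measurable_cong_sets)
  have T: "skew_product \<in> measurable (conditional A) K" "skew_product \<in> measurable (conditional A) (conditional A)"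
    using measurable_skew_product by (simp_all cong: measurable_cong_sets)
  have vim: "future -` B \<in> sets K" if "B \<in> sets K" for B
    using measurable_sets[OF measurable_future that] by simp
  have dens: "distr (conditional A) K future = K"
  proof (rule ergodic_unique_invariant_density[OF erg prob_K])
    show "prob_space (distr (conditional A) K future)"
      by (rule C.prob_space_distr[OF fut])
    show "absolutely_continuous K (distr (conditional A) K future)"
      unfolding absolutely_continuous_def
    proof
      fix B assume B: "B \<in> null_sets (K :: ((nat \<Rightarrow> 'd torus) \<times> 'd torus) measure)"
      then have B': "B \<in> sets K" by auto
      have "emeasure K (future -` B) = emeasure (distr K K future) B"
        using B' by (subst emeasure_distr[OF measurable_future]) auto
      also have "\<dots> = 0" using B by (simp add: distr_future null_sets_def)
      finally have "emeasure K (A \<inter> future -` B) = 0"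
        using emeasure_mono[of "A \<inter> future -` B" "future -` B" K] vim[OF B'] by simp
      then have "emeasure (conditional A) (future -` B) = 0"
        by (simp add: emeasure_conditional[OF A vim[OF B']])
      then show "B \<in> null_sets (distr (conditional A) K future)"
        using B' by (simp add: null_sets_def emeasure_distr[OF fut])
    qed
    have "distr (distr (conditional A) K future) K skew_product = distr (conditional A) K (skew_product \<circ> future)"
      by (rule distr_distr[OF measurable_skew_product fut])
    also have "skew_product \<circ> future = future \<circ> skew_product"
      by (simp add: fun_eq_iff future_skew_product)
    also have "distr (conditional A) K (future \<circ> skew_product) = distr (distr (conditional A) K skew_product) K future"
      by (rule distr_distr[OF measurable_future T(1), symmetric])
    also have "\<dots> = distr (conditional A) K future"
      by (simp only: distr_conditional_skew_product[OF A inv])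
    finally show "distr (distr (conditional A) K future) K skew_product = distr (conditional A) K future" .
  qed simp
  have future_eq: "emeasure (conditional A) (future -` B) = emeasure K (future -` B)" if "B \<in> sets K" for B
    using arg_cong[OF dens, of "\<lambda>M. emeasure M B"] arg_cong[OF distr_future, of "\<lambda>M. emeasure M B"] that
    by (simp add: emeasure_distr[OF fut] emeasure_distr[OF measurable_future])
  show "conditional A = K"
  proof (rule K_eqI_cylinder)
    show "sets (conditional A) = sets K" by simp
    show "finite_measure (conditional A)" by (rule C.finite_measure_axioms)
    fix J and F :: "int \<Rightarrow> 'd torus set" and E :: "'d torus set"
    assume J: "finite J" and F: "\<And>j. j \<in> J \<Longrightarrow> F j \<in> sets borel" and E: "E \<in> sets borel"
    let ?Y = "{\<beta>. \<forall>j\<in>J. \<beta> j \<in> F j} \<times> E"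
    have Y: "?Y \<in> sets K"
      using cylinder_sets[OF J F] E by (simp add: sets_K)
    \<comment> \<open>Shifting by \<open>n\<close> makes all indices in \<open>J\<close> nonnegative; inserting \<open>0\<close> covers empty \<open>J\<close>.\<close>
    define n where "n = nat (Max (insert 0 (uminus ` J)))"
    have n: "0 \<le> j + int n" if "j \<in> J" for j
    proof -
      have "- j \<le> Max (insert 0 (uminus ` J))"
        using J that by (intro Max_ge) auto
      then show ?thesis by (simp add: n_def)
    qed
    define B where "B = {x :: (nat \<Rightarrow> 'd torus) \<times> 'd torus. (\<forall>j\<in>J. fst x (nat (j + int n)) \<in> F j) \<and> snd x + (\<Sum>i<n. fst x i) \<in> E}"
    have B: "B \<in> sets K"
    proof -
      let ?N = "(noise :: (nat \<Rightarrow> 'd torus) measure) \<Otimes>\<^sub>M m"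
      have coord [measurable]: "(\<lambda>x. fst x i) \<in> borel_measurable ?N" for i
        by (rule measurable_compose[OF measurable_fst measurable_coordinate])
      have [measurable]: "(\<lambda>x. snd x) \<in> borel_measurable ?N"
        using measurable_snd[of "noise :: (nat \<Rightarrow> 'd torus) measure" m] by (simp cong: measurable_cong_sets)
      have [measurable]: "(\<lambda>x. snd x + (\<Sum>i<n. fst x i)) \<in> borel_measurable ?N"
        by (intro borel_measurable_torus_add borel_measurable_torus_sum coord) measurable
      have "{x \<in> space ?N. (\<forall>j\<in>J. fst x (nat (j + int n)) \<in> F j) \<and> snd x + (\<Sum>i<n. fst x i) \<in> E} \<in> sets ?N"
        using J F E by measurable
      then show ?thesis
        by (simp add: B_def sets_K space_pair_measure)
    qed
    have shift: "(skew_product ^^ n) -` ?Y = future -` B"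
    proof (intro set_eqI)
      fix x :: "(int \<Rightarrow> 'd torus) \<times> 'd torus"
      obtain \<beta> \<theta> where x: "x = (\<beta>, \<theta>)" by (cases x)
      have "\<beta> (int (nat (j + int n))) = \<beta> (j + int n)" if "j \<in> J" for j
        using n[OF that] by simp
      then show "x \<in> (skew_product ^^ n) -` ?Y \<longleftrightarrow> x \<in> future -` B"
        by (auto simp: x funpow_skew_product future_def B_def)
    qed
    have "emeasure (conditional A) ?Y = emeasure (conditional A) ((skew_product ^^ n) -` ?Y)"
      using emeasure_vimage_funpow[OF T(2), of ?Y n] distr_conditional_skew_product[OF A inv] Y
      by (simp cong: distr_cong)
    also have "\<dots> = emeasure K ((skew_product ^^ n) -` ?Y)"
      unfolding shift by (rule future_eq[OF B])
    also have "\<dots> = emeasure K ?Y"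
      using emeasure_vimage_funpow[OF measurable_skew_product distr_skew_product Y, of n] by simp
    finally show "emeasure (conditional A) ?Y = emeasure K ?Y" .
  qed
qed

end

theorem theorem2p3:
  fixes \<mu> m :: "'d::finite torus measure"
  assumes mu: "borel_prob \<mu>"
    and haar: "haar_prob m"
  shows "all_equivalent [
    ergodic (skew_measure \<mu> m :: ((int \<Rightarrow> 'd torus) \<times> 'd torus) measure) skew_product,
    ergodic (skew_measure \<mu> m :: ((nat \<Rightarrow> 'd torus) \<times> 'd torus) measure) skew_product,
    (\<forall>\<phi>\<in>L_infty m. stationary_observable \<mu> m \<phi> \<longrightarrow> (\<exists>c. AE \<theta> in m. \<phi> \<theta> = c)),
    (\<forall>k. k \<noteq> 0 \<longrightarrow> fourier_coeff \<mu> k \<noteq> 1),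
    (\<forall>k. k \<noteq> 0 \<longrightarrow> (\<exists>\<alpha>\<in>supp_measure \<mu>. int_pairing k \<alpha> \<noteq> 0)),
    UNIV = closure (\<Union>n\<in>{1..}. set_multiple (supp_measure \<mu>) n),
    stationary_measure \<mu> m \<and> (\<forall>\<eta>. stationary_measure \<mu> \<eta> \<longrightarrow> \<eta> = m),
    (\<forall>\<phi>. continuous_on UNIV \<phi> \<longrightarrow>
      (\<forall>\<theta>. (\<lambda>n. 1 / real n * (\<Sum>j<n. (markov_op \<mu> ^^ j) \<phi> \<theta>))
        \<longlonglongrightarrow> (\<integral>\<theta>'. \<phi> \<theta>' \<partial>m)))]"
    (is "all_equivalent [?P1, ?P2, ?P3, ?P4, ?P5, ?P6, ?P7, ?P8]")
proof -
  interpret torus_walk \<mu> m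
    by unfold_locales (rule mu, rule haar)
  have 21: ?P1 if ?P2
    using that by (rule one_sided_imp_two_sided_ergodic)
  have 14: ?P4 if ?P1
    by (intro allI impI) (rule ergodic_imp_fourier_coeff_ne_1[OF that])
  have 32: ?P2 if ?P3
    by (rule observables_const_imp_ergodic_one_sided) (use that in blast)
  have 43: ?P3 if ?P4
    by (intro ballI impI, rule stationary_observable_const[OF mu haar]) (use that in auto)
  have 45: "?P4 \<longleftrightarrow> ?P5"
    by (simp add: fourier_coeff_eq_1_iff_supp[OF mu])
  have 48: ?P8 if ?P4
    by (intro allI impI, rule averages_converge[OF mu haar]) (use that in auto)
  have 86: ?P6 if ?P8
    by (rule averages_imp_dense_sums[OF mu haar]) (use that in simp)
  have 65: ?P5 if ?P6
    by (intro allI impI) (rule dense_sums_imp_pairing_nonzero[OF that])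
  have 47: ?P7 if ?P4
  proof (intro conjI allI impI)
    show "stationary_measure \<mu> m" by (rule stationary_haar[OF mu haar])
    show "\<eta> = m" if "stationary_measure \<mu> \<eta>" for \<eta>
      by (rule stationary_measure_unique[OF mu haar _ that]) (use \<open>?P4\<close> in simp)
  qed
  have 74: ?P4 if ?P7
  proof (intro allI impI notI)
    fix k :: "int ^ 'd" assume "k \<noteq> 0" "fourier_coeff \<mu> k = 1"
    from stationary_density[OF mu haar this] show False
      using that by auto
  qed
  have "?P1 \<longleftrightarrow> ?P4" "?P2 \<longleftrightarrow> ?P4" "?P3 \<longleftrightarrow> ?P4" "?P5 \<longleftrightarrow> ?P4" "?P6 \<longleftrightarrow> ?P4" "?P7 \<longleftrightarrow> ?P4" "?P8 \<longleftrightarrow> ?P4"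
    using 21 14 32 43 45 48 86 65 47 74 by argo+
  then show ?thesis
    unfolding all_equivalent_def list.set by auto
qed

end
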